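(* Let $(M,\omega)$ be a symplectic manifold and $X\subseteq Y\subseteq M$ closed subsets. Then the map $\Vert\cdot\Vert_X^{Y,\omega}:\operatorname{Ham}(X,\omega)\to[0,\infty]$ is a semi-norm on the group $\operatorname{Ham}(X,\omega)$. Furthermore, let $Y'\subseteq M$ be a closed subset such that $Y$ is contained in the interior of $Y'$. If $Y$ is compact and non-empty, then $$\Vert\varphi\Vert_X^{Y,\omega}\ \ge\ \Vert\varphi\Vert_X^{Y',\omega}\qquad\text{for every }\varphi\in\operatorname{Ham}(X,\omega).$$
   Context: All manifolds are smooth with empty boundary. For a time-dependent vector field $V:[0,1]\times M\to TM$ let $\mathcal{D}_V^t$ be the set of $x_0\in M$ for which $\dot x(s)=V(s,x(s))$, $x(0)=x_0$ has a solution $x\in C^\infty([0,t],M)$, and put $\varphi_V^t(x_0):=x(t)$ on $\mathcal{D}_V^t$. For $H\in C^\infty([0,1]\times M,\mathbb{R})$, $H^t:=H(t,\cdot)$, the Hamiltonian vector field is given by $\omega(X_{H^t},\cdot)=dH^t$, and $\varphi_H^t:=\varphi_{X_H}^t$. For a closed subset $X\subseteq M$, $V$ is called $X$-compatible iff $X\subseteq\mathcal{D}_V^1$ and $\varphi_V^t(X)=X$ for every $t\in[0,1]$. Define $\mathcal{H}(M,\omega,X):=\{H\in C^\infty([0,1]\times M,\mathbb{R})\mid X_H \text{ is } X\text{-compatible}\}$ and $\operatorname{Ham}(X,\omega):=\{\varphi_H^1|_X\mid H\in\mathcal{H}(M,\omega,X)\}$, which is a group under composition. Put $\Vert H\Vert_X:=\int_0^1\big(\sup_X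 H^t-\inf_X H^t\big)dt\in[0,\infty]$ and, for $\varphi\in\operatorname{Ham}(X,\omega)$, $\Vert\varphi\Vert^{X,\omega}:=\inf\{\Vert H\Vert_X\mid H\in\mathcal{H}(M,\omega,X),\ \varphi_H^1|_X=\varphi\}$. For closed $X\subseteq Y$ and $\varphi\in\operatorname{Ham}(X,\omega)$ put $\Vert\varphi\Vert_X^{Y,\omega}:=\inf\{\Vert\psi\Vert^{Y,\omega}\mid\psi\in\operatorname{Ham}(Y,\omega),\ \psi|_X=\varphi\}$ (with $\inf\emptyset=\infty$). A semi-norm on a group $G$ is a map $\Vert\cdot\Vert:G\to[0,\infty]$ with $\Vert\mathbf 1\Vert=0$, $\Vert g^{-1}\Vert=\Vert g\Vert$ and $\Vert gh\Vert\le\Vert g\Vert+\Vert h\Vert$ for all $g,h\in G$. *)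

theory Defs
  imports "HOL-Analysis.Analysis" "HOL-Algebra.Group"
begin

section \<open>Smooth maps between finite-dimensional vector spaces\<close>

text \<open>The derivatives are full Frechet derivatives, so this is meant for open sets only.\<close>

fun Ck_on :: "nat \<Rightarrow> 'a::real_normed_vector set \<Rightarrow> ('a \<Rightarrow> 'b::real_normed_vector) \<Rightarrow> bool" where
  "Ck_on 0 S f \<longleftrightarrow> continuous_on S f"
| "Ck_on (Suc k) S f \<longleftrightarrow> (\<forall>x\<in>S. f differentiable (at x)) \<and>
     (\<forall>v. Ck_on k S (\<lambda>x. frechet_derivative f (at x) v))"

text \<open>On an arbitrary set, such as \<open>{0..1} \<times> V\<close> with \<open>V\<close> open, smoothness means local
  extendability to a smooth map on an open set.\<close>

definition smooth_on :: "'a::real_normed_vector set \<Rightarrow> ('a \<Rightarrow> 'b::real_normed_vector) \<Rightarrow> bool" where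
  "smooth_on S f \<longleftrightarrow> (\<forall>x\<in>S. \<exists>U g. open U \<and> x \<in> U \<and> (\<forall>k. Ck_on k U g) \<and> (\<forall>y\<in>S \<inter> U. g y = f y))"

section \<open>Smooth manifolds\<close>

text \<open>A chart is a pair of a domain and a coordinate map; values of the coordinate map outside the
  domain are irrelevant. The model space \<open>'b\<close> is a real inner product space in which bounded sets
  are relatively compact, that is, a finite-dimensional Euclidean space. The class
  \<^class>\<open>euclidean_space\<close> would exclude dimension 0.\<close>

type_synonym ('a, 'b) chart = "'a set \<times> ('a \<Rightarrow> 'b)"

definition chart_inv :: "('a, 'b) chart \<Rightarrow> 'b \<Rightarrow> 'a" where
  "chart_inv c = inv_into (fst c) (snd c)"

definition transition :: "('a, 'b) chart \<Rightarrow> ('a, 'b) chart \<Rightarrow> 'b \<Rightarrow> 'b" where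
  "transition c d = snd d \<circ> chart_inv c"

definition charts_at :: "('a, 'b) chart set \<Rightarrow> 'a \<Rightarrow> ('a, 'b) chart set" where
  "charts_at A p = {c \<in> A. p \<in> fst c}"

locale smooth_manifold =
  fixes M :: "'a topology"
    and A :: "('a, 'b::{real_inner, heine_borel}) chart set"
  assumes Hausdorff: "Hausdorff_space M"
    and second_countable: "second_countable M"
    and chart_domain: "c \<in> A \<Longrightarrow> openin M (fst c)"
    and chart_image: "c \<in> A \<Longrightarrow> open (snd c ` fst c)"
    and chart_homeomorphic:
      "c \<in> A \<Longrightarrow> homeomorphic_map (subtopology M (fst c)) (top_of_set (snd c ` fst c)) (snd c)"
    and charts_cover: "\<Union> (fst ` A) = topspace M"
    and transition_smooth:
      "\<lbrakk>c \<in> A; d \<in> A\<rbrakk> \<Longrightarrow> smooth_on (snd c ` (fst c \<inter> fst d)) (transition c d)"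

text \<open>A tangent vector at \<open>p\<close> is the family of its coordinate vectors in all charts of the atlas
  around \<open>p\<close>, related by the derivatives of the transition maps. Components at other charts are 0,
  so that the representation is unique; the linear structure is componentwise.\<close>

type_synonym ('a, 'b) tvec = "('a, 'b) chart \<Rightarrow> 'b"

definition tangent_space ::
  "('a, 'b::real_normed_vector) chart set \<Rightarrow> 'a \<Rightarrow> ('a, 'b) tvec set" where
  "tangent_space A p = {v.
     (\<forall>c\<in>charts_at A p. \<forall>d\<in>charts_at A p.
        v d = frechet_derivative (transition c d) (at (snd c p)) (v c)) \<and>
     (\<forall>c. c \<notin> charts_at A p \<longrightarrow> v c = 0)}"

text \<open>The tangent vector at \<open>p\<close> with coordinate vector \<open>u\<close> in the chart \<open>c\<close> around \<open>p\<close>.\<close>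

definition coord_tvec ::
  "('a, 'b::real_normed_vector) chart set \<Rightarrow> ('a, 'b) chart \<Rightarrow> 'a \<Rightarrow> 'b \<Rightarrow> ('a, 'b) tvec" where
  "coord_tvec A c p u = (\<lambda>d. if d \<in> charts_at A p
     then frechet_derivative (transition c d) (at (snd c p)) u else 0)"

text \<open>For smooth \<open>f\<close> and \<open>v\<close> tangent at \<open>p\<close> this does not depend on the chosen chart.\<close>

definition differential ::
  "('a, 'b::real_normed_vector) chart set \<Rightarrow> ('a \<Rightarrow> real) \<Rightarrow> 'a \<Rightarrow> ('a, 'b) tvec \<Rightarrow> real" where
  "differential A f p v = (let c = SOME c. c \<in> charts_at A p in
     frechet_derivative (f \<circ> chart_inv c) (at (snd c p)) (v c))"

section \<open>Symplectic manifolds\<close>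

definition form_coeff ::
  "('a, 'b::real_normed_vector) chart set \<Rightarrow> ('a \<Rightarrow> ('a, 'b) tvec \<Rightarrow> ('a, 'b) tvec \<Rightarrow> real) \<Rightarrow>
   ('a, 'b) chart \<Rightarrow> 'b \<Rightarrow> 'b \<Rightarrow> 'b \<Rightarrow> real" where
  "form_coeff A \<omega> c u v y =
     (let p = chart_inv c y in \<omega> p (coord_tvec A c p u) (coord_tvec A c p v))"

text \<open>The axiom \<open>form_closed\<close> is \<open>d\<omega> = 0\<close> evaluated on coordinate vector fields, whose Lie brackets
  vanish.\<close>

locale symplectic_manifold = smooth_manifold M A
  for M :: "'a topology" and A :: "('a, 'b::{real_inner, heine_borel}) chart set" +
  fixes \<omega> :: "'a \<Rightarrow> ('a, 'b) tvec \<Rightarrow> ('a, 'b) tvec \<Rightarrow> real"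
  assumes form_linear:
      "\<lbrakk>p \<in> topspace M; u \<in> tangent_space A p; v \<in> tangent_space A p; w \<in> tangent_space A p\<rbrakk>
       \<Longrightarrow> \<omega> p (\<lambda>c. a *\<^sub>R u c + b *\<^sub>R v c) w = a * \<omega> p u w + b * \<omega> p v w"
    and form_skew:
      "\<lbrakk>p \<in> topspace M; u \<in> tangent_space A p; v \<in> tangent_space A p\<rbrakk> \<Longrightarrow> \<omega> p u v = - \<omega> p v u"
    and form_smooth: "c \<in> A \<Longrightarrow> smooth_on (snd c ` fst c) (form_coeff A \<omega> c u' v')"
    and form_closed:
      "\<lbrakk>c \<in> A; y \<in> snd c ` fst c\<rbrakk> \<Longrightarrow>
         frechet_derivative (form_coeff A \<omega> c v' w') (at y) u'
       - frechet_derivative (form_coeff A \<omega> c u' w') (at y) v'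
       + frechet_derivative (form_coeff A \<omega> c u' v') (at y) w' = 0"
    and form_nondegenerate:
      "\<lbrakk>p \<in> topspace M; v \<in> tangent_space A p; \<And>w. w \<in> tangent_space A p \<Longrightarrow> \<omega> p v w = 0\<rbrakk>
       \<Longrightarrow> v = (\<lambda>c. 0)"

section \<open>Flows of time-dependent vector fields\<close>

definition smooth_curve ::
  "'a topology \<Rightarrow> ('a, 'b::real_normed_vector) chart set \<Rightarrow> real \<Rightarrow> (real \<Rightarrow> 'a) \<Rightarrow> bool" where
  "smooth_curve M A t x \<longleftrightarrow> continuous_map (top_of_set {0..t}) M x \<and>
     (\<forall>c\<in>A. smooth_on {s \<in> {0..t}. x s \<in> fst c} (snd c \<circ> x))"

definition integral_curve ::
  "'a topology \<Rightarrow> ('a, 'b::real_normed_vector) chart set \<Rightarrow> (real \<Rightarrow> 'a \<Rightarrow> ('a, 'b) tvec) \<Rightarrow>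
   real \<Rightarrow> (real \<Rightarrow> 'a) \<Rightarrow> bool" where
  "integral_curve M A V t x \<longleftrightarrow> smooth_curve M A t x \<and>
     (\<forall>s\<in>{0..t}. \<forall>c\<in>charts_at A (x s).
        ((snd c \<circ> x) has_vector_derivative V s (x s) c) (at s within {0..t}))"

definition flow_domain ::
  "'a topology \<Rightarrow> ('a, 'b::real_normed_vector) chart set \<Rightarrow> (real \<Rightarrow> 'a \<Rightarrow> ('a, 'b) tvec) \<Rightarrow>
   real \<Rightarrow> 'a set" where
  "flow_domain M A V t = {x0. \<exists>x. integral_curve M A V t x \<and> x 0 = x0}"

definition flow ::
  "'a topology \<Rightarrow> ('a, 'b::real_normed_vector) chart set \<Rightarrow> (real \<Rightarrow> 'a \<Rightarrow> ('a, 'b) tvec) \<Rightarrow>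
   real \<Rightarrow> 'a \<Rightarrow> 'a" where
  "flow M A V t x0 = (THE y. \<exists>x. integral_curve M A V t x \<and> x 0 = x0 \<and> x t = y)"

definition compatible ::
  "'a topology \<Rightarrow> ('a, 'b::real_normed_vector) chart set \<Rightarrow> (real \<Rightarrow> 'a \<Rightarrow> ('a, 'b) tvec) \<Rightarrow>
   'a set \<Rightarrow> bool" where
  "compatible M A V X \<longleftrightarrow> X \<subseteq> flow_domain M A V 1 \<and> (\<forall>t\<in>{0..1}. flow M A V t ` X = X)"

section \<open>Hamiltonian diffeomorphisms and Hofer norms of closed subsets\<close>

text \<open>Functions on \<open>[0,1] \<times> M\<close> are curried; values at other times or outside \<open>M\<close> are irrelevant.\<close>

definition smooth_time_fun ::
  "('a, 'b::real_normed_vector) chart set \<Rightarrow> (real \<Rightarrow> 'a \<Rightarrow> real) \<Rightarrow> bool" where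
  "smooth_time_fun A H \<longleftrightarrow>
     (\<forall>c\<in>A. smooth_on ({0..1} \<times> snd c ` fst c) (\<lambda>(t, y). H t (chart_inv c y)))"

definition ham_vf ::
  "('a, 'b::real_normed_vector) chart set \<Rightarrow> ('a \<Rightarrow> ('a, 'b) tvec \<Rightarrow> ('a, 'b) tvec \<Rightarrow> real) \<Rightarrow>
   (real \<Rightarrow> 'a \<Rightarrow> real) \<Rightarrow> real \<Rightarrow> 'a \<Rightarrow> ('a, 'b) tvec" where
  "ham_vf A \<omega> H t p = (THE v. v \<in> tangent_space A p \<and>
     (\<forall>w\<in>tangent_space A p. \<omega> p v w = differential A (H t) p w))"

definition ham_flow ::
  "'a topology \<Rightarrow> ('a, 'b::real_normed_vector) chart set \<Rightarrow>
   ('a \<Rightarrow> ('a, 'b) tvec \<Rightarrow> ('a, 'b) tvec \<Rightarrow> real) \<Rightarrow> (real \<Rightarrow> 'a \<Rightarrow> real) \<Rightarrow> real \<Rightarrow> 'a \<Rightarrow> 'a" where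
  "ham_flow M A \<omega> H = flow M A (ham_vf A \<omega> H)"

definition Ham_fun ::
  "'a topology \<Rightarrow> ('a, 'b::real_normed_vector) chart set \<Rightarrow>
   ('a \<Rightarrow> ('a, 'b) tvec \<Rightarrow> ('a, 'b) tvec \<Rightarrow> real) \<Rightarrow> 'a set \<Rightarrow> (real \<Rightarrow> 'a \<Rightarrow> real) set" where
  "Ham_fun M A \<omega> X = {H. smooth_time_fun A H \<and> compatible M A (ham_vf A \<omega> H) X}"

definition Ham ::
  "'a topology \<Rightarrow> ('a, 'b::real_normed_vector) chart set \<Rightarrow>
   ('a \<Rightarrow> ('a, 'b) tvec \<Rightarrow> ('a, 'b) tvec \<Rightarrow> real) \<Rightarrow> 'a set \<Rightarrow> ('a \<Rightarrow> 'a) set" where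
  "Ham M A \<omega> X = {restrict (ham_flow M A \<omega> H 1) X | H. H \<in> Ham_fun M A \<omega> X}"

definition Ham_group ::
  "'a topology \<Rightarrow> ('a, 'b::real_normed_vector) chart set \<Rightarrow>
   ('a \<Rightarrow> ('a, 'b) tvec \<Rightarrow> ('a, 'b) tvec \<Rightarrow> real) \<Rightarrow> 'a set \<Rightarrow> ('a \<Rightarrow> 'a) monoid" where
  "Ham_group M A \<omega> X =
     \<lparr>carrier = Ham M A \<omega> X, mult = (\<lambda>\<phi> \<psi>. compose X \<phi> \<psi>), one = restrict id X\<rparr>"

text \<open>For \<open>X \<noteq> {}\<close> the supremum is at least the infimum, so \<^const>\<open>e2ennreal\<close> is a mere change of type.
  For \<open>X = {}\<close> it turns \<open>-\<infinity> - \<infinity> = -\<infinity>\<close> into 0, which keeps the norm in \<open>[0,\<infinity>]\<close>.\<close>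

definition osc_norm :: "'a set \<Rightarrow> (real \<Rightarrow> 'a \<Rightarrow> real) \<Rightarrow> ennreal" where
  "osc_norm X H = (\<integral>\<^sup>+t\<in>{0..1}.
     e2ennreal ((SUP x\<in>X. ereal (H t x)) - (INF x\<in>X. ereal (H t x))) \<partial>lborel)"

definition hofer_norm ::
  "'a topology \<Rightarrow> ('a, 'b::real_normed_vector) chart set \<Rightarrow>
   ('a \<Rightarrow> ('a, 'b) tvec \<Rightarrow> ('a, 'b) tvec \<Rightarrow> real) \<Rightarrow> 'a set \<Rightarrow> ('a \<Rightarrow> 'a) \<Rightarrow> ennreal" where
  "hofer_norm M A \<omega> X \<phi> =
     Inf {osc_norm X H | H. H \<in> Ham_fun M A \<omega> X \<and> restrict (ham_flow M A \<omega> H 1) X = \<phi>}"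

definition rel_hofer_norm ::
  "'a topology \<Rightarrow> ('a, 'b::real_normed_vector) chart set \<Rightarrow>
   ('a \<Rightarrow> ('a, 'b) tvec \<Rightarrow> ('a, 'b) tvec \<Rightarrow> real) \<Rightarrow> 'a set \<Rightarrow> 'a set \<Rightarrow> ('a \<Rightarrow> 'a) \<Rightarrow> ennreal" where
  "rel_hofer_norm M A \<omega> X Y \<phi> =
     Inf {hofer_norm M A \<omega> Y \<psi> | \<psi>. \<psi> \<in> Ham M A \<omega> Y \<and> restrict \<psi> X = \<phi>}"

locale group_seminorm = group G for G :: "('g, 'more) monoid_scheme" (structure) +
  fixes N :: "'g \<Rightarrow> ennreal"
  assumes seminorm_one: "N \<one> = 0"
    and seminorm_inv: "g \<in> carrier G \<Longrightarrow> N (inv g) = N g"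
    and seminorm_mult: "\<lbrakk>g \<in> carrier G; h \<in> carrier G\<rbrakk> \<Longrightarrow> N (g \<otimes> h) \<le> N g + N h"

end

theory Submission
  imports Defs
begin

text \<open>The semi-norm property only needs time reparametrisations: if \<open>x\<close> is an integral curve of
  \<open>X\<^sub>H\<close>, then \<open>x \<circ> \<rho>\<close> is one of the Hamiltonian \<open>\<rho>'(t) H(\<rho>(t), \<cdot>)\<close>. With \<open>\<rho>(t) = 1 - t\<close> this yields
  inverses, and with two monotone steps that are flat at their ends and act one after the other it
  yields products. By substitution the oscillation norm is invariant and subadditive, and no flow is
  needed outside the set on which it is assumed to exist.

  For the comparison of \<open>Y\<close> with \<open>Y'\<close>, fix \<open>y\<^sub>0 \<in> Y\<close> and replace \<open>H\<close> by \<open>\<kappa> \<cdot> (H - H(\<cdot>, y\<^sub>0))\<close>, where the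
  cutoff \<open>\<kappa>\<close> is 1 near \<open>Y\<close> and has compact support in the interior of \<open>Y'\<close>, close enough to \<open>Y\<close> for the
  oscillation to grow by at most \<open>2\<epsilon>\<close>. Its flow is complete, agrees with the old one on \<open>Y\<close>, and
  fixes all points outside \<open>Y'\<close>, hence preserves \<open>Y'\<close>.\<close>

section \<open>Orthonormal bases\<close>

text \<open>The usual Hamiltonian of a product, \<open>H t + K t o (flow of H at time t)^-1\<close>,
  is out of reach: the flow of \<open>H\<close> is known on \<open>X\<close> only, so this is no
  function on \<open>M\<close>. Running the two Hamiltonians in disjoint time intervals uses nothing
  but curves inside \<open>X\<close>. Subtracting \<open>H(t, y0)\<close> is what makes the cutoff
  cheap: afterwards 0 is a value on \<open>Y\<close>, and cutting off moves values only towards 0.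
  Compactness of \<open>Y\<close> gives a cutoff of compact support, and with it a complete flow.
  Much of the length is due to two features of \<open>X_H\<close>. It is given implicitly by
  \<open>\<omega>\<close>, so its smoothness is that of the solution of a linear equation with a
  parameter. And smoothness on \<open>[0,1]\<close> means local extendability past the times 0 and
  1, so every argument about differential equations passes to a local extension of the field in a
  chart. The model space is finite-dimensional only in the sense that bounded sets are relatively
  compact; an orthonormal basis extracted from this replaces coordinates throughout.\<close>

definition orthonormal_basis :: "'b::real_inner set \<Rightarrow> bool" where
  "orthonormal_basis B \<longleftrightarrow> finite B \<and> (\<forall>e\<in>B. \<forall>f\<in>B. e \<bullet> f = (if e = f then 1 else 0)) \<and>
     (\<forall>x. (\<Sum>e\<in>B. (x \<bullet> e) *\<^sub>R e) = x)"

text \<open>Distinct orthonormal vectors are at distance sqrt 2, so a finite cover of the compact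
  unit sphere by balls of radius 1/2 bounds the size of orthonormal sets. One of maximal size spans:
  otherwise the normalised remainder \<open>u\<close> of an expansion could be added to it.\<close>

lemma orthonormal_basis_exists:
  "\<exists>B::'b::{real_inner, heine_borel} set. orthonormal_basis B"
proof -
  define ON where "ON B \<longleftrightarrow> finite B \<and> (\<forall>e\<in>B. \<forall>f\<in>B. e \<bullet> f = (if e = f then 1 else 0))"
    for B :: "'b set"
  have "bounded (sphere (0::'b) 1)" by (rule bounded_subset[OF bounded_cball[of 0 1]]) auto
  moreover have "closed (sphere (0::'b) 1)"
    unfolding sphere_def by (intro closed_Collect_eq continuous_intros)
  ultimately have "compact (sphere (0::'b) 1)" by (simp add: compact_eq_bounded_closed)
  then obtain T where T: "finite T" "T \<subseteq> sphere (0::'b) 1" "sphere (0::'b) 1 \<subseteq> (\<Union>x\<in>T. ball x (1/2))"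
    using compactE_image[of "sphere (0::'b) 1" "sphere 0 1" "\<lambda>x. ball x (1/2)"] by force
  have bound: "card B \<le> card T" if "ON B" for B
  proof -
    have "\<forall>e\<in>B. \<exists>x\<in>T. dist x e < 1/2"
    proof
      fix e assume "e \<in> B"
      then have "norm e = 1" using that by (auto simp: ON_def norm_eq_sqrt_inner)
      then show "\<exists>x\<in>T. dist x e < 1/2" using T(3) by (force simp: subset_iff)
    qed
    then obtain h where h: "\<And>e. e \<in> B \<Longrightarrow> h e \<in> T \<and> dist (h e) e < 1/2" by metis
    have "inj_on h B"
    proof (rule inj_onI, rule ccontr)
      fix e f assume ef: "e \<in> B" "f \<in> B" "h e = h f" "e \<noteq> f"
      have "dist e f < 1" using h[OF ef(1)] h[OF ef(2)] ef(3)
        by (smt (verit) dist_commute dist_triangle field_sum_of_halves)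
      then have "(norm (e - f))\<^sup>2 < 1" by (simp add: dist_norm power_less_one_iff)
      moreover have "(norm (e - f))\<^sup>2 = 2" using that ef
        by (auto simp: ON_def power2_norm_eq_inner algebra_simps)
      ultimately show False by simp
    qed
    then show ?thesis using h T(1) by (intro card_inj_on_le[of h]) auto
  qed
  have "ON {}" by (simp add: ON_def)
  then obtain B where B: "ON B" and max: "\<And>C. ON C \<Longrightarrow> card C \<le> card B"
    using bound ex_has_greatest_nat[of ON "{}" card "card T"] by (metis less_imp_le_nat nat_less_le le_imp_less_Suc)
  have fin: "finite B" using B by (simp add: ON_def)
  have "(\<Sum>e\<in>B. (x \<bullet> e) *\<^sub>R e) = x" for x
  proof (rule ccontr)
    define r where "r = x - (\<Sum>e\<in>B. (x \<bullet> e) *\<^sub>R e)"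
    assume "(\<Sum>e\<in>B. (x \<bullet> e) *\<^sub>R e) \<noteq> x"
    then have r0: "r \<noteq> 0" by (simp add: r_def)
    have orth: "r \<bullet> f = 0" if "f \<in> B" for f
    proof -
      have "(\<Sum>e\<in>B. (x \<bullet> e) * (e \<bullet> f)) = (\<Sum>e\<in>B. if e = f then x \<bullet> f else 0)"
        using B that by (intro sum.cong) (auto simp: ON_def)
      then show ?thesis using fin that
        by (simp add: r_def inner_diff_left inner_sum_left)
    qed
    define u where "u = r /\<^sub>R norm r"
    have uu: "u \<bullet> u = 1" using r0 by (simp add: u_def power2_norm_eq_inner[symmetric] power2_eq_square)
    have uf: "u \<bullet> f = 0" "f \<bullet> u = 0" if "f \<in> B" for f
      using orth[OF that] by (simp_all add: u_def inner_commute)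
    have "u \<notin> B" using uf uu by force
    moreover have "ON (insert u B)" using B uu uf \<open>u \<notin> B\<close> by (auto simp: ON_def)
    ultimately show False using max[of "insert u B"] fin by simp
  qed
  with B have "orthonormal_basis B" unfolding ON_def orthonormal_basis_def by blast
  then show ?thesis ..
qed

definition obasis :: "'b::{real_inner, heine_borel} set" where
  "obasis = (SOME B. orthonormal_basis B)"

lemma orthonormal_obasis: "orthonormal_basis obasis"
  unfolding obasis_def using orthonormal_basis_exists by (rule someI_ex)

lemma finite_obasis [simp]: "finite obasis"
  and inner_obasis: "\<lbrakk>e \<in> obasis; f \<in> obasis\<rbrakk> \<Longrightarrow> e \<bullet> f = (if e = f then 1 else 0)"
  and obasis_expansion: "(\<Sum>e\<in>obasis. (x \<bullet> e) *\<^sub>R e) = x"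
  using orthonormal_obasis by (auto simp: orthonormal_basis_def)

lemma norm_obasis: "e \<in> obasis \<Longrightarrow> norm e = 1"
  by (simp add: norm_eq_sqrt_inner inner_obasis)

lemma linear_obasis_expansion:
  assumes "linear f"
  shows "f x = (\<Sum>e\<in>obasis. (x \<bullet> e) *\<^sub>R f e)"
proof -
  interpret linear f by fact
  have "f x = f (\<Sum>e\<in>obasis. (x \<bullet> e) *\<^sub>R e)" by (simp add: obasis_expansion)
  then show ?thesis by (simp add: sum scale)
qed

lemma inner_sum_obasis:
  assumes "f \<in> obasis"
  shows "(\<Sum>e\<in>obasis. a e *\<^sub>R e) \<bullet> f = a f"
proof -
  have "(\<Sum>e\<in>obasis. a e *\<^sub>R e) \<bullet> f = (\<Sum>e\<in>obasis. if e = f then a f else 0)"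
    unfolding inner_sum_left using assms by (intro sum.cong) (auto simp: inner_obasis)
  then show ?thesis using assms by simp
qed

text \<open>Only the finitely many values \<open>f e\<close> enter the bound. When \<open>f\<close>
  is a derivative, \<open>Ck_on\<close> makes exactly these values continuous in the base point,
  while it says nothing directly about the operator norm.\<close>

lemma norm_linear_le_obasis:
  fixes f :: "'a::{real_inner, heine_borel} \<Rightarrow> 'b::real_normed_vector"
  assumes "linear f"
  shows "norm (f x) \<le> (\<Sum>e\<in>obasis. norm (f e)) * norm x"
proof -
  have "norm (f x) \<le> (\<Sum>e\<in>obasis. norm ((x \<bullet> e) *\<^sub>R f e))"
    by (subst linear_obasis_expansion[OF assms]) (rule norm_sum)
  also have "\<dots> \<le> (\<Sum>e\<in>obasis. norm (f e) * norm x)"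
  proof (rule sum_mono)
    fix e :: 'a assume "e \<in> obasis"
    then have "\<bar>x \<bullet> e\<bar> \<le> norm x" using Cauchy_Schwarz_ineq2[of x e] by (simp add: norm_obasis)
    then show "norm ((x \<bullet> e) *\<^sub>R f e) \<le> norm (f e) * norm x"
      by (simp add: mult.commute[of "norm (f e)"] mult_right_mono)
  qed
  finally show ?thesis by (simp add: sum_distrib_right)
qed

lemma bounded_linear_obasis:
  fixes f :: "'a::{real_inner, heine_borel} \<Rightarrow> 'b::real_normed_vector"
  assumes "linear f"
  shows "bounded_linear f"
proof -
  interpret linear f by fact
  show ?thesis
    using norm_linear_le_obasis[OF assms]
    by (intro bounded_linear_intro[where K="\<Sum>e\<in>obasis. norm (f e)"])
       (auto simp: add scale mult.commute)
qed

lemma linear_injective_imp_surj: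
  fixes f :: "'a::{real_inner, heine_borel} \<Rightarrow> 'a"
  assumes "linear f" "\<And>x. f x = 0 \<Longrightarrow> x = 0"
  shows "surj f"
proof -
  have ind: "independent (obasis :: 'a set)"
  proof -
    have "a e = 0" if "(\<Sum>e\<in>obasis. a e *\<^sub>R e) = 0" "e \<in> obasis" for a and e :: 'a
      using inner_sum_obasis[OF that(2), of a] that(1) by simp
    then show ?thesis by (auto simp: independent_explicit_finite_subsets dependent_finite)
  qed
  have sp: "span (obasis :: 'a set) = UNIV"
  proof -
    have "x \<in> span obasis" for x :: 'a
      using span_sum[of obasis "\<lambda>e. (x \<bullet> e) *\<^sub>R e" obasis]
      by (simp add: obasis_expansion span_base span_scale)
    then show ?thesis by auto
  qed
  \<comment> \<open>\<open>obasis\<close> is the finite independent spanning set through which the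
    dimension argument becomes available.\<close>
  interpret F: finite_dimensional_vector_space_pair "(*\<^sub>R)" "obasis :: 'a set" "(*\<^sub>R)" "obasis :: 'a set"
    by unfold_locales
      (use ind sp in \<open>auto simp: dependent_raw_def span_raw_def\<close>)
  have "inj f" using assms linear_injective_0 by blast
  show ?thesis
  proof (rule F.linear_injective_imp_surjective)
    show "Vector_Spaces.linear (*\<^sub>R) (*\<^sub>R) f" using assms(1) by (simp add: linear_def)
  qed (use \<open>inj f\<close> in auto)
qed

section \<open>Calculus of smooth maps\<close>

lemma Ck_on_subset: "Ck_on k S f \<Longrightarrow> T \<subseteq> S \<Longrightarrow> Ck_on k T f"
  by (induction k arbitrary: f) (auto intro: continuous_on_subset)

lemma has_derivative_frechet:
  "f differentiable (at x) \<Longrightarrow> (f has_derivative frechet_derivative f (at x)) (at x)"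
  by (simp add: frechet_derivative_works[symmetric])

lemma Ck_on_has_derivative:
  "Ck_on (Suc k) S f \<Longrightarrow> x \<in> S \<Longrightarrow> (f has_derivative frechet_derivative f (at x)) (at x)"
  by (simp add: has_derivative_frechet)

lemma Ck_on_cong:
  assumes "open S" "\<And>x. x \<in> S \<Longrightarrow> f x = g x"
  shows "Ck_on k S f \<longleftrightarrow> Ck_on k S g"
  using assms(2)
proof (induction k arbitrary: f g)
  case 0
  then show ?case by (auto intro: continuous_on_cong[THEN iffD1] simp: cong: continuous_on_cong)
next
  case (Suc k)
  have *: "Ck_on (Suc k) S g" if C: "Ck_on (Suc k) S f" and eq: "\<And>x. x \<in> S \<Longrightarrow> f x = g x"
    for f g :: "'a \<Rightarrow> 'b"
  proof -
    have d: "(g has_derivative frechet_derivative f (at x)) (at x)" if "x \<in> S" for x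
      using has_derivative_transform_within_open[OF Ck_on_has_derivative[OF C that] assms(1) that] eq
      by auto
    then have "frechet_derivative g (at x) v = frechet_derivative f (at x) v" if "x \<in> S" for x v
      using that frechet_derivative_at by metis
    then have "Ck_on k S (\<lambda>x. frechet_derivative g (at x) v)" for v
      using C Suc.IH[of "\<lambda>x. frechet_derivative f (at x) v" "\<lambda>x. frechet_derivative g (at x) v"] by simp
    with d show ?thesis by (auto simp: differentiable_def)
  qed
  show ?case using *[of f g] *[of g f] Suc.prems by metis
qed

text \<open>\<open>Ck_on\<close> insists on \<open>frechet_derivative\<close>. By uniqueness of
  derivatives any explicitly known derivative may take its place, and openness of \<open>S\<close>
  makes the two interchangeable at all higher orders.\<close>

lemma Ck_on_SucI:
  assumes "open S" "\<And>x. x \<in> S \<Longrightarrow> (f has_derivative f' x) (at x)"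
    and "\<And>v. Ck_on k S (\<lambda>x. f' x v)"
  shows "Ck_on (Suc k) S f"
proof -
  have "frechet_derivative f (at x) v = f' x v" if "x \<in> S" for x v
    using assms(2)[OF that] frechet_derivative_at by metis
  then show ?thesis
    using assms Ck_on_cong[OF assms(1), of "\<lambda>x. f' x v" "\<lambda>x. frechet_derivative f (at x) v" for v]
    by (auto simp: differentiable_def)
qed

lemma Ck_on_SucD: "Ck_on (Suc k) S f \<Longrightarrow> Ck_on k S f"
proof (induction k arbitrary: f)
  case 0
  then show ?case
    by (auto intro!: continuous_at_imp_continuous_on differentiable_imp_continuous_within)
qed auto

lemma Ck_on_imp_continuous_on: "Ck_on k S f \<Longrightarrow> continuous_on S f"
proof (induction k)
  case (Suc k)
  then show ?case using Ck_on_SucD by blast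
qed simp

lemma Ck_on_local:
  assumes "\<And>x. x \<in> S \<Longrightarrow> \<exists>U. open U \<and> x \<in> U \<and> Ck_on k U f"
  shows "Ck_on k S f"
  using assms
proof (induction k arbitrary: f)
  case 0
  show ?case
    unfolding Ck_on.simps
  proof (rule continuous_at_imp_continuous_on, rule ballI)
    fix x assume "x \<in> S"
    from 0[OF this] obtain U where "open U" "x \<in> U" "continuous_on U f" by auto
    then show "isCont f x" by (simp add: continuous_on_eq_continuous_at)
  qed
next
  case (Suc k)
  show ?case
    unfolding Ck_on.simps
  proof (intro conjI allI ballI)
    fix x assume "x \<in> S"
    with Suc.prems obtain U where "x \<in> U" "Ck_on (Suc k) U f" by blast
    then show "f differentiable at x" by simp
  next
    fix v
    show "Ck_on k S (\<lambda>x. frechet_derivative f (at x) v)"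
      by (rule Suc.IH) (use Suc.prems in fastforce)
  qed
qed

lemma Ck_on_const: "Ck_on k S (\<lambda>x. c)"
proof (induction k arbitrary: c)
  case (Suc k)
  have "frechet_derivative (\<lambda>x. c) (at x) = (\<lambda>_. 0)" for x :: 'a
    using frechet_derivative_at[OF has_derivative_const] by metis
  then have "Ck_on k S (\<lambda>x. frechet_derivative (\<lambda>x. c) (at x) v)" for v
    using Suc[of 0] by simp
  then show ?case by simp
qed simp

lemma Ck_on_bounded_linear:
  assumes "bounded_linear L" "open S" "Ck_on k S f"
  shows "Ck_on k S (\<lambda>x. L (f x))"
  using assms(3)
proof (induction k arbitrary: f)
  case 0
  then show ?case using assms(1) by (simp add: bounded_linear.continuous_on)
next
  case (Suc k)
  show ?case
  proof (rule Ck_on_SucI[OF assms(2)])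
    show "((\<lambda>x. L (f x)) has_derivative (\<lambda>v. L (frechet_derivative f (at x) v))) (at x)" if "x \<in> S" for x
      using bounded_linear.has_derivative[OF assms(1) Ck_on_has_derivative[OF Suc.prems that]] .
    show "Ck_on k S (\<lambda>x. L (frechet_derivative f (at x) v))" for v
      using Suc by simp
  qed
qed

lemma Ck_on_id: "open S \<Longrightarrow> Ck_on k S (\<lambda>x. x)"
proof (cases k)
  case (Suc n)
  assume "open S"
  then show ?thesis unfolding Suc
    by (rule Ck_on_SucI[where f'="\<lambda>_ v. v"]) (auto intro: Ck_on_const)
qed simp

lemma Ck_on_add:
  assumes "open S" "Ck_on k S f" "Ck_on k S g"
  shows "Ck_on k S (\<lambda>x. f x + g x)"
  using assms(2,3)
proof (induction k arbitrary: f g)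
  case 0
  then show ?case by (simp add: continuous_on_add)
next
  case (Suc k)
  show ?case
    by (rule Ck_on_SucI[OF assms(1) has_derivative_add[OF Ck_on_has_derivative[OF Suc.prems(1)]
          Ck_on_has_derivative[OF Suc.prems(2)]]]) (use Suc in auto)
qed

lemma Ck_on_sum:
  assumes "open S" "\<And>i. i \<in> I \<Longrightarrow> Ck_on k S (f i)"
  shows "Ck_on k S (\<lambda>x. \<Sum>i\<in>I. f i x)"
  using assms(2)
  by (induction I rule: infinite_finite_induct) (auto intro: Ck_on_const Ck_on_add assms(1))

lemma Ck_on_bilinear:
  assumes "bounded_bilinear p" "open S" "Ck_on k S f" "Ck_on k S g"
  shows "Ck_on k S (\<lambda>x. p (f x) (g x))"
  using assms(3,4)
proof (induction k arbitrary: f g)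
  case 0
  then show ?case using assms(1) by (simp add: bounded_bilinear.continuous_on)
next
  case (Suc k)
  show ?case
    by (rule Ck_on_SucI[OF assms(2) bounded_bilinear.FDERIV[OF assms(1) Ck_on_has_derivative[OF Suc.prems(1)]
          Ck_on_has_derivative[OF Suc.prems(2)]]])
      (use Suc Ck_on_SucD[OF Suc.prems(1)] Ck_on_SucD[OF Suc.prems(2)] in \<open>auto intro!: Ck_on_add assms(2)\<close>)
qed

lemmas Ck_on_mult = Ck_on_bilinear[OF bounded_bilinear_mult]
lemmas Ck_on_scaleR = Ck_on_bilinear[OF bounded_bilinear_scaleR]
lemmas Ck_on_inner = Ck_on_bilinear[OF bounded_bilinear_inner]
lemmas Ck_on_minus = Ck_on_bounded_linear[OF bounded_linear_minus[OF bounded_linear_ident]]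

lemma Ck_on_diff:
  assumes "open S" "Ck_on k S f" "Ck_on k S g"
  shows "Ck_on k S (\<lambda>x. f x - g x)"
  using Ck_on_add[OF assms(1,2) Ck_on_minus[OF assms(1,3)]] by simp

lemma Ck_on_Pair:
  assumes "open S" "Ck_on k S f" "Ck_on k S g"
  shows "Ck_on k S (\<lambda>x. (f x, g x))"
proof -
  have "bounded_linear (\<lambda>x. (x, 0::'c))" "bounded_linear (\<lambda>x. (0::'b, x))"
    by (intro bounded_linear_Pair bounded_linear_ident bounded_linear_zero)+
  from Ck_on_add[OF assms(1) Ck_on_bounded_linear[OF this(1) assms(1,2)] Ck_on_bounded_linear[OF this(2) assms(1,3)]]
  show ?thesis by simp
qed

text \<open>In the chain rule the vector to which the derivative of \<open>g\<close> is applied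
  varies with the point, while \<open>Ck_on\<close> speaks of fixed directions. Expanding it in
  \<open>obasis\<close> leaves a finite sum of products with fixed directions \<open>e\<close>, to
  which the induction hypothesis applies.\<close>

lemma Ck_on_compose:
  fixes f :: "'a::real_normed_vector \<Rightarrow> 'b::{real_inner, heine_borel}"
  assumes "open S" "open T" "Ck_on k T g" "Ck_on k S f" "f ` S \<subseteq> T"
  shows "Ck_on k S (\<lambda>x. g (f x))"
  using assms(3,4)
proof (induction k arbitrary: g)
  case 0
  then show ?case using assms(5) by (auto intro: continuous_on_compose2)
next
  case (Suc k)
  show ?case
  proof (rule Ck_on_SucI[OF assms(1)])
    fix x assume x: "x \<in> S"
    let ?G = "frechet_derivative g (at (f x))"
    have g: "(g has_derivative ?G) (at (f x))"
      using x assms(5) by (intro Ck_on_has_derivative[OF Suc.prems(1)]) auto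
    have "((\<lambda>x. g (f x)) has_derivative (\<lambda>v. ?G (frechet_derivative f (at x) v))) (at x)"
      using diff_chain_at[OF Ck_on_has_derivative[OF Suc.prems(2) x] g] by (simp add: o_def)
    then show "((\<lambda>x. g (f x)) has_derivative
       (\<lambda>v. \<Sum>e\<in>obasis. (frechet_derivative f (at x) v \<bullet> e) *\<^sub>R ?G e)) (at x)"
      by (subst (asm) linear_obasis_expansion[OF has_derivative_linear[OF g]])
  next
    fix v
    show "Ck_on k S (\<lambda>x. \<Sum>e\<in>obasis. (frechet_derivative f (at x) v \<bullet> e) *\<^sub>R frechet_derivative g (at (f x)) e)"
      using Suc.prems Ck_on_SucD[OF Suc.prems(2)]
      by (intro Ck_on_sum Ck_on_scaleR assms(1) Suc.IH Ck_on_inner Ck_on_const) auto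
  qed
qed

lemma Ck_on_vector_derivativeI:
  fixes f :: "real \<Rightarrow> 'b::real_normed_vector"
  assumes "open S" "\<And>x. x \<in> S \<Longrightarrow> (f has_vector_derivative f' x) (at x)" "Ck_on k S f'"
  shows "Ck_on (Suc k) S f"
  using assms
  by (intro Ck_on_SucI[where f'="\<lambda>x v. v *\<^sub>R f' x"])
     (auto simp: has_vector_derivative_def intro!: Ck_on_scaleR Ck_on_const)

text \<open>The derivative is minus the square of the function itself, so each order of smoothness
  yields the next.\<close>

lemma Ck_on_inverse: "Ck_on k (- {0::real}) inverse"
proof (induction k)
  case 0
  show ?case by (auto intro!: continuous_on_inverse)
next
  case (Suc k)
  have "Ck_on k (- {0::real}) (\<lambda>x. - (inverse x * inverse x))"
    by (intro Ck_on_minus Ck_on_mult Suc) auto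
  then show ?case
    by (rule Ck_on_vector_derivativeI[rotated 2])
      (auto simp: has_real_derivative_iff_has_vector_derivative[symmetric] power2_eq_square
         intro!: derivative_eq_intros)
qed

section \<open>Smoothness on sets that need not be open\<close>

lemma smooth_on_open: "open S \<Longrightarrow> smooth_on S f \<longleftrightarrow> (\<forall>k. Ck_on k S f)"
proof
  assume S: "open S" and f: "smooth_on S f"
  show "\<forall>k. Ck_on k S f"
  proof (intro allI Ck_on_local)
    fix k x assume "x \<in> S"
    from bspec[OF f[unfolded smooth_on_def] this] obtain U g
      where U: "open U" "x \<in> U" "\<And>k. Ck_on k U g" "\<And>y. y \<in> S \<inter> U \<Longrightarrow> g y = f y"
      by auto
    then have "Ck_on k (S \<inter> U) f"
      using Ck_on_cong[of "S \<inter> U" g f k] Ck_on_subset[OF U(3), of "S \<inter> U"] S by blast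
    then show "\<exists>U. open U \<and> x \<in> U \<and> Ck_on k U f" using S U \<open>x \<in> S\<close> by (intro exI[of _ "S \<inter> U"]) auto
  qed
qed (auto simp: smooth_on_def)

lemma smooth_onE:
  assumes "smooth_on S f" "x \<in> S"
  obtains U g where "open U" "x \<in> U" "\<And>k. Ck_on k U g" "\<And>y. y \<in> S \<Longrightarrow> y \<in> U \<Longrightarrow> g y = f y"
  using bspec[OF assms(1)[unfolded smooth_on_def] assms(2)] by auto

lemma smooth_onI:
  assumes "\<And>x. x \<in> S \<Longrightarrow> \<exists>U g. open U \<and> x \<in> U \<and> (\<forall>k. Ck_on k U g) \<and> (\<forall>y\<in>S \<inter> U. g y = f y)"
  shows "smooth_on S f"
  using assms unfolding smooth_on_def by (rule ballI)

lemma smooth_on_imp_continuous_on: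
  assumes "smooth_on S f"
  shows "continuous_on S f"
proof (rule continuous_on_eq_continuous_within[THEN iffD2], rule ballI)
  fix x assume x: "x \<in> S"
  then obtain U g where U: "open U" "x \<in> U" "\<And>k. Ck_on k U g" "\<And>y. y \<in> S \<Longrightarrow> y \<in> U \<Longrightarrow> g y = f y"
    using smooth_onE[OF assms x] by blast
  have "continuous_on U g" using U(3) Ck_on_imp_continuous_on by blast
  then have "isCont g x" using U by (simp add: continuous_on_eq_continuous_at)
  then have "continuous (at x within S) g" by (rule continuous_at_imp_continuous_at_within)
  then have "(g \<longlongrightarrow> f x) (at x within S)" using U x by (simp add: continuous_within)
  moreover have "\<forall>\<^sub>F y in at x within S. g y = f y"
    using U x by (auto simp: eventually_at_topological)
  ultimately show "continuous (at x within S) f"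
    unfolding continuous_within by (rule Lim_transform_eventually)
qed

lemma smooth_on_compose:
  fixes f :: "'a::real_normed_vector \<Rightarrow> 'b::{real_inner, heine_borel}"
  assumes "smooth_on T g" "smooth_on S f" "f ` S \<subseteq> T"
  shows "smooth_on S (\<lambda>x. g (f x))"
proof (rule smooth_onI)
  fix x assume x: "x \<in> S"
  obtain U f' where U: "open U" "x \<in> U" "\<And>k. Ck_on k U f'" "\<And>y. y \<in> S \<Longrightarrow> y \<in> U \<Longrightarrow> f' y = f y"
    using smooth_onE[OF assms(2) x] by blast
  have "f x \<in> T" using x assms(3) by blast
  from smooth_onE[OF assms(1) this]
  obtain W g' where W: "open W" "f x \<in> W" "\<And>k. Ck_on k W g'" "\<And>y. y \<in> T \<Longrightarrow> y \<in> W \<Longrightarrow> g' y = g y"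
    by blast
  \<comment> \<open>The extension \<open>f'\<close> may leave \<open>T\<close> away from
    \<open>S\<close>, so the composite is taken where \<open>f'\<close> stays in the domain
    \<open>W\<close> of the extension of \<open>g\<close>.\<close>
  let ?U = "U \<inter> f' -` W"
  have o: "open ?U"
    using U(1) W(1) Ck_on_imp_continuous_on[OF U(3)] continuous_on_open_vimage
    by (metis Int_commute)
  have "Ck_on k ?U (\<lambda>x. g' (f' x))" for k
    by (rule Ck_on_compose[OF o W(1,3)]) (auto intro: Ck_on_subset[OF U(3)])
  then show "\<exists>U h. open U \<and> x \<in> U \<and> (\<forall>k. Ck_on k U h) \<and> (\<forall>y\<in>S \<inter> U. h y = g (f y))"
    using o U W x assms(3) by (intro exI[of _ ?U] exI[of _ "\<lambda>x. g' (f' x)"]) auto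
qed

lemma smooth_on_Pair:
  assumes "smooth_on S f" "smooth_on S g"
  shows "smooth_on S (\<lambda>x. (f x, g x))"
proof (rule smooth_onI)
  fix x assume x: "x \<in> S"
  obtain U f' where U: "open U" "x \<in> U" "\<And>k. Ck_on k U f'" "\<And>y. y \<in> S \<Longrightarrow> y \<in> U \<Longrightarrow> f' y = f y"
    using smooth_onE[OF assms(1) x] by blast
  obtain W g' where W: "open W" "x \<in> W" "\<And>k. Ck_on k W g'" "\<And>y. y \<in> S \<Longrightarrow> y \<in> W \<Longrightarrow> g' y = g y"
    using smooth_onE[OF assms(2) x] by blast
  have "Ck_on k (U \<inter> W) (\<lambda>x. (f' x, g' x))" for k
    using U(1) W(1) by (intro Ck_on_Pair) (auto intro: Ck_on_subset[OF U(3)] Ck_on_subset[OF W(3)])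
  then show "\<exists>U h. open U \<and> x \<in> U \<and> (\<forall>k. Ck_on k U h) \<and> (\<forall>y\<in>S \<inter> U. h y = (f y, g y))"
    using U W by (intro exI[of _ "U \<inter> W"] exI[of _ "\<lambda>x. (f' x, g' x)"]) auto
qed

lemma smooth_on_const: "smooth_on S (\<lambda>x. c)"
  by (rule smooth_onI, rule exI[of _ UNIV], rule exI[of _ "\<lambda>x. c"]) (auto intro: Ck_on_const)

lemma Ck_on_UNIV_imp_smooth_on: "(\<And>k. Ck_on k UNIV f) \<Longrightarrow> smooth_on S f"
  by (rule smooth_onI, rule exI[of _ UNIV], rule exI[of _ f]) auto

lemma smooth_on_bounded_linear: "bounded_linear f \<Longrightarrow> smooth_on S f"
  using Ck_on_bounded_linear[OF _ open_UNIV Ck_on_id[OF open_UNIV]]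
  by (intro Ck_on_UNIV_imp_smooth_on) auto

lemma smooth_on_add:
  fixes f g :: "'a::real_normed_vector \<Rightarrow> 'b::{real_inner, heine_borel}"
  assumes "smooth_on S f" "smooth_on S g"
  shows "smooth_on S (\<lambda>x. f x + g x)"
proof -
  have "bounded_linear (\<lambda>p::'b \<times> 'b. fst p + snd p)"
    by (intro bounded_linear_add bounded_linear_fst bounded_linear_snd)
  from smooth_on_compose[OF smooth_on_bounded_linear[OF this] smooth_on_Pair[OF assms], of UNIV]
  show ?thesis by simp
qed

lemma smooth_on_mult:
  fixes f g :: "'a::real_normed_vector \<Rightarrow> real"
  assumes "smooth_on S f" "smooth_on S g"
  shows "smooth_on S (\<lambda>x. f x * g x)"
proof -
  have "Ck_on k UNIV (\<lambda>p::real \<times> real. fst p * snd p)" for k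
    by (intro Ck_on_mult Ck_on_bounded_linear[OF bounded_linear_fst, of _ _ "\<lambda>x. x"]
        Ck_on_bounded_linear[OF bounded_linear_snd, of _ _ "\<lambda>x. x"] Ck_on_id open_UNIV)
  then have "smooth_on UNIV (\<lambda>p::real \<times> real. fst p * snd p)" by (rule Ck_on_UNIV_imp_smooth_on)
  from smooth_on_compose[OF this smooth_on_Pair[OF assms]] show ?thesis by simp
qed

lemma smooth_on_diff:
  fixes f g :: "'a::real_normed_vector \<Rightarrow> real"
  assumes "smooth_on S f" "smooth_on S g"
  shows "smooth_on S (\<lambda>x. f x - g x)"
  using smooth_on_add[OF assms(1) smooth_on_mult[OF smooth_on_const[of S "-1"] assms(2)]] by simp

lemma smooth_on_prod:
  fixes f :: "'i \<Rightarrow> 'a::real_normed_vector \<Rightarrow> real"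
  assumes "\<And>i. i \<in> I \<Longrightarrow> smooth_on S (f i)"
  shows "smooth_on S (\<lambda>x. \<Prod>i\<in>I. f i x)"
  using assms by (induction I rule: infinite_finite_induct) (auto intro: smooth_on_const smooth_on_mult)

section \<open>A smooth step function\<close>

text \<open>All functions \<open>p(1/x) exp(-1/x)\<close> at once: the family is closed under
  differentiation, so the smoothness of \<open>exp(-1/x)\<close> at 0 becomes an induction over the
  order.\<close>

definition flat_exp :: "real poly \<Rightarrow> real \<Rightarrow> real" where
  "flat_exp p x = (if x > 0 then poly p (1 / x) * exp (- (1 / x)) else 0)"

lemma tendsto_poly_div_exp_0:
  "((\<lambda>x. poly p x * exp (- x)) \<longlongrightarrow> (0::real)) at_top"
proof -
  have "((\<lambda>x. \<Sum>i\<le>degree p. coeff p i * (x ^ i / exp x)) \<longlongrightarrow> (\<Sum>i\<le>degree p. coeff p i * 0)) at_top"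
    by (intro tendsto_intros tendsto_power_div_exp_0)
  then show ?thesis by (simp add: poly_altdef sum_distrib_right exp_minus divide_inverse mult.assoc)
qed

lemma flat_exp_tendsto_0: "(flat_exp p \<longlongrightarrow> 0) (at_right 0)"
proof -
  have "((\<lambda>x. poly p (inverse x) * exp (- inverse x)) \<longlongrightarrow> (0::real)) (at_right 0)"
    by (rule filterlim_compose[OF tendsto_poly_div_exp_0 filterlim_inverse_at_top_right])
  then show ?thesis
    by (rule Lim_transform_eventually)
      (auto simp: eventually_at_right_less flat_exp_def inverse_eq_divide intro!: eventually_at_rightI[of _ 1])
qed

text \<open>For positive \<open>x\<close> both factors produce \<open>1/x^2\<close>, with a minus
  sign for the polynomial. At 0 the difference quotient from the right is \<open>flat_exp\<close> of
  \<open>p\<close> times the variable, which tends to 0.\<close>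

lemma flat_exp_derivative:
  "(flat_exp p has_real_derivative flat_exp ((p - pderiv p) * [:0, 0, 1:]) x) (at x)"
proof -
  consider "x > 0" | "x < 0" | "x = 0" by linarith
  then show ?thesis
  proof cases
    case 1
    have "((\<lambda>x. poly p (1 / x) * exp (- (1 / x))) has_real_derivative
        flat_exp ((p - pderiv p) * [:0, 0, 1:]) x) (at x)"
      using 1 by (auto simp: flat_exp_def intro!: derivative_eq_intros DERIV_chain2[OF poly_DERIV])
        (simp add: field_simps power2_eq_square)
    then show ?thesis
      by (rule DERIV_cong_ev[OF refl _ refl, THEN iffD1, rotated])
        (use 1 in \<open>auto simp: flat_exp_def intro!:
           eventually_nhds_in_open[of "{0<..}", THEN eventually_mono]\<close>)
  next
    case 2
    have "((\<lambda>x. 0::real) has_real_derivative flat_exp ((p - pderiv p) * [:0, 0, 1:]) x) (at x)"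
      using 2 by (auto simp: flat_exp_def)
    then show ?thesis
      by (rule DERIV_cong_ev[OF refl _ refl, THEN iffD1, rotated])
        (use 2 in \<open>auto simp: flat_exp_def intro!: eventually_nhds_in_open[of "{..<0}", THEN eventually_mono]\<close>)
  next
    case 3
    have "((\<lambda>y. flat_exp p y / y) \<longlongrightarrow> 0) (at_right 0)"
      by (rule Lim_transform_eventually[OF flat_exp_tendsto_0[of "p * [:0, 1:]"]])
        (auto simp: flat_exp_def intro!: eventually_at_rightI[of _ 1])
    moreover have "((\<lambda>y. flat_exp p y / y) \<longlongrightarrow> 0) (at_left 0)"
      by (rule Lim_transform_eventually[OF tendsto_const])
        (auto simp: flat_exp_def intro!: eventually_at_leftI[of "-1"])
    ultimately have "((\<lambda>y. flat_exp p y / y) \<longlongrightarrow> 0) (at 0)" by (rule filterlim_split_at_real[rotated])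
    then show ?thesis using 3 by (simp add: has_field_derivative_iff flat_exp_def)
  qed
qed

lemma Ck_on_flat_exp: "Ck_on k UNIV (flat_exp p)"
proof (induction k arbitrary: p)
  case 0
  show ?case using flat_exp_derivative
    by (auto intro!: continuous_at_imp_continuous_on DERIV_isCont)
next
  case (Suc k)
  then show ?case using flat_exp_derivative
    by (intro Ck_on_vector_derivativeI) (auto simp: has_real_derivative_iff_has_vector_derivative[symmetric])
qed

text \<open>The quotient \<open>f(x) / (f(x) + f(1 - x))\<close> with
  \<open>f(x) = exp(-1/x)\<close>; the denominator is positive because \<open>x\<close> or
  \<open>1 - x\<close> is. The derivative is carried along as a function because it becomes the
  factor in front of a reparametrised Hamiltonian.\<close>

lemma smooth_step_01:
  obtains \<sigma> \<sigma>' :: "real \<Rightarrow> real" where "\<And>k. Ck_on k UNIV \<sigma>" "\<And>k. Ck_on k UNIV \<sigma>'"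
    "\<And>x. (\<sigma> has_real_derivative \<sigma>' x) (at x)" "\<And>x. \<sigma>' x \<ge> 0" "\<And>x. \<sigma> x \<in> {0..1}"
    "\<And>x. x \<le> 0 \<Longrightarrow> \<sigma> x = 0" "\<And>x. x \<ge> 1 \<Longrightarrow> \<sigma> x = 1"
    "\<And>x. x \<le> 0 \<Longrightarrow> \<sigma>' x = 0" "\<And>x. x \<ge> 1 \<Longrightarrow> \<sigma>' x = 0"
proof -
  define f where "f = flat_exp 1"
  define g where "g = flat_exp [:0, 0, 1:]"
  have fg: "(f has_real_derivative g x) (at x)" for x
    using flat_exp_derivative[of 1 x] by (simp add: f_def g_def)
  have f0: "f x \<ge> 0" "x > 0 \<Longrightarrow> f x > 0" "x \<le> 0 \<Longrightarrow> f x = 0" for x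
    by (auto simp: f_def flat_exp_def)
  have g0: "g x \<ge> 0" "x \<le> 0 \<Longrightarrow> g x = 0" for x
    by (auto simp: g_def flat_exp_def)
  define D where "D x = f x + f (1 - x)" for x
  have D: "D x > 0" for x
    using f0(1)[of x] f0(1)[of "1 - x"] f0(2)[of x] f0(2)[of "1 - x"] by (cases "x > 0") (auto simp: D_def)
  define s where "s x = f x * inverse (D x)" for x
  define s' where "s' x = (g x * f (1 - x) + f x * g (1 - x)) * (inverse (D x) * inverse (D x))" for x
  have Cf: "Ck_on k UNIV f" "Ck_on k UNIV g" for k
    unfolding f_def g_def by (rule Ck_on_flat_exp)+
  have C1: "Ck_on k UNIV (\<lambda>x::real. 1 - x)" for k
    by (intro Ck_on_diff Ck_on_const Ck_on_id open_UNIV)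
  note Cr = Ck_on_compose[OF open_UNIV open_UNIV _ C1 subset_UNIV]
  have CD: "Ck_on k UNIV (\<lambda>x. inverse (D x))" for k
  proof (rule Ck_on_compose[OF open_UNIV _ Ck_on_inverse])
    show "Ck_on k UNIV D" unfolding D_def by (intro Ck_on_add Cf Cr open_UNIV)
    show "range D \<subseteq> - {0}" using D by (metis ComplI UNIV_I imageE less_irrefl singletonD subsetI)
  qed auto
  show ?thesis
  proof (rule that[of s s'])
    show "Ck_on k UNIV s" "Ck_on k UNIV s'" for k
      unfolding s_def s'_def by (intro Ck_on_mult Ck_on_add Cf Cr CD open_UNIV)+
    have *: "((\<lambda>x. f (1 - x)) has_real_derivative - g (1 - x)) (at x)" for x
    proof -
      have "((\<lambda>x. 1 - x) has_real_derivative -1) (at x)" by (auto intro!: derivative_eq_intros)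
      from DERIV_chain2[OF fg this] show ?thesis by simp
    qed
    show "(s has_real_derivative s' x) (at x)" for x
    proof -
      define i where "i = inverse (D x)"
      have i: "D x * i = 1" using D[of x] by (simp add: i_def)
      have "(D has_real_derivative g x - g (1 - x)) (at x)"
        unfolding D_def using DERIV_add[OF fg[of x] *[of x]] by simp
      from DERIV_mult[OF fg[of x] DERIV_inverse'[OF this]] D[of x]
      have "(s has_real_derivative g x * i + - (i * (g x - g (1 - x)) * i) * f x) (at x)"
        by (simp add: s_def[abs_def] i_def)
      \<comment> \<open>Writing 1 as \<open>D x * i\<close> in the first term brings both terms over
        the square of the denominator.\<close>
      moreover have "g x * i * (D x * i) + - (i * (g x - g (1 - x)) * i) * f x = s' x"
        by (simp add: s'_def D_def i_def algebra_simps)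
      ultimately show ?thesis unfolding i by simp
    qed
    show "s' x \<ge> 0" for x
      using f0 g0 D[of x] by (auto simp: s'_def intro!: mult_nonneg_nonneg add_nonneg_nonneg)
    show "s x \<in> {0..1}" for x
      using f0(1)[of x] f0(1)[of "1 - x"] D[of x] by (auto simp: s_def field_simps) (simp add: D_def)
    show "s x = 0" if "x \<le> 0" for x using that f0 by (simp add: s_def)
    show "s x = 1" if "x \<ge> 1" for x using that f0(3)[of "1 - x"] D[of x] by (simp add: s_def D_def)
    show "s' x = 0" if "x \<le> 0" for x using that f0 g0 by (simp add: s'_def)
    show "s' x = 0" if "x \<ge> 1" for x using that f0(3)[of "1 - x"] g0(2)[of "1 - x"] by (simp add: s'_def)
  qed
qed

lemma smooth_step:
  fixes a b :: real
  assumes "a < b"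
  obtains \<sigma> \<sigma>' :: "real \<Rightarrow> real" where "\<And>k. Ck_on k UNIV \<sigma>" "\<And>k. Ck_on k UNIV \<sigma>'"
    "\<And>x. (\<sigma> has_real_derivative \<sigma>' x) (at x)" "\<And>x. \<sigma>' x \<ge> 0" "\<And>x. \<sigma> x \<in> {0..1}"
    "\<And>x. x \<le> a \<Longrightarrow> \<sigma> x = 0" "\<And>x. x \<ge> b \<Longrightarrow> \<sigma> x = 1"
    "\<And>x. x \<le> a \<Longrightarrow> \<sigma>' x = 0" "\<And>x. x \<ge> b \<Longrightarrow> \<sigma>' x = 0"
proof -
  obtain s s' :: "real \<Rightarrow> real" where s: "\<And>k. Ck_on k UNIV s" "\<And>k. Ck_on k UNIV s'"
    "\<And>x. (s has_real_derivative s' x) (at x)" "\<And>x. s' x \<ge> 0" "\<And>x. s x \<in> {0..1}"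
    "\<And>x. x \<le> 0 \<Longrightarrow> s x = 0" "\<And>x. x \<ge> 1 \<Longrightarrow> s x = 1"
    "\<And>x. x \<le> 0 \<Longrightarrow> s' x = 0" "\<And>x. x \<ge> 1 \<Longrightarrow> s' x = 0"
    by (rule smooth_step_01) blast
  define l where "l x = (x - a) * (1 / (b - a))" for x
  have Cl: "Ck_on k UNIV l" for k
    unfolding l_def by (intro Ck_on_mult Ck_on_diff Ck_on_id Ck_on_const open_UNIV)
  have l: "x \<le> a \<Longrightarrow> l x \<le> 0" "x \<ge> b \<Longrightarrow> l x \<ge> 1" for x
    using assms by (auto simp: l_def field_simps)
  note Cr = Ck_on_compose[OF open_UNIV open_UNIV _ Cl subset_UNIV]
  show ?thesis
  proof (rule that[of "\<lambda>x. s (l x)" "\<lambda>x. s' (l x) * (1 / (b - a))"])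
    show "((\<lambda>x. s (l x)) has_real_derivative s' (l x) * (1 / (b - a))) (at x)" for x
      by (rule DERIV_chain2[OF s(3)]) (use assms in \<open>auto simp: l_def intro!: derivative_eq_intros\<close>)
    show "Ck_on k UNIV (\<lambda>x. s' (l x) * (1 / (b - a)))" for k
      by (rule Ck_on_mult[OF open_UNIV Cr[OF s(2)] Ck_on_const])
    show "Ck_on k UNIV (\<lambda>x. s (l x))" for k by (rule Cr[OF s(1)])
  qed (use s(4-) l assms in auto)
qed

section \<open>Ordinary differential equations in Euclidean space\<close>

text \<open>\<open>N\<close> dominates the operator norm of the derivative and is continuous, hence
  bounded on a compact ball. As the ball is convex, the mean value inequality turns this bound into
  a Lipschitz constant.\<close>

lemma C1_imp_locally_lipschitz:
  fixes F :: "'a::{real_inner, heine_borel} \<Rightarrow> 'b::real_normed_vector"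
  assumes "open W" "Ck_on (Suc 0) W F" "z0 \<in> W"
  obtains r C L where "r > 0" "cball z0 r \<subseteq> W" "C > 0" "L > 0"
    "\<And>z. z \<in> cball z0 r \<Longrightarrow> norm (F z) \<le> C"
    "\<And>z z'. z \<in> cball z0 r \<Longrightarrow> z' \<in> cball z0 r \<Longrightarrow> norm (F z - F z') \<le> L * norm (z - z')"
proof -
  obtain r where r: "r > 0" "cball z0 r \<subseteq> W"
    using assms(1,3) open_contains_cball by metis
  have comp: "compact (cball z0 r)" by simp
  have "continuous_on (cball z0 r) F"
    using continuous_on_subset[OF Ck_on_imp_continuous_on[OF assms(2)] r(2)] .
  then have "bounded (F ` cball z0 r)"
    using comp compact_continuous_image compact_imp_bounded by blast
  then obtain C where C: "C > 0" "\<And>z. z \<in> cball z0 r \<Longrightarrow> norm (F z) \<le> C"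
    unfolding bounded_pos by auto
  define N where "N z = (\<Sum>e\<in>obasis. norm (frechet_derivative F (at z) e))" for z
  have "continuous_on W N"
    unfolding N_def using assms(2) by (intro continuous_intros) auto
  then have "bounded (N ` cball z0 r)"
    using comp compact_continuous_image compact_imp_bounded continuous_on_subset r(2) by metis
  then obtain L where L: "L > 0" "\<And>z. z \<in> cball z0 r \<Longrightarrow> norm (N z) \<le> L"
    unfolding bounded_pos by auto
  have "norm (F z - F z') \<le> L * norm (z - z')" if "z \<in> cball z0 r" "z' \<in> cball z0 r" for z z'
  proof (rule differentiable_bound[OF convex_cball _ _ that])
    fix x assume x: "x \<in> cball z0 r"
    then have d: "(F has_derivative frechet_derivative F (at x)) (at x)"
      using r(2) Ck_on_has_derivative[OF assms(2)] by blast
    then show "(F has_derivative frechet_derivative F (at x)) (at x within cball z0 r)"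
      by (rule has_derivative_at_withinI)
    have "norm (frechet_derivative F (at x) v) \<le> L * norm v" for v
      using norm_linear_le_obasis[OF has_derivative_linear[OF d], of v] L(2)[OF x]
      by (fold N_def) (smt (verit) mult_right_mono norm_ge_zero real_norm_def)
    then show "onorm (frechet_derivative F (at x)) \<le> L" using L(1) by (intro onorm_bound) auto
  qed
  with r C L(1) show ?thesis by (intro that[of r C L]) auto
qed

lemma vector_derivative_bound:
  fixes g :: "real \<Rightarrow> 'b::real_normed_vector"
  assumes "\<And>t. t \<in> {a..b} \<Longrightarrow> (g has_vector_derivative g' t) (at t within {a..b})"
    and "\<And>t. t \<in> {a..b} \<Longrightarrow> norm (g' t) \<le> C" "s \<in> {a..b}" "t \<in> {a..b}"
  shows "norm (g s - g t) \<le> C * \<bar>s - t\<bar>"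
proof -
  have "norm (g s - g t) \<le> C * norm (s - t)"
  proof (rule differentiable_bound[of "{a..b}" g "\<lambda>t h. h *\<^sub>R g' t"])
    show "onorm (\<lambda>h. h *\<^sub>R g' x) \<le> C" if "x \<in> {a..b}" for x
      using assms(2)[OF that] by (intro onorm_bound) (auto simp: mult.commute[of C] mult_left_mono intro: order_trans[OF norm_ge_zero])
  qed (use assms in \<open>auto simp: has_vector_derivative_def\<close>)
  then show ?thesis by simp
qed

text \<open>Integrating each coordinate with respect to \<open>obasis\<close> leaves only integrals
  of real functions.\<close>

lemma antiderivative_exists:
  fixes f :: "real \<Rightarrow> 'b::{real_inner, heine_borel}"
  assumes "continuous_on {a..b} f"
  shows "\<exists>g. \<forall>t\<in>{a..b}. (g has_vector_derivative f t) (at t within {a..b})"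
proof -
  define g where "g t = (\<Sum>e\<in>obasis. integral {a..t} (\<lambda>s. f s \<bullet> e) *\<^sub>R e)" for t
  have "(g has_vector_derivative f t) (at t within {a..b})" if t: "t \<in> {a..b}" for t
  proof -
    have "((\<lambda>t. integral {a..t} (\<lambda>s. f s \<bullet> e) *\<^sub>R e) has_vector_derivative (f t \<bullet> e) *\<^sub>R e)
        (at t within {a..b})" for e
    proof -
      have "continuous_on {a..b} (\<lambda>s. f s \<bullet> e)" using assms by (intro continuous_intros)
      from integral_has_vector_derivative[OF this t] show ?thesis
        by (auto intro!: derivative_eq_intros simp: has_real_derivative_iff_has_vector_derivative)
    qed
    then have "(g has_vector_derivative (\<Sum>e\<in>obasis. (f t \<bullet> e) *\<^sub>R e)) (at t within {a..b})"
      unfolding g_def by (intro has_vector_derivative_sum) auto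
    then show ?thesis by (simp add: obasis_expansion)
  qed
  then show ?thesis by blast
qed

lemma norm_Pair_diff_fst_eq: "norm ((s, y) - (s, y')) = norm (y - y')"
  by (simp add: norm_Pair)

text \<open>The solution is a fixed point of the Picard map. The same \<open>\<delta>\<close> serves
  all initial data near \<open>(s0, y0)\<close>; a uniform existence time on a compact set is later
  extracted from this.\<close>

lemma picard_lindelof:
  fixes F :: "real \<times> 'b \<Rightarrow> 'b::{real_inner, heine_borel}"
  assumes "open W" "Ck_on (Suc 0) W F" "(s0, y0) \<in> W"
  obtains \<delta> \<rho> where "\<delta> > 0" "\<rho> > 0"
    "\<And>s1 y1. \<bar>s1 - s0\<bar> < \<delta> \<Longrightarrow> norm (y1 - y0) < \<rho> \<Longrightarrow>
       \<exists>y. y s1 = y1 \<and> (\<forall>s. \<bar>s - s1\<bar> < \<delta> \<longrightarrow> (s, y s) \<in> W \<and> (y has_vector_derivative F (s, y s)) (at s))"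
proof -
  obtain r C L where r: "r > 0" "cball (s0, y0) r \<subseteq> W" and C: "C > 0" and L: "L > 0"
    and bd: "\<And>z. z \<in> cball (s0, y0) r \<Longrightarrow> norm (F z) \<le> C"
    and lip: "\<And>z z'. z \<in> cball (s0, y0) r \<Longrightarrow> z' \<in> cball (s0, y0) r \<Longrightarrow> norm (F z - F z') \<le> L * norm (z - z')"
    using C1_imp_locally_lipschitz[OF assms] by metis
  \<comment> \<open>The three bounds keep times inside the ball of radius \<open>r\<close>, keep the
    Picard map inside \<open>cball y1 (r / 4)\<close>, and make it a contraction with factor
    1/2.\<close>
  define \<delta> where "\<delta> = min (r / 4) (min (r / (4 * C)) (1 / (2 * L)))"
  have \<delta>: "\<delta> > 0" "\<delta> \<le> r / 4" "\<delta> \<le> r / (4 * C)" "\<delta> \<le> 1 / (2 * L)"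
    using r C L by (auto simp: \<delta>_def)
  then have \<delta>C: "C * \<delta> \<le> r / 4" and \<delta>L: "L * \<delta> \<le> 1 / 2"
    using C L by (auto simp: field_simps)
  show ?thesis
  proof (rule that[of \<delta> "r / 4"])
    fix s1 y1 assume s1: "\<bar>s1 - s0\<bar> < \<delta>" and y1: "norm (y1 - y0) < r / 4"
    define a b where "a = s1 - \<delta>" and "b = s1 + \<delta>"
    have ab: "a < b" "s1 \<in> {a..b}" using \<delta> by (auto simp: a_def b_def)
    have inr: "(s, y) \<in> cball (s0, y0) r" if "s \<in> {a..b}" "y \<in> cball y1 (r / 4)" for s y
    proof -
      have "dist (s0, y0) (s, y) \<le> dist s0 s + dist y0 y"
        by (simp add: dist_Pair_Pair sqrt_sum_squares_le_sum)
      also have "dist s0 s \<le> r / 2" using that(1) s1 \<delta>(1,2) unfolding a_def b_def dist_real_def atLeastAtMost_iff by linarith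
      also have "dist y0 y \<le> r / 2"
        using that(2) y1 dist_triangle[of y0 y y1] by (simp add: dist_norm norm_minus_commute)
      finally show ?thesis by simp
    qed
    \<comment> \<open>Functions on the whole line instead of \<open>{a..b}\<close>: they form a
      closed subset of the complete space of bounded continuous functions. The map \<open>cl\<close>
      below freezes time at the end points.\<close>
    define S where "S = PiC (UNIV::real set) (\<lambda>_. cball y1 (r / 4))"
    have memS: "f \<in> S \<longleftrightarrow> (\<forall>t. apply_bcontfun f t \<in> cball y1 (r / 4))" for f
      by (auto simp: S_def mem_PiC_iff)
    have "continuous_on {a..b} (\<lambda>s. F (s, apply_bcontfun f s))" if "f \<in> S" for f
    proof (rule continuous_on_compose2[of "cball (s0, y0) r" F])
      show "continuous_on (cball (s0, y0) r) F"
        using continuous_on_subset[OF Ck_on_imp_continuous_on[OF assms(2)] r(2)] .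
      show "continuous_on {a..b} (\<lambda>s. (s, apply_bcontfun f s))"
        by (intro continuous_intros continuous_on_apply_bcontfun)
    qed (use inr that memS in blast)
    then have "\<forall>f\<in>S. \<exists>g. \<forall>t\<in>{a..b}. (g has_vector_derivative F (t, apply_bcontfun f t)) (at t within {a..b})"
      by (intro ballI antiderivative_exists)
    from bchoice[OF this] obtain G where
      "\<forall>f\<in>S. \<forall>t\<in>{a..b}. (G f has_vector_derivative F (t, apply_bcontfun f t)) (at t within {a..b})" ..
    then have G: "(G f has_vector_derivative F (t, apply_bcontfun f t)) (at t within {a..b})"
      if "f \<in> S" "t \<in> {a..b}" for f t
      using that by blast
    have Gc: "continuous_on {a..b} (G f)" if "f \<in> S" for f
      by (rule continuous_on_vector_derivative[OF G[OF that]])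
    define cl where "cl t = max a (min b t)" for t :: real
    have cl: "cl t \<in> {a..b}" "t \<in> {a..b} \<Longrightarrow> cl t = t" "\<bar>cl t - s1\<bar> \<le> \<delta>" for t
      using ab \<delta> by (auto simp: cl_def a_def b_def)
    \<comment> \<open>\<open>G f\<close> is an arbitrarily chosen antiderivative; subtracting its
      value at \<open>s1\<close> removes the free constant and fixes the initial value
      \<open>y1\<close>.\<close>
    define Q where "Q f t = y1 + (G f (cl t) - G f s1)" for f t
    have Qb: "norm (Q f t - y1) \<le> r / 4" if "f \<in> S" for f t
    proof -
      have "norm (G f (cl t) - G f s1) \<le> C * \<bar>cl t - s1\<bar>"
        by (rule vector_derivative_bound[OF G[OF that]]) (use bd inr that memS cl ab in auto)
      also have "\<dots> \<le> C * \<delta>" using cl C by (intro mult_left_mono) auto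
      finally show ?thesis using \<delta>C by (simp add: Q_def)
    qed
    have Qbc: "Q f \<in> bcontfun" if "f \<in> S" for f
    proof (rule bcontfun_normI)
      have "continuous_on UNIV (\<lambda>t. G f (cl t))"
        by (rule continuous_on_compose2[OF Gc[OF that]]) (use cl in \<open>auto simp: cl_def intro!: continuous_intros\<close>)
      then show "continuous_on UNIV (Q f)" unfolding Q_def by (intro continuous_intros)
      show "norm (Q f t) \<le> norm y1 + r / 4" for t
        using Qb[OF that, of t] norm_triangle_sub[of "Q f t" y1] by linarith
    qed
    define P where "P f = Bcontfun (Q f)" for f
    have P: "apply_bcontfun (P f) = Q f" if "f \<in> S" for f
      using Qbc[OF that] by (simp add: P_def Bcontfun_inverse)
    have "\<exists>!f\<in>S. P f = f"
    proof (rule Banach_fix[of S "1/2"])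
      have "closed S" unfolding S_def by (rule closed_PiC) auto
      then show "complete S" by (simp add: complete_eq_closed)
      have "const_bcontfun y1 \<in> S" using r by (auto simp: memS)
      then show "S \<noteq> {}" by blast
      show "P ` S \<subseteq> S" using Qb by (auto simp: memS P dist_norm norm_minus_commute)
      fix f g assume fg: "f \<in> S" "g \<in> S"
      show "dist (P f) (P g) \<le> 1 / 2 * dist f g"
      proof (rule dist_bound)
        fix t
        have "norm ((G f (cl t) - G g (cl t)) - (G f s1 - G g s1)) \<le> (L * dist f g) * \<bar>cl t - s1\<bar>"
        proof (rule vector_derivative_bound[where g="\<lambda>t. G f t - G g t"])
          fix t assume t: "t \<in> {a..b}"
          show "((\<lambda>t. G f t - G g t) has_vector_derivative F (t, apply_bcontfun f t) - F (t, apply_bcontfun g t))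
             (at t within {a..b})"
            by (intro derivative_intros G fg t)
          have "norm (F (t, apply_bcontfun f t) - F (t, apply_bcontfun g t))
             \<le> L * norm ((t, apply_bcontfun f t) - (t, apply_bcontfun g t))"
            using fg t by (intro lip inr) (auto simp: memS)
          also have "\<dots> \<le> L * dist f g"
            unfolding norm_Pair_diff_fst_eq using L dist_bounded[of f t g]
            by (intro mult_left_mono) (auto simp: dist_norm)
          finally show "norm (F (t, apply_bcontfun f t) - F (t, apply_bcontfun g t)) \<le> L * dist f g" .
        qed (use cl ab in auto)
        also have "\<dots> \<le> (L * dist f g) * \<delta>" using L cl by (intro mult_left_mono) auto
        also have "\<dots> = (L * \<delta>) * dist f g" by simp
        also have "\<dots> \<le> 1 / 2 * dist f g" using \<delta>L by (intro mult_right_mono) auto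
        finally show "dist (apply_bcontfun (P f) t) (apply_bcontfun (P g) t) \<le> 1 / 2 * dist f g"
          by (simp add: P fg Q_def dist_norm algebra_simps)
      qed
    qed auto
    then obtain f where f: "f \<in> S" "P f = f" by blast
    define y where "y = apply_bcontfun f"
    have y: "y t = Q f t" for t using P[OF f(1)] f(2) by (simp add: y_def)
    have "y s1 = y1" using cl(2)[OF ab(2)] by (simp add: y Q_def)
    moreover have "(s, y s) \<in> W" "(y has_vector_derivative F (s, y s)) (at s)" if s: "\<bar>s - s1\<bar> < \<delta>" for s
    proof -
      have sab: "s \<in> {a<..<b}" "s \<in> {a..b}" using s by (auto simp: a_def b_def)
      then show "(s, y s) \<in> W" using inr[of s "y s"] r(2) f(1) by (auto simp: memS y_def)
      have "(G f has_vector_derivative F (s, y s)) (at s within {a<..<b})"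
        unfolding y_def by (rule has_vector_derivative_within_subset[OF G[OF f(1) sab(2)]]) auto
      then have "(G f has_vector_derivative F (s, y s)) (at s)"
        using sab(1) by (simp add: at_within_open[of s "{a<..<b}"])
      then have "((\<lambda>t. y1 + (G f t - G f s1)) has_vector_derivative F (s, y s)) (at s)"
        by (auto intro!: derivative_eq_intros)
      then show "(y has_vector_derivative F (s, y s)) (at s)"
        by (rule has_vector_derivative_transform_within_open[of _ _ _ "{a<..<b}"])
           (use sab cl in \<open>auto simp: y Q_def\<close>)
    qed
    ultimately show "\<exists>y. y s1 = y1 \<and> (\<forall>s. \<bar>s - s1\<bar> < \<delta> \<longrightarrow> (s, y s) \<in> W \<and> (y has_vector_derivative F (s, y s)) (at s))"
      by blast
  qed (use \<delta> r in auto)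
qed

text \<open>The derivative of \<open>|d|^2 exp(c t)\<close> is nonpositive for
  \<open>c = - 2 * L\<close> and nonnegative for \<open>c = 2 * L\<close>. The first choice carries
  the zero at \<open>s0\<close> forward, the second backward; both directions occur because curves
  will be compared from arbitrary times.\<close>

lemma gronwall_zero:
  fixes d :: "real \<Rightarrow> 'b::real_inner"
  assumes deriv: "\<And>s. s \<in> {a..b} \<Longrightarrow> (d has_vector_derivative d' s) (at s within {a..b})"
    and bd: "\<And>s. s \<in> {a..b} \<Longrightarrow> norm (d' s) \<le> L * norm (d s)"
    and s0: "s0 \<in> {a..b}" "d s0 = 0" and s: "s \<in> {a..b}"
  shows "d s = 0"
proof -
  have cont: "continuous_on {a..b} d" using deriv continuous_on_vector_derivative by blast
  have inner_bd: "\<bar>d t \<bullet> d' t\<bar> \<le> L * (d t \<bullet> d t)" if "t \<in> {a..b}" for t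
  proof -
    have "\<bar>d t \<bullet> d' t\<bar> \<le> norm (d t) * norm (d' t)" by (rule Cauchy_Schwarz_ineq2)
    also have "\<dots> \<le> norm (d t) * (L * norm (d t))" using bd[OF that] by (intro mult_left_mono) auto
    finally show ?thesis by (simp add: power2_norm_eq_inner[symmetric] power2_eq_square algebra_simps)
  qed
  have D: "((\<lambda>t. (d t \<bullet> d t) * exp (c * t)) has_real_derivative
      (2 * (d t \<bullet> d' t) + c * (d t \<bullet> d t)) * exp (c * t)) (at t)" if t: "a < t" "t < b" for c t
  proof -
    have "(d has_vector_derivative d' t) (at t within {a<..<b})"
      using t by (intro has_vector_derivative_within_subset[OF deriv[of t], of "{a<..<b}"]) auto
    then have "(d has_derivative (\<lambda>h. h *\<^sub>R d' t)) (at t)"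
      using t by (simp add: at_within_open[of t "{a<..<b}"] has_vector_derivative_def)
    from has_derivative_inner[OF this this]
    have "((\<lambda>t. d t \<bullet> d t) has_real_derivative 2 * (d t \<bullet> d' t)) (at t)"
      unfolding has_field_derivative_def
      by (rule has_derivative_eq_rhs) (auto simp: inner_commute algebra_simps)
    moreover have "((\<lambda>t. exp (c * t)) has_real_derivative c * exp (c * t)) (at t)"
      by (auto intro!: derivative_eq_intros)
    ultimately show ?thesis
      by (rule DERIV_cong[OF DERIV_mult]) (simp add: algebra_simps)
  qed
  have C: "continuous_on {u..v} (\<lambda>t. (d t \<bullet> d t) * exp (c * t))" if "{u..v} \<subseteq> {a..b}" for c u v
    using continuous_on_subset[OF cont that] by (intro continuous_intros)
  have "(d s \<bullet> d s) * exp (c * s) \<le> 0" if c: "c = (if s0 \<le> s then - 2 * L else 2 * L)" for c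
  proof (cases "s0 \<le> s")
    case True
    have "(d s \<bullet> d s) * exp (c * s) \<le> (d s0 \<bullet> d s0) * exp (c * s0)"
    proof (rule DERIV_nonpos_imp_decreasing_open[OF True _ C])
      fix x assume x: "s0 < x" "x < s"
      then have "2 * (d x \<bullet> d' x) + c * (d x \<bullet> d x) \<le> 0"
        using inner_bd[of x] s s0 True c by auto
      then show "\<exists>y. ((\<lambda>t. (d t \<bullet> d t) * exp (c * t)) has_real_derivative y) (at x) \<and> y \<le> 0"
        using D[of x c] x s s0 by (intro exI[of _ "(2 * (d x \<bullet> d' x) + c * (d x \<bullet> d x)) * exp (c * x)"] conjI) (auto intro: mult_nonpos_nonneg)
    qed (use s s0 in auto)
    then show ?thesis using s0 by simp
  next
    case False
    have "(d s \<bullet> d s) * exp (c * s) \<le> (d s0 \<bullet> d s0) * exp (c * s0)"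
    proof (rule DERIV_nonneg_imp_increasing_open[OF _ _ C])
      fix x assume x: "s < x" "x < s0"
      then have "2 * (d x \<bullet> d' x) + c * (d x \<bullet> d x) \<ge> 0"
        using inner_bd[of x] s s0 False c by auto
      then show "\<exists>y. ((\<lambda>t. (d t \<bullet> d t) * exp (c * t)) has_real_derivative y) (at x) \<and> 0 \<le> y"
        using D[of x c] x s s0 by (intro exI[of _ "(2 * (d x \<bullet> d' x) + c * (d x \<bullet> d x)) * exp (c * x)"] conjI) (auto intro: mult_nonneg_nonneg)
    qed (use s s0 False in auto)
    then show ?thesis using s0 by simp
  qed
  then have "(d s \<bullet> d s) * exp ((if s0 \<le> s then - 2 * L else 2 * L) * s) \<le> 0" by blast
  then have "d s \<bullet> d s \<le> 0" by (simp add: mult_le_0_iff not_le[symmetric])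
  then show ?thesis by (metis inner_eq_zero_iff inner_ge_zero order_antisym)
qed

text \<open>The derivative \<open>F (s, y s)\<close> is as smooth as \<open>y\<close>, so each order
  of smoothness yields the next.\<close>

lemma ode_solution_regular:
  fixes F :: "real \<times> 'b \<Rightarrow> 'b::{real_inner, heine_borel}"
  assumes "open W" "\<And>k. Ck_on k W F" "open I"
    and y: "\<And>s. s \<in> I \<Longrightarrow> (s, y s) \<in> W \<and> (y has_vector_derivative F (s, y s)) (at s)"
  shows "Ck_on k I y"
proof (induction k)
  case 0
  show ?case using y
    by (auto intro!: continuous_at_imp_continuous_on has_vector_derivative_continuous)
next
  case (Suc k)
  have "Ck_on k I (\<lambda>s. F (s, y s))"
    using y by (intro Ck_on_compose[OF assms(3,1,2)] Ck_on_Pair Ck_on_id Suc assms(3)) auto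
  with y show ?case by (intro Ck_on_vector_derivativeI[OF assms(3)]) auto
qed

section \<open>Smooth dependence of the solution of a linear equation\<close>

text \<open>\<open>L\<close> represents the linear form \<open>b v\<close> by a vector.
  Non-degeneracy makes it injective, hence onto in finite dimension, and two linear forms agree once
  they agree on \<open>obasis\<close>.\<close>

lemma bilinear_nondegenerate_ex1:
  fixes b :: "'b::{real_inner, heine_borel} \<Rightarrow> 'b \<Rightarrow> real" and \<alpha> :: "'b \<Rightarrow> real"
  assumes "bilinear b" "\<And>v. (\<And>w. b v w = 0) \<Longrightarrow> v = 0" "linear \<alpha>"
  shows "\<exists>!v. \<forall>w. b v w = \<alpha> w"
proof -
  define L where "L v = (\<Sum>e\<in>obasis. b v e *\<^sub>R e)" for v
  have lin1: "linear (b v)" and lin2: "linear (\<lambda>v. b v w)" for v w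
    using assms(1) by (auto simp: bilinear_def)
  have "linear L"
    by (rule linearI) (simp_all add: L_def linear_add[OF lin2] linear_scale[OF lin2] scaleR_left_distrib
        sum.distrib scaleR_sum_right)
  have Lb: "b v e = L v \<bullet> e" if "e \<in> obasis" for v e
    using inner_sum_obasis[OF that] by (simp add: L_def)
  have "v = 0" if "L v = 0" for v
  proof (rule assms(2))
    show "b v w = 0" for w
      using linear_obasis_expansion[OF lin1, of v w] that by (simp add: Lb)
  qed
  from linear_injective_imp_surj[OF \<open>linear L\<close> this]
  obtain v where v: "L v = (\<Sum>e\<in>obasis. \<alpha> e *\<^sub>R e)" by (metis surjD)
  have "b v w = \<alpha> w" for w
  proof -
    have "b v e = \<alpha> e" if "e \<in> obasis" for e
      using that inner_sum_obasis[OF that, of \<alpha>] by (simp add: Lb v)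
    then show ?thesis
      using linear_obasis_expansion[OF lin1, of v w] linear_obasis_expansion[OF assms(3), of w] by simp
  qed
  moreover have "v = v'" if "\<forall>w. b v w = \<alpha> w" "\<forall>w. b v' w = \<alpha> w" for v v'
  proof -
    have "v - v' = 0"
    proof (rule assms(2))
      show "b (v - v') w = 0" for w
        using linear_diff[OF lin2, of v v' w] that by simp
    qed
    then show ?thesis by simp
  qed
  ultimately show ?thesis by blast
qed

text \<open>A differentiable factor that vanishes at \<open>z\<close> is \<open>O(|y - z|)\<close>
  and the other one is \<open>o(1)\<close>, so the product is \<open>o(|y - z|)\<close>. Through
  this lemma the continuity of a solution leads to its differentiability.\<close>

lemma has_derivative_scaleR_vanishing:
  fixes \<beta> :: "'a::real_normed_vector \<Rightarrow> real" and \<gamma> :: "'a \<Rightarrow> 'b::real_normed_vector"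
  assumes "\<beta> differentiable (at z)" "\<beta> z = 0" "isCont \<gamma> z" "\<gamma> z = 0"
  shows "((\<lambda>x. \<beta> x *\<^sub>R \<gamma> x) has_derivative (\<lambda>_. 0)) (at z)"
proof -
  obtain D where D: "(\<beta> has_derivative D) (at z)" using assms(1) by (auto simp: differentiable_def)
  have bl: "bounded_linear D" using D by (rule has_derivative_bounded_linear)
  then obtain K where K: "K > 0" "\<And>h. norm (D h) \<le> norm h * K" using bounded_linear.pos_bounded by blast
  show ?thesis
    unfolding has_derivative_at_alt
  proof (intro conjI allI impI)
    fix e :: real assume e: "e > 0"
    from conjunct2[OF D[unfolded has_derivative_at_alt], rule_format, OF zero_less_one]
    obtain d1 where d1: "d1 > 0"
      "\<And>y. norm (y - z) < d1 \<Longrightarrow> norm (\<beta> y - \<beta> z - D (y - z)) \<le> 1 * norm (y - z)" by auto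
    from assms(3) have "\<exists>d>0. \<forall>y. dist y z < d \<longrightarrow> dist (\<gamma> y) (\<gamma> z) < e / (1 + K)"
      using e K by (auto simp: continuous_at_eps_delta)
    then obtain d2 where d2: "d2 > 0" "\<And>y. dist y z < d2 \<Longrightarrow> norm (\<gamma> y) < e / (1 + K)"
      using assms(4) by (auto simp: dist_norm)
    have "norm (\<beta> y *\<^sub>R \<gamma> y) \<le> e * norm (y - z)" if y: "norm (y - z) < min d1 d2" for y
    proof -
      have "\<bar>\<beta> y\<bar> \<le> norm (\<beta> y - \<beta> z - D (y - z)) + norm (D (y - z))" using assms(2) by simp
      also have "\<dots> \<le> (1 + K) * norm (y - z)" using d1(2)[of y] K(2)[of "y - z"] y by (simp add: algebra_simps)
      finally have 1: "\<bar>\<beta> y\<bar> \<le> (1 + K) * norm (y - z)" .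
      have 2: "norm (\<gamma> y) \<le> e / (1 + K)" using d2(2)[of y] y by (simp add: dist_norm)
      have "\<bar>\<beta> y\<bar> * norm (\<gamma> y) \<le> (1 + K) * norm (y - z) * (e / (1 + K))"
        using 1 2 K by (intro mult_mono) auto
      then show ?thesis using K by (simp add: mult.commute)
    qed
    then show "\<exists>d>0. \<forall>y. norm (y - z) < d \<longrightarrow>
        norm (\<beta> y *\<^sub>R \<gamma> y - \<beta> z *\<^sub>R \<gamma> z - 0) \<le> e * norm (y - z)"
      using d1(1) d2(1) assms(2) by (intro exI[of _ "min d1 d2"]) auto
  qed auto
qed

text \<open>Modelled on the symplectic form in a chart, with \<open>z\<close> a pair of a time and a
  coordinate vector. The aim is that the solution \<open>v\<close> of
  \<open>b z v = \<alpha> z\<close> is as smooth in \<open>z\<close> as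
  \<open>\<alpha>\<close>.\<close>

locale smooth_linear_family =
  fixes b :: "'c::{real_inner, heine_borel} \<Rightarrow> 'b::{real_inner, heine_borel} \<Rightarrow> 'b \<Rightarrow> real"
    and U :: "'c set"
  assumes U: "open U"
    and bil: "z \<in> U \<Longrightarrow> bilinear (b z)"
    and nondeg: "z \<in> U \<Longrightarrow> (\<And>w. b z v w = 0) \<Longrightarrow> v = 0"
    and smooth: "Ck_on k U (\<lambda>z. b z v w)"
begin

lemma linear_left: "z \<in> U \<Longrightarrow> linear (\<lambda>v. b z v w)"
  and linear_right: "z \<in> U \<Longrightarrow> linear (b z v)"
  using bil by (auto simp: bilinear_def)

lemma expand_left: "z \<in> U \<Longrightarrow> b z v w = (\<Sum>e\<in>obasis. b z e w * (v \<bullet> e))"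
  using linear_obasis_expansion[OF linear_left[of z w], of v] by (simp add: mult.commute)

text \<open>The vector that represents the linear form \<open>b z v\<close> under the inner product,
  so that equations for the form become equations for an injective linear map.\<close>

definition sharp :: "'c \<Rightarrow> 'b \<Rightarrow> 'b" where
  "sharp z v = (\<Sum>f\<in>obasis. b z v f *\<^sub>R f)"

lemma linear_sharp: "z \<in> U \<Longrightarrow> linear (sharp z)"
  by (rule linearI) (simp_all add: sharp_def linear_add[OF linear_left] linear_scale[OF linear_left]
        scaleR_left_distrib sum.distrib scaleR_sum_right)

lemma sharp_eq_0D:
  assumes "z \<in> U" "sharp z v = 0"
  shows "v = 0"
proof (rule nondeg[OF assms(1)])
  fix w
  have "b z v e = 0" if "e \<in> obasis" for e
    using inner_sum_obasis[OF that, of "b z v"] assms(2) by (simp add: sharp_def)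
  then show "b z v w = 0" using linear_obasis_expansion[OF linear_right[OF assms(1)], of v w] by simp
qed

lemma sharp_left_inverse:
  assumes "z \<in> U"
  obtains K where "bounded_linear K" "\<And>v. K (sharp z v) = v"
proof -
  have "inj (sharp z)"
    using linear_injective_0[OF linear_sharp[OF assms]] sharp_eq_0D[OF assms] by blast
  from linear_injective_left_inverse[OF linear_sharp[OF assms] this]
  obtain K where "linear K" "K \<circ> sharp z = id" by blast
  then show ?thesis by (intro that[of K] bounded_linear_obasis) (auto simp: fun_eq_iff)
qed

text \<open>Separating the differences of coefficients from \<open>v\<close> allows a termwise
  estimate in \<open>coercive\<close> and exhibits products of vanishing factors in
  \<open>solution_decomposition\<close>.\<close>

lemma sharp_diff_expansion:
  assumes "z \<in> U" "y \<in> U"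
  shows "sharp z v - sharp y v = (\<Sum>e\<in>obasis. \<Sum>f\<in>obasis. (b z e f - b y e f) *\<^sub>R ((v \<bullet> e) *\<^sub>R f))"
proof -
  have "sharp z v - sharp y v = (\<Sum>f\<in>obasis. \<Sum>e\<in>obasis. (b z e f - b y e f) *\<^sub>R ((v \<bullet> e) *\<^sub>R f))"
    by (simp add: sharp_def expand_left[OF assms(1), of v] expand_left[OF assms(2), of v]
        sum_subtractf[symmetric] scaleR_sum_left algebra_simps)
  then show ?thesis by (subst sum.swap)
qed

text \<open>Only the inverse \<open>K\<close> at the fixed point \<open>z\<close> occurs: it is
  applied to \<open>sharp z (V y - V z)\<close>, which is split into the effect of the data and the
  change of the operator. Each term of the last sum has two factors that vanish at
  \<open>y = z\<close>, so the sum contributes nothing to first order.\<close>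

lemma solution_decomposition:
  assumes z: "z \<in> U" and y: "y \<in> U" and K: "bounded_linear K" "\<And>v. K (sharp z v) = v"
    and V: "\<And>w. b y (V y) w = \<alpha> y w"
  shows "V y = V z + K ((\<Sum>f\<in>obasis. \<alpha> y f *\<^sub>R f) - sharp y (V z)) +
    (\<Sum>e\<in>obasis. \<Sum>f\<in>obasis. (b z e f - b y e f) *\<^sub>R (((V y - V z) \<bullet> e) *\<^sub>R K f))"
proof -
  interpret K: bounded_linear K by fact
  have "sharp z (V y - V z) = (sharp y (V y) - sharp y (V z)) + (sharp z (V y - V z) - sharp y (V y - V z))"
    by (simp add: linear_diff[OF linear_sharp[OF y]])
  then have "K (sharp z (V y - V z)) = K (sharp y (V y) - sharp y (V z)) + K (sharp z (V y - V z) - sharp y (V y - V z))"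
    by (metis K.add)
  moreover have "sharp y (V y) = (\<Sum>f\<in>obasis. \<alpha> y f *\<^sub>R f)" by (simp add: sharp_def V)
  moreover have "K (sharp z (V y - V z) - sharp y (V y - V z)) =
      (\<Sum>e\<in>obasis. \<Sum>f\<in>obasis. (b z e f - b y e f) *\<^sub>R (((V y - V z) \<bullet> e) *\<^sub>R K f))"
    unfolding sharp_diff_expansion[OF z y] by (simp only: K.sum K.scaleR)
  ultimately show ?thesis by (simp add: K(2) algebra_simps)
qed

lemma coercive:
  assumes "z \<in> U"
  obtains c N where "c > 0" "open N" "z \<in> N" "N \<subseteq> U" "\<And>y v. y \<in> N \<Longrightarrow> norm v \<le> c * norm (sharp y v)"
proof -
  obtain K where K: "bounded_linear K" "\<And>v. K (sharp z v) = v" using sharp_left_inverse[OF assms] by metis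
  from bounded_linear.pos_bounded[OF K(1)] obtain C where C: "C > 0" "\<And>x. norm (K x) \<le> norm x * C" by blast
  \<comment> \<open>\<open>q\<close> bounds the operator norm of \<open>sharp z - sharp y\<close>.
    Where it is below \<open>1 / (2 * C)\<close>, the perturbation uses up at most half of the lower
    bound at \<open>z\<close>, whence the constant \<open>2 * C\<close>.\<close>
  define q where "q y = (\<Sum>e\<in>obasis. \<Sum>f\<in>(obasis::'b set). \<bar>b z e f - b y e f\<bar>)" for y
  have qc: "continuous_on U q"
    unfolding q_def using smooth[of 0] by (intro continuous_intros) auto
  have op: "open (U \<inter> q -` {..<1 / (2 * C)})"
    using continuous_on_open_vimage[OF U, of q] qc by (simp add: Int_commute)
  show ?thesis
  proof (rule that[OF _ op])
    show "2 * C > 0" using C by simp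
    show "z \<in> U \<inter> q -` {..<1 / (2 * C)}" using assms C by (simp add: q_def)
    fix y v assume y: "y \<in> U \<inter> q -` {..<1 / (2 * C)}"
    have "norm (sharp z v - sharp y v) \<le> q y * norm v"
    proof -
      have "norm (sharp z v - sharp y v) \<le> (\<Sum>e\<in>obasis. \<Sum>f\<in>obasis. \<bar>b z e f - b y e f\<bar> * norm v)"
        unfolding sharp_diff_expansion[OF assms IntD1[OF y]]
      proof (intro sum_norm_le order_trans[OF norm_sum] sum_mono)
        fix e f :: 'b assume ef: "e \<in> obasis" "f \<in> obasis"
        have "\<bar>v \<bullet> e\<bar> \<le> norm v" using Cauchy_Schwarz_ineq2[of v e] ef by (simp add: norm_obasis)
        then show "norm ((b z e f - b y e f) *\<^sub>R ((v \<bullet> e) *\<^sub>R f)) \<le> \<bar>b z e f - b y e f\<bar> * norm v"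
          using ef by (simp add: norm_obasis abs_mult mult_left_mono)
      qed
      then show ?thesis by (simp add: q_def sum_distrib_right)
    qed
    also have "\<dots> \<le> 1 / (2 * C) * norm v" using y by (intro mult_right_mono) auto
    finally have 1: "norm (sharp z v - sharp y v) \<le> 1 / (2 * C) * norm v" .
    have "norm v \<le> norm (sharp z v) * C" using C(2)[of "sharp z v"] K(2) by simp
    also have "\<dots> \<le> (norm (sharp y v) + 1 / (2 * C) * norm v) * C"
      using 1 C norm_triangle_sub[of "sharp z v" "sharp y v"] by (intro mult_right_mono) auto
    finally show "norm v \<le> 2 * C * norm (sharp y v)" using C by (simp add: field_simps)
  qed auto
qed

text \<open>By \<open>coercive\<close> it is enough that \<open>sharp y (V y - V z)\<close> tends to
  0. Linearity rewrites it as \<open>g y\<close>, in which the unknown \<open>V y\<close> is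
  replaced by the data \<open>\<alpha> y\<close>.\<close>

lemma solution_continuous:
  assumes V: "\<And>z w. z \<in> U \<Longrightarrow> b z (V z) w = \<alpha> z w" and \<alpha>: "\<And>w. continuous_on U (\<lambda>z. \<alpha> z w)"
  shows "continuous_on U V"
proof (rule continuous_at_imp_continuous_on, rule ballI)
  fix z assume z: "z \<in> U"
  obtain c N where N: "c > 0" "open N" "z \<in> N" "N \<subseteq> U" "\<And>y v. y \<in> N \<Longrightarrow> norm v \<le> c * norm (sharp y v)"
    using coercive[OF z] by metis
  define g where "g y = (\<Sum>f\<in>obasis. (\<alpha> y f - b y (V z) f) *\<^sub>R f)" for y
  have gs: "g y = sharp y (V y - V z)" if "y \<in> U" for y
    using that by (simp add: g_def sharp_def linear_diff[OF linear_left] V)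
  have "continuous_on U g"
    unfolding g_def using \<alpha> smooth[of 0] by (intro continuous_intros) auto
  then have "(g \<longlongrightarrow> g z) (at z)" using z U by (simp add: continuous_on_eq_continuous_at isCont_def)
  moreover have "g z = 0" using gs[OF z] linear_0[OF linear_sharp[OF z]] by simp
  ultimately have "((\<lambda>y. c * norm (g y)) \<longlongrightarrow> 0) (at z)" by (auto intro!: tendsto_eq_intros)
  moreover have "\<forall>\<^sub>F y in at z. norm (V y - V z) \<le> c * norm (g y)"
    using N gs by (auto simp: eventually_at_topological intro!: exI[of _ N])
  ultimately have "((\<lambda>y. V y - V z) \<longlongrightarrow> 0) (at z)"
    by (rule Lim_null_comparison[rotated])
  then show "isCont V z" by (simp add: isCont_def LIM_zero_iff)
qed

lemma solution_differentiable:
  assumes V: "\<And>z w. z \<in> U \<Longrightarrow> b z (V z) w = \<alpha> z w"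
    and \<alpha>: "\<And>w z. z \<in> U \<Longrightarrow> (\<lambda>z. \<alpha> z w) differentiable (at z)" and z: "z \<in> U"
  shows "V differentiable (at z)"
proof -
  obtain K where K: "bounded_linear K" "\<And>v. K (sharp z v) = v" using sharp_left_inverse[OF z] by metis
  have cont: "continuous_on U V"
    using V by (rule solution_continuous)
      (use \<alpha> in \<open>auto intro!: continuous_at_imp_continuous_on differentiable_imp_continuous_within\<close>)
  have bd: "(\<lambda>z. b z v w) differentiable (at z)" for v w using smooth[of 1 v w] z by simp
  let ?R = "\<lambda>y. \<Sum>e\<in>obasis. \<Sum>f\<in>obasis. (b z e f - b y e f) *\<^sub>R (((V y - V z) \<bullet> e) *\<^sub>R K f)"
  have "(?R has_derivative (\<lambda>h. \<Sum>e\<in>(obasis::'b set). \<Sum>f\<in>(obasis::'b set). 0)) (at z)"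
  proof (intro has_derivative_sum has_derivative_scaleR_vanishing)
    have "isCont V z" using cont z U by (simp add: continuous_on_eq_continuous_at)
    then show "isCont (\<lambda>y. ((V y - V z) \<bullet> e) *\<^sub>R K f) z" for e f by (intro continuous_intros)
  qed (auto intro!: differentiable_diff bd)
  then have "?R differentiable (at z)" by (auto simp: differentiable_def)
  moreover have "(\<lambda>y. (\<Sum>f\<in>obasis. \<alpha> y f *\<^sub>R f) - sharp y (V z)) differentiable (at z)"
    unfolding sharp_def using \<alpha>[OF z] bd
    by (intro differentiable_diff differentiable_sum differentiable_scaleR differentiable_const)
      (auto intro: finite_obasis)
  then have "(\<lambda>y. K ((\<Sum>f\<in>obasis. \<alpha> y f *\<^sub>R f) - sharp y (V z))) differentiable (at z)"
    using bounded_linear.has_derivative[OF K(1)] unfolding differentiable_def by blast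
  ultimately have "(\<lambda>y. V z + K ((\<Sum>f\<in>obasis. \<alpha> y f *\<^sub>R f) - sharp y (V z)) + ?R y) differentiable (at z)"
    by (intro differentiable_add differentiable_const)
  then obtain D where "((\<lambda>y. V z + K ((\<Sum>f\<in>obasis. \<alpha> y f *\<^sub>R f) - sharp y (V z)) + ?R y) has_derivative D) (at z)"
    by (auto simp: differentiable_def)
  then have "(V has_derivative D) (at z)"
    by (rule has_derivative_transform_within_open[OF _ U z])
       (rule solution_decomposition[OF z _ K V, symmetric])
  then show ?thesis by (auto simp: differentiable_def)
qed

text \<open>The derivative of the solution solves an equation with the same form \<open>b\<close> and a right-hand side that
  is one degree less smooth; this bootstraps without inverting matrices.\<close>

lemma solution_Ck:
  assumes "\<And>z w. z \<in> U \<Longrightarrow> b z (V z) w = \<alpha> z w" "\<And>w. Ck_on k U (\<lambda>z. \<alpha> z w)"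
  shows "Ck_on k U V"
  using assms
proof (induction k arbitrary: V \<alpha>)
  case 0
  then show ?case using solution_continuous[of V \<alpha>] by simp
next
  case (Suc k)
  have Vk: "Ck_on k U V" using Suc.IH[OF Suc.prems(1)] Suc.prems(2) Ck_on_SucD by blast
  have diff: "V differentiable (at z)" if "z \<in> U" for z
    using Suc.prems by (intro solution_differentiable[of V \<alpha>] that) auto
  have "Ck_on k U (\<lambda>z. frechet_derivative V (at z) h)" for h
  proof (rule Suc.IH)
    fix z w assume z: "z \<in> U"
    let ?B = "\<lambda>e. frechet_derivative (\<lambda>z. b z e w) (at z)" and ?V = "frechet_derivative V (at z)"
    have B: "((\<lambda>z. b z e w) has_derivative ?B e) (at z)" for e
      using Ck_on_has_derivative[OF smooth z] .
    have Vd: "((\<lambda>z. V z \<bullet> e) has_derivative (\<lambda>h. ?V h \<bullet> e)) (at z)" for e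
      using has_derivative_inner_left[OF has_derivative_frechet[OF diff[OF z]]] .
    have "((\<lambda>z. \<Sum>e\<in>obasis. b z e w * (V z \<bullet> e)) has_derivative
        (\<lambda>h. \<Sum>e\<in>obasis. b z e w * (?V h \<bullet> e) + ?B e h * (V z \<bullet> e))) (at z)"
      by (intro has_derivative_sum has_derivative_mult B Vd)
    then have "((\<lambda>z. \<alpha> z w) has_derivative
        (\<lambda>h. \<Sum>e\<in>obasis. b z e w * (?V h \<bullet> e) + ?B e h * (V z \<bullet> e))) (at z)"
      by (rule has_derivative_transform_within_open[OF _ U z])
         (simp add: Suc.prems(1)[symmetric] expand_left[symmetric])
    then have "frechet_derivative (\<lambda>z. \<alpha> z w) (at z) h =
        (\<Sum>e\<in>obasis. b z e w * (?V h \<bullet> e)) + (\<Sum>e\<in>obasis. ?B e h * (V z \<bullet> e))"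
      by (simp add: frechet_derivative_at[symmetric] sum.distrib)
    then show "b z (?V h) w = frechet_derivative (\<lambda>z. \<alpha> z w) (at z) h - (\<Sum>e\<in>obasis. ?B e h * (V z \<bullet> e))"
      by (simp add: expand_left[OF z, of "?V h"])
  next
    show "Ck_on k U (\<lambda>z. frechet_derivative (\<lambda>z. \<alpha> z w) (at z) h -
        (\<Sum>e\<in>obasis. frechet_derivative (\<lambda>z. b z e w) (at z) h * (V z \<bullet> e)))" for w
      using Suc.prems(2) smooth[of "Suc k"]
      by (intro Ck_on_diff Ck_on_sum Ck_on_mult Ck_on_inner Ck_on_const U Vk) auto
  qed
  with diff show ?case by simp
qed

end

section \<open>Charts and tangent vectors\<close>

context smooth_manifold
begin

lemma chart_subset: "c \<in> A \<Longrightarrow> fst c \<subseteq> topspace M"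
  using chart_domain openin_subset by blast

lemma chart_inj:
  assumes "c \<in> A"
  shows "inj_on (snd c) (fst c)"
  using homeomorphic_imp_injective_map[OF chart_homeomorphic[OF assms]] chart_subset[OF assms]
  by (simp add: Int_absorb1)

lemma chart_inv_chart [simp]: "c \<in> A \<Longrightarrow> p \<in> fst c \<Longrightarrow> chart_inv c (snd c p) = p"
  by (simp add: chart_inv_def chart_inj inv_into_f_f)

lemma chart_chart_inv [simp]: "y \<in> snd c ` fst c \<Longrightarrow> snd c (chart_inv c y) = y"
  by (simp add: chart_inv_def f_inv_into_f)

lemma chart_inv_in [simp]: "y \<in> snd c ` fst c \<Longrightarrow> chart_inv c y \<in> fst c"
  by (simp add: chart_inv_def inv_into_into)

lemma continuous_map_chart:
  "c \<in> A \<Longrightarrow> continuous_map (subtopology M (fst c)) euclidean (snd c)"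
  using homeomorphic_imp_continuous_map[OF chart_homeomorphic]
  by (simp add: continuous_map_in_subtopology)

lemma openin_chart_vimage:
  assumes "c \<in> A" "open W"
  shows "openin M {p \<in> fst c. snd c p \<in> W}"
proof -
  have "openin (subtopology M (fst c)) {p \<in> topspace (subtopology M (fst c)). snd c p \<in> W}"
    using openin_continuous_map_preimage[OF continuous_map_chart[OF assms(1)]] assms(2) by simp
  moreover have "topspace (subtopology M (fst c)) = fst c" using chart_subset[OF assms(1)] by auto
  ultimately show ?thesis using chart_domain[OF assms(1)] openin_trans_full by metis
qed

lemma open_chart_image:
  assumes "c \<in> A" "openin M U" "U \<subseteq> fst c"
  shows "open (snd c ` U)"
proof -
  have "openin (subtopology M (fst c)) U"
    using assms openin_subtopology_Int2[of M U "fst c"] by (simp add: Int_absorb1)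
  then have "openin (top_of_set (snd c ` fst c)) (snd c ` U)"
    using homeomorphic_imp_open_map[OF chart_homeomorphic[OF assms(1)]] by (simp add: open_map_def)
  then show ?thesis using chart_image[OF assms(1)] openin_open_trans by blast
qed

lemma continuous_map_chart_inv:
  assumes "c \<in> A"
  shows "continuous_map (top_of_set (snd c ` fst c)) M (chart_inv c)"
  unfolding continuous_map
proof (intro conjI allI impI)
  show "chart_inv c ` topspace (top_of_set (snd c ` fst c)) \<subseteq> topspace M"
    using chart_subset[OF assms] by auto
  fix U assume U: "openin M U"
  have "{x \<in> topspace (top_of_set (snd c ` fst c)). chart_inv c x \<in> U} = snd c ` (U \<inter> fst c)"
    using assms by force
  moreover have "open (snd c ` (U \<inter> fst c))"
    using U chart_domain[OF assms] by (intro open_chart_image[OF assms]) auto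
  ultimately show "openin (top_of_set (snd c ` fst c)) {x \<in> topspace (top_of_set (snd c ` fst c)). chart_inv c x \<in> U}"
    by (metis (no_types, lifting) Int_lower2 image_mono open_openin openin_open_eq chart_image[OF assms] open_subset)
qed

lemma charts_at_iff: "c \<in> charts_at A p \<longleftrightarrow> c \<in> A \<and> p \<in> fst c"
  by (auto simp: charts_at_def)

lemma charts_at_nonempty: "p \<in> topspace M \<Longrightarrow> \<exists>c. c \<in> charts_at A p"
  using charts_cover unfolding charts_at_iff by blast

lemma charts_at_topspace: "c \<in> charts_at A p \<Longrightarrow> p \<in> topspace M"
  using chart_subset unfolding charts_at_iff by blast

lemma open_overlap: "c \<in> A \<Longrightarrow> d \<in> A \<Longrightarrow> open (snd c ` (fst c \<inter> fst d))"
  by (intro open_chart_image openin_Int chart_domain) auto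

lemma Ck_on_transition: "c \<in> A \<Longrightarrow> d \<in> A \<Longrightarrow> Ck_on k (snd c ` (fst c \<inter> fst d)) (transition c d)"
  using transition_smooth open_overlap smooth_on_open by blast

lemma transition_chart: "c \<in> charts_at A p \<Longrightarrow> transition c d (snd c p) = snd d p"
  by (simp add: transition_def charts_at_iff)

abbreviation Dtrans :: "('a, 'b) chart \<Rightarrow> ('a, 'b) chart \<Rightarrow> 'a \<Rightarrow> 'b \<Rightarrow> 'b" where
  "Dtrans c d p \<equiv> frechet_derivative (transition c d) (at (snd c p))"

lemma transition_has_derivative:
  "c \<in> charts_at A p \<Longrightarrow> d \<in> charts_at A p \<Longrightarrow> (transition c d has_derivative Dtrans c d p) (at (snd c p))"
  using Ck_on_has_derivative[OF Ck_on_transition[of c d "Suc 0"]] by (auto simp: charts_at_iff)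

lemma linear_Dtrans: "c \<in> charts_at A p \<Longrightarrow> d \<in> charts_at A p \<Longrightarrow> linear (Dtrans c d p)"
  using transition_has_derivative has_derivative_linear by blast

lemma Dtrans_cocycle:
  assumes "c \<in> charts_at A p" "d \<in> charts_at A p" "e \<in> charts_at A p"
  shows "Dtrans d e p (Dtrans c d p u) = Dtrans c e p u"
proof -
  have "(transition d e has_derivative Dtrans d e p) (at (transition c d (snd c p)))"
    using transition_has_derivative[OF assms(2,3)] transition_chart[OF assms(1)] by simp
  from diff_chain_at[OF transition_has_derivative[OF assms(1,2)] this]
  have "(transition d e \<circ> transition c d has_derivative Dtrans d e p \<circ> Dtrans c d p) (at (snd c p))" .
  then have "(transition c e has_derivative Dtrans d e p \<circ> Dtrans c d p) (at (snd c p))"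
    by (rule has_derivative_transform_within_open[OF _ open_overlap[of c d]])
       (use assms in \<open>auto simp: charts_at_iff transition_def\<close>)
  from fun_cong[OF frechet_derivative_at[OF this], of u] show ?thesis by simp
qed

lemma Dtrans_self:
  assumes "c \<in> charts_at A p"
  shows "Dtrans c c p u = u"
proof -
  have "(transition c c has_derivative (\<lambda>u. u)) (at (snd c p))"
    by (rule has_derivative_transform_within_open[OF has_derivative_ident open_overlap[of c c]])
       (use assms in \<open>auto simp: charts_at_iff transition_def\<close>)
  from fun_cong[OF frechet_derivative_at[OF this], of u] show ?thesis by simp
qed

lemma tangentD:
  "v \<in> tangent_space A p \<Longrightarrow> c \<in> charts_at A p \<Longrightarrow> d \<in> charts_at A p \<Longrightarrow> v d = Dtrans c d p (v c)"
  unfolding tangent_space_def mem_Collect_eq by (elim conjE) (drule (1) bspec, drule (1) bspec)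

lemma tangentI:
  assumes "\<And>c d. c \<in> charts_at A p \<Longrightarrow> d \<in> charts_at A p \<Longrightarrow> v d = Dtrans c d p (v c)"
    and "\<And>c. c \<notin> charts_at A p \<Longrightarrow> v c = 0"
  shows "v \<in> tangent_space A p"
  unfolding tangent_space_def
proof (intro CollectI conjI ballI allI impI)
  fix c d assume "c \<in> charts_at A p" "d \<in> charts_at A p"
  then show "v d = Dtrans c d p (v c)" by (rule assms(1))
next
  fix c assume "c \<notin> charts_at A p"
  then show "v c = 0" by (rule assms(2))
qed

lemma tangent_outside: "v \<in> tangent_space A p \<Longrightarrow> c \<notin> charts_at A p \<Longrightarrow> v c = 0"
  unfolding tangent_space_def mem_Collect_eq by (elim conjE allE[where x=c] impE)

lemma coord_tvec_tangent:
  assumes "c \<in> charts_at A p"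
  shows "coord_tvec A c p u \<in> tangent_space A p"
proof (rule tangentI)
  fix d e assume "d \<in> charts_at A p" "e \<in> charts_at A p"
  then show "coord_tvec A c p u e = Dtrans d e p (coord_tvec A c p u d)"
    using Dtrans_cocycle[OF assms] by (simp add: coord_tvec_def)
qed (simp add: coord_tvec_def)

lemma coord_tvec_same: "c \<in> charts_at A p \<Longrightarrow> coord_tvec A c p u c = u"
  by (simp add: coord_tvec_def Dtrans_self)

lemma coord_tvec_of_tangent:
  assumes "c \<in> charts_at A p" "v \<in> tangent_space A p"
  shows "coord_tvec A c p (v c) = v"
proof
  fix d
  show "coord_tvec A c p (v c) d = v d"
    using tangentD[OF assms(2,1), of d] tangent_outside[OF assms(2), of d] by (simp add: coord_tvec_def)
qed

lemma tangent_lincomb: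
  assumes u: "u \<in> tangent_space A p" and v: "v \<in> tangent_space A p"
  shows "(\<lambda>c. a *\<^sub>R u c + b *\<^sub>R v c) \<in> tangent_space A p"
proof (rule tangentI)
  fix c d assume cd: "c \<in> charts_at A p" "d \<in> charts_at A p"
  note lin = linear_add[OF linear_Dtrans[OF cd]] linear_scale[OF linear_Dtrans[OF cd]]
  show "a *\<^sub>R u d + b *\<^sub>R v d = Dtrans c d p (a *\<^sub>R u c + b *\<^sub>R v c)"
    unfolding lin tangentD[OF u cd] tangentD[OF v cd] ..
qed (simp add: tangent_outside[OF u] tangent_outside[OF v])

lemma tangent_scale: "u \<in> tangent_space A p \<Longrightarrow> (\<lambda>c. a *\<^sub>R u c) \<in> tangent_space A p"
  using tangent_lincomb[of u p u a 0] by simp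

lemma coord_tvec_lincomb:
  assumes "c \<in> charts_at A p"
  shows "coord_tvec A c p (a *\<^sub>R u + b *\<^sub>R v) = (\<lambda>d. a *\<^sub>R coord_tvec A c p u d + b *\<^sub>R coord_tvec A c p v d)"
  using linear_Dtrans[OF assms] by (auto simp: coord_tvec_def linear_add linear_scale)

section \<open>Differentials\<close>

definition mdiff :: "('a \<Rightarrow> real) \<Rightarrow> 'a \<Rightarrow> bool" where
  "mdiff f p \<longleftrightarrow> (\<forall>c\<in>charts_at A p. (f \<circ> chart_inv c) differentiable (at (snd c p)))"

text \<open>The chain rule with \<open>transition d c\<close> cancels the change of the coordinates
  of \<open>v\<close>. This frees \<open>differential\<close> from the chart picked by
  \<open>SOME\<close>.\<close>

lemma differential_chart_change:
  assumes c: "c \<in> charts_at A p" and d: "d \<in> charts_at A p" and v: "v \<in> tangent_space A p"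
    and f: "(f \<circ> chart_inv c) differentiable (at (snd c p))"
  shows "frechet_derivative (f \<circ> chart_inv d) (at (snd d p)) (v d)
    = frechet_derivative (f \<circ> chart_inv c) (at (snd c p)) (v c)"
proof -
  let ?D = "frechet_derivative (f \<circ> chart_inv c) (at (snd c p))"
  have "(f \<circ> chart_inv c has_derivative ?D) (at (transition d c (snd d p)))"
    using has_derivative_frechet[OF f] transition_chart[OF d] by simp
  from diff_chain_at[OF transition_has_derivative[OF d c] this]
  have "((f \<circ> chart_inv c) \<circ> transition d c has_derivative ?D \<circ> Dtrans d c p) (at (snd d p))" .
  then have "(f \<circ> chart_inv d has_derivative ?D \<circ> Dtrans d c p) (at (snd d p))"
    by (rule has_derivative_transform_within_open[OF _ open_overlap[of d c]])
       (use c d in \<open>auto simp: charts_at_iff transition_def\<close>)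
  then have "frechet_derivative (f \<circ> chart_inv d) (at (snd d p)) = ?D \<circ> Dtrans d c p"
    using frechet_derivative_at by metis
  then show ?thesis using tangentD[OF v d c] by simp
qed

lemma differential_eq:
  assumes "c \<in> charts_at A p" "mdiff f p" "v \<in> tangent_space A p"
  shows "differential A f p v = frechet_derivative (f \<circ> chart_inv c) (at (snd c p)) (v c)"
proof -
  define d where "d = (SOME c. c \<in> charts_at A p)"
  have "d \<in> charts_at A p" unfolding d_def using assms(1) by (rule someI)
  with assms show ?thesis
    unfolding differential_def d_def[symmetric] Let_def
    by (intro differential_chart_change) (auto simp: mdiff_def)
qed

lemma smooth_time_fun_slice:
  assumes "smooth_time_fun A H" "t \<in> {0..1}" "c \<in> A"
  shows "smooth_on (snd c ` fst c) (H t \<circ> chart_inv c)"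
proof -
  have "smooth_on (snd c ` fst c) (\<lambda>y. (t, y))"
    by (intro smooth_on_Pair smooth_on_const smooth_on_bounded_linear bounded_linear_ident)
  from smooth_on_compose[OF assms(1)[unfolded smooth_time_fun_def, rule_format, OF assms(3)] this]
  have "smooth_on (snd c ` fst c) (\<lambda>y. case (t, y) of (t, y) \<Rightarrow> H t (chart_inv c y))"
    using assms(2) by blast
  then show ?thesis by (simp add: o_def)
qed

lemma smooth_time_fun_mdiff:
  assumes "smooth_time_fun A H" "t \<in> {0..1}"
  shows "mdiff (H t) p"
proof -
  have "(H t \<circ> chart_inv c) differentiable (at (snd c p))" if c: "c \<in> charts_at A p" for c
  proof -
    have "Ck_on 1 (snd c ` fst c) (H t \<circ> chart_inv c)"
      using smooth_time_fun_slice[OF assms] c chart_image smooth_on_open unfolding charts_at_iff by blast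
    then show ?thesis using c by (auto simp: charts_at_iff)
  qed
  then show ?thesis by (simp add: mdiff_def)
qed

text \<open>Smoothness up to the times 0 and 1 means local extendability; the solution theory below
  therefore works with local extensions of the field past these times.\<close>

definition smooth_vf :: "(real \<Rightarrow> 'a \<Rightarrow> ('a, 'b) tvec) \<Rightarrow> bool" where
  "smooth_vf V \<longleftrightarrow> (\<forall>t\<in>{0..1}. \<forall>p\<in>topspace M. V t p \<in> tangent_space A p) \<and>
     (\<forall>c\<in>A. smooth_on ({0..1} \<times> snd c ` fst c) (\<lambda>(t, y). V t (chart_inv c y) c))"

end

section \<open>Hamiltonian vector fields\<close>

context symplectic_manifold
begin

lemma form_linear_right:
  assumes "p \<in> topspace M" "u \<in> tangent_space A p" "v \<in> tangent_space A p" "w \<in> tangent_space A p"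
  shows "\<omega> p w (\<lambda>c. a *\<^sub>R u c + b *\<^sub>R v c) = a * \<omega> p w u + b * \<omega> p w v"
  using form_linear[OF assms, of a b] form_skew[of p w] tangent_lincomb[OF assms(2,3), of a b] assms
  by (simp add: algebra_simps)

lemma form_coeff_chart:
  assumes "c \<in> charts_at A p"
  shows "form_coeff A \<omega> c u v (snd c p) = \<omega> p (coord_tvec A c p u) (coord_tvec A c p v)"
  using assms by (simp add: form_coeff_def charts_at_iff)

lemma bilinear_form_coeff:
  assumes "c \<in> A" "y \<in> snd c ` fst c"
  shows "bilinear (\<lambda>u v. form_coeff A \<omega> c u v y)"
proof -
  obtain p where p: "p \<in> fst c" "y = snd c p" using assms by blast
  then have c: "c \<in> charts_at A p" using assms by (simp add: charts_at_iff)
  have pM: "p \<in> topspace M" using charts_at_topspace[OF c] .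
  note T = coord_tvec_tangent[OF c]
  have L: "form_coeff A \<omega> c (a *\<^sub>R u + b *\<^sub>R v) w y = a * form_coeff A \<omega> c u w y + b * form_coeff A \<omega> c v w y"
   and R: "form_coeff A \<omega> c w (a *\<^sub>R u + b *\<^sub>R v) y = a * form_coeff A \<omega> c w u y + b * form_coeff A \<omega> c w v y" for a b u v w
    unfolding p(2) form_coeff_chart[OF c] coord_tvec_lincomb[OF c]
    by (rule form_linear[OF pM T T T] form_linear_right[OF pM T T T])+
  show ?thesis
    unfolding bilinear_def
    using L[of 1 _ 1] L[of _ _ 0] R[of _ 1 _ 1] R[of _ _ _ 0] by (auto intro!: linearI)
qed

lemma nondegenerate_form_coeff:
  assumes "c \<in> A" "y \<in> snd c ` fst c" "\<And>w. form_coeff A \<omega> c v w y = 0"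
  shows "v = 0"
proof -
  obtain p where p: "p \<in> fst c" "y = snd c p" using assms by blast
  then have c: "c \<in> charts_at A p" using assms by (simp add: charts_at_iff)
  have "coord_tvec A c p v = (\<lambda>c. 0)"
  proof (rule form_nondegenerate[OF charts_at_topspace[OF c] coord_tvec_tangent[OF c]])
    fix w assume "w \<in> tangent_space A p"
    then show "\<omega> p (coord_tvec A c p v) w = 0"
      using assms(3)[of "w c"] form_coeff_chart[OF c, of v "w c"] coord_tvec_of_tangent[OF c] p(2) by simp
  qed
  then show ?thesis using coord_tvec_same[OF c, of v] by metis
qed

lemma form_in_chart:
  assumes "c \<in> charts_at A p" "u \<in> tangent_space A p" "v \<in> tangent_space A p"
  shows "\<omega> p u v = form_coeff A \<omega> c (u c) (v c) (snd c p)"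
  using form_coeff_chart[OF assms(1)] coord_tvec_of_tangent[OF assms(1)] assms(2,3) by simp

text \<open>In a chart the condition is a linear equation for the coordinate vector with a
  non-degenerate form, hence uniquely solvable. This gives meaning to the \<open>THE\<close> in
  \<open>ham_vf\<close>.\<close>

lemma ham_vf_ex1:
  assumes "p \<in> topspace M" "mdiff f p"
  shows "\<exists>!v. v \<in> tangent_space A p \<and> (\<forall>w\<in>tangent_space A p. \<omega> p v w = differential A f p w)"
proof -
  obtain c where c: "c \<in> charts_at A p" using charts_at_nonempty[OF assms(1)] by blast
  then have y: "c \<in> A" "snd c p \<in> snd c ` fst c" by (auto simp: charts_at_iff)
  let ?D = "frechet_derivative (f \<circ> chart_inv c) (at (snd c p))"
  have "linear ?D" using assms(2) c
    by (intro has_derivative_linear[OF has_derivative_frechet]) (auto simp: mdiff_def)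
  from bilinear_nondegenerate_ex1[OF bilinear_form_coeff[OF y] nondegenerate_form_coeff[OF y] this]
  have ex1: "\<exists>!v. \<forall>w. form_coeff A \<omega> c v w (snd c p) = ?D w" by simp
  have eq: "(\<forall>w\<in>tangent_space A p. \<omega> p v w = differential A f p w) \<longleftrightarrow>
      (\<forall>w. form_coeff A \<omega> c (v c) w (snd c p) = ?D w)" if v: "v \<in> tangent_space A p" for v
  proof -
    have 1: "\<omega> p v w = differential A f p w \<longleftrightarrow> form_coeff A \<omega> c (v c) (w c) (snd c p) = ?D (w c)"
      if w: "w \<in> tangent_space A p" for w
      using form_in_chart[OF c v w] differential_eq[OF c assms(2) w] by simp
    show ?thesis
    proof safe
      fix w assume "\<forall>w\<in>tangent_space A p. \<omega> p v w = differential A f p w"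
      then show "form_coeff A \<omega> c (v c) w (snd c p) = ?D w"
        using 1[OF coord_tvec_tangent[OF c]] coord_tvec_tangent[OF c] coord_tvec_same[OF c, of w] by metis
    qed (use 1 in blast)
  qed
  from ex1 obtain u where u: "\<forall>w. form_coeff A \<omega> c u w (snd c p) = ?D w" by blast
  show ?thesis
  proof (rule ex1I[of _ "coord_tvec A c p u"])
    show "coord_tvec A c p u \<in> tangent_space A p \<and>
      (\<forall>w\<in>tangent_space A p. \<omega> p (coord_tvec A c p u) w = differential A f p w)"
      using coord_tvec_tangent[OF c] eq[OF coord_tvec_tangent[OF c]] coord_tvec_same[OF c] u by metis
    fix v assume v: "v \<in> tangent_space A p \<and> (\<forall>w\<in>tangent_space A p. \<omega> p v w = differential A f p w)"
    then have "v c = u" using eq ex1 u by blast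
    then show "v = coord_tvec A c p u" using coord_tvec_of_tangent[OF c] v by metis
  qed
qed

lemma ham_vf_props:
  assumes "p \<in> topspace M" "mdiff (H t) p"
  shows "ham_vf A \<omega> H t p \<in> tangent_space A p"
    "w \<in> tangent_space A p \<Longrightarrow> \<omega> p (ham_vf A \<omega> H t p) w = differential A (H t) p w"
  using theI'[OF ham_vf_ex1[OF assms]] by (auto simp: ham_vf_def)

lemma ham_vf_unique:
  assumes "p \<in> topspace M" "mdiff (H t) p" "v \<in> tangent_space A p"
    "\<And>w. w \<in> tangent_space A p \<Longrightarrow> \<omega> p v w = differential A (H t) p w"
  shows "ham_vf A \<omega> H t p = v"
  unfolding ham_vf_def using the1_equality[OF ham_vf_ex1[OF assms(1,2)]] assms(3,4) by blast

lemma ham_vf_coord: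
  assumes "c \<in> charts_at A p" "mdiff (H t) p"
  shows "form_coeff A \<omega> c (ham_vf A \<omega> H t p c) w (snd c p) =
    frechet_derivative (H t \<circ> chart_inv c) (at (snd c p)) w"
  using ham_vf_props(2)[where H=H and t=t, OF charts_at_topspace[OF assms(1)] assms(2) coord_tvec_tangent[OF assms(1), of w]]
    form_in_chart[OF assms(1) ham_vf_props(1)[where H=H and t=t, OF charts_at_topspace[OF assms(1)] assms(2)] coord_tvec_tangent[OF assms(1), of w]]
    differential_eq[OF assms coord_tvec_tangent[OF assms(1), of w]]
    coord_tvec_same[OF assms(1), of w]
  by simp

text \<open>A local extension \<open>g\<close> of \<open>H\<close> past the times 0 and 1 turns the
  defining equation into one on an open set. Its solution is smooth by \<open>solution_Ck\<close>
  and extends the coordinates of the field.\<close>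

lemma ham_vf_smooth:
  assumes H: "smooth_time_fun A H"
  shows "smooth_vf (ham_vf A \<omega> H)"
  unfolding smooth_vf_def
proof (intro conjI ballI)
  show "ham_vf A \<omega> H t p \<in> tangent_space A p" if "t \<in> {0..1}" "p \<in> topspace M" for t p
    using that ham_vf_props(1) smooth_time_fun_mdiff[OF H] by blast
  fix c assume c: "c \<in> A"
  let ?I = "snd c ` fst c"
  show "smooth_on ({0..1} \<times> ?I) (\<lambda>(t, y). ham_vf A \<omega> H t (chart_inv c y) c)"
  proof (rule smooth_onI)
    fix x :: "real \<times> 'b" assume x: "x \<in> {0..1} \<times> ?I"
    obtain U0 g where U0: "open U0" "x \<in> U0" "\<And>k. Ck_on k U0 g"
      "\<And>z. z \<in> {0..1} \<times> ?I \<Longrightarrow> z \<in> U0 \<Longrightarrow> g z = (case z of (t, y) \<Rightarrow> H t (chart_inv c y))"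
      using smooth_onE[OF H[unfolded smooth_time_fun_def, rule_format, OF c] x] by metis
    define U where "U = U0 \<inter> (UNIV \<times> ?I)"
    have Up: "open U" "x \<in> U" "U \<subseteq> UNIV \<times> ?I" "U \<subseteq> U0"
      using U0(1,2) x chart_image[OF c] by (auto simp: U_def open_Times)
    have g: "Ck_on k U g" for k using Ck_on_subset[OF U0(3) Up(4)] .
    define b where "b z v w = form_coeff A \<omega> c v w (snd z)" for z :: "real \<times> 'b" and v w
    have sU: "snd z \<in> ?I" if "z \<in> U" for z using that Up(3) by auto
    interpret smooth_linear_family b U
    proof
      show "open U" by fact
      show "bilinear (b z)" if "z \<in> U" for z
        using bilinear_form_coeff[OF c sU[OF that]] by (simp add: b_def[abs_def])
      show "v = 0" if "z \<in> U" "\<And>w. b z v w = 0" for z v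
        using nondegenerate_form_coeff[OF c sU[OF that(1)]] that(2) by (simp add: b_def)
      show "Ck_on k U (\<lambda>z. b z v w)" for k v w
        unfolding b_def
      proof (rule Ck_on_compose[OF Up(1) chart_image[OF c]])
        show "Ck_on k ?I (form_coeff A \<omega> c v w)"
          using form_smooth[OF c] smooth_on_open[OF chart_image[OF c]] by blast
        show "Ck_on k U snd" using Ck_on_bounded_linear[OF bounded_linear_snd Up(1) Ck_on_id[OF Up(1)]] .
      qed (use Up(3) in auto)
    qed
    \<comment> \<open>The derivative of the extension in chart directions only; time remains a
      parameter.\<close>
    define \<alpha> where "\<alpha> z w = frechet_derivative g (at z) (0, w)" for z w
    have gd: "(g has_derivative frechet_derivative g (at z)) (at z)" if "z \<in> U" for z
      using Ck_on_has_derivative[OF g that] .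
    have lin: "linear (\<alpha> z)" if "z \<in> U" for z
      unfolding \<alpha>_def using linear_compose[of "\<lambda>w. (0, w)" "frechet_derivative g (at z)"]
        has_derivative_linear[OF gd[OF that]]
      by (simp add: o_def linear_iff)
    define V where "V z = (THE v. \<forall>w. b z v w = \<alpha> z w)" for z
    have ex1: "\<exists>!v. \<forall>w. b z v w = \<alpha> z w" if "z \<in> U" for z
      using bilinear_nondegenerate_ex1[OF bil[OF that] nondeg[OF that] lin[OF that]] by simp
    have V: "b z (V z) w = \<alpha> z w" if "z \<in> U" for z w
      using theI'[OF ex1[OF that]] by (simp add: V_def)
    have "Ck_on k U (\<lambda>z. \<alpha> z w)" for k w
      using g[of "Suc k"] by (simp add: \<alpha>_def)
    from solution_Ck[OF V this] have CkV: "Ck_on k U V" for k .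
    have "V z = (case z of (t, y) \<Rightarrow> ham_vf A \<omega> H t (chart_inv c y) c)" if z: "z \<in> ({0..1} \<times> ?I) \<inter> U" for z
    proof -
      obtain t y where ty: "z = (t, y)" by force
      define p where "p = chart_inv c y"
      have t: "t \<in> {0..1}" and y: "y \<in> ?I" and zU: "(t, y) \<in> U" using z ty by auto
      have p: "p \<in> fst c" "snd c p = y" using y by (auto simp: p_def)
      have cp: "c \<in> charts_at A p" using p c by (simp add: charts_at_iff)
      have "((\<lambda>y. (t, y)) has_derivative (\<lambda>w. (0, w))) (at y)"
        by (intro has_derivative_Pair has_derivative_const has_derivative_ident)
      from diff_chain_at[OF this gd[OF zU]]
      have "((\<lambda>y. g (t, y)) has_derivative \<alpha> (t, y)) (at y)"
        by (simp add: o_def \<alpha>_def[abs_def])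
      then have "((H t \<circ> chart_inv c) has_derivative \<alpha> (t, y)) (at y)"
      \<comment> \<open>For fixed \<open>t\<close> in \<open>{0..1}\<close> the extension agrees
        with \<open>H t\<close> on an open slice, so their derivatives in the chart coincide even at
        \<open>t = 0\<close> and \<open>t = 1\<close>.\<close>
      proof (rule has_derivative_transform_within_open[of _ _ _ _ "Pair t -` U"])
        show "open (Pair t -` U)" using Up(1) by (intro open_vimage continuous_intros)
        show "g (t, y') = (H t \<circ> chart_inv c) y'" if "y' \<in> Pair t -` U" for y'
          using U0(4)[of "(t, y')"] that Up(3,4) t by auto
      qed (use zU in auto)
      then have "frechet_derivative (H t \<circ> chart_inv c) (at y) = \<alpha> (t, y)"
        by (rule frechet_derivative_at[symmetric])
      then have "\<forall>w. b z (ham_vf A \<omega> H t p c) w = \<alpha> z w"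
        using ham_vf_coord[where H=H and t=t, OF cp smooth_time_fun_mdiff[OF H t]] p(2) ty by (simp add: b_def)
      then have "V z = ham_vf A \<omega> H t p c" using ex1[of z] V[of z] zU ty by blast
      then show ?thesis by (simp add: ty p_def)
    qed
    then show "\<exists>U g. open U \<and> x \<in> U \<and> (\<forall>k. Ck_on k U g) \<and>
       (\<forall>y\<in>({0..1} \<times> ?I) \<inter> U. g y = (case y of (t, y) \<Rightarrow> ham_vf A \<omega> H t (chart_inv c y) c))"
      using Up CkV by blast
  qed
qed

end

section \<open>Integral curves on manifolds\<close>

lemma ode_locally_unique:
  fixes F :: "real \<times> 'b \<Rightarrow> 'b::{real_inner, heine_borel}"
  assumes W: "open W" "Ck_on (Suc 0) W F" and s0: "s0 \<in> {a..b}" "u s0 = v s0" "(s0, u s0) \<in> W"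
    and u: "\<And>s. s \<in> {a..b} \<Longrightarrow> (u has_vector_derivative F (s, u s)) (at s within {a..b})"
    and v: "\<And>s. s \<in> {a..b} \<Longrightarrow> (v has_vector_derivative F (s, v s)) (at s within {a..b})"
  obtains \<delta> where "\<delta> > 0" "\<And>s. s \<in> {a..b} \<Longrightarrow> \<bar>s - s0\<bar> < \<delta> \<Longrightarrow> u s = v s"
proof -
  obtain r C L where r: "r > 0" and L: "L > 0"
    and lip: "\<And>z z'. z \<in> cball (s0, u s0) r \<Longrightarrow> z' \<in> cball (s0, u s0) r \<Longrightarrow> norm (F z - F z') \<le> L * norm (z - z')"
    using C1_imp_locally_lipschitz[OF W s0(3)] by metis
  have "continuous_on {a..b} (\<lambda>s. (s, u s))" "continuous_on {a..b} (\<lambda>s. (s, v s))"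
    using continuous_on_vector_derivative[OF u] continuous_on_vector_derivative[OF v]
    by (auto intro!: continuous_intros)
  then obtain d1 d2 where d: "d1 > 0" "\<And>s. s \<in> {a..b} \<Longrightarrow> dist s s0 < d1 \<Longrightarrow> dist (s, u s) (s0, u s0) < r"
      "d2 > 0" "\<And>s. s \<in> {a..b} \<Longrightarrow> dist s s0 < d2 \<Longrightarrow> dist (s, v s) (s0, v s0) < r"
    unfolding continuous_on_iff using s0(1) r by metis
  \<comment> \<open>Halving yields a closed time interval inside both open ranges.\<close>
  define \<delta> where "\<delta> = min d1 d2 / 2"
  define a' b' where "a' = max a (s0 - \<delta>)" and "b' = min b (s0 + \<delta>)"
  have \<delta>: "\<delta> > 0" "\<delta> < d1" "\<delta> < d2" using d by (auto simp: \<delta>_def)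
  have sub: "{a'..b'} \<subseteq> {a..b}" by (auto simp: a'_def b'_def)
  have near: "dist s s0 < d1" "dist s s0 < d2" if "s \<in> {a'..b'}" for s
    using that \<delta> by (auto simp: a'_def b'_def dist_real_def)
  have "u s - v s = 0" if s: "s \<in> {a'..b'}" for s
  proof (rule gronwall_zero[where d="\<lambda>s. u s - v s" and d'="\<lambda>s. F (s, u s) - F (s, v s)"
        and a=a' and b=b' and L=L and ?s0.0=s0])
    fix t assume t: "t \<in> {a'..b'}"
    have tab: "t \<in> {a..b}" using t sub by blast
    show "((\<lambda>s. u s - v s) has_vector_derivative F (t, u t) - F (t, v t)) (at t within {a'..b'})"
      by (intro derivative_intros has_vector_derivative_within_subset[OF u[OF tab] sub]
          has_vector_derivative_within_subset[OF v[OF tab] sub])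
    have "norm (F (t, u t) - F (t, v t)) \<le> L * norm ((t, u t) - (t, v t))"
      using d(2)[OF tab near(1)[OF t]] d(4)[OF tab near(2)[OF t]] s0(2)
      by (intro lip) (auto simp: dist_commute)
    then show "norm (F (t, u t) - F (t, v t)) \<le> L * norm (u t - v t)"
      by (simp add: norm_Pair_diff_fst_eq)
  qed (use s s0 \<delta> in \<open>auto simp: a'_def b'_def\<close>)
  moreover have "s \<in> {a'..b'}" if "s \<in> {a..b}" "\<bar>s - s0\<bar> < \<delta>" for s
    using that by (auto simp: a'_def b'_def)
  ultimately show ?thesis using \<delta>(1) by (intro that[of \<delta>]) auto
qed

lemma continuous_map_top_of_set_iff:
  fixes I :: "real set"
  shows "continuous_map (top_of_set I) M x \<longleftrightarrow> x ` I \<subseteq> topspace M \<and>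
    (\<forall>s\<in>I. \<forall>U. openin M U \<longrightarrow> x s \<in> U \<longrightarrow> (\<exists>\<delta>>0. \<forall>s'\<in>I. dist s' s < \<delta> \<longrightarrow> x s' \<in> U))"
proof -
  have "openin (top_of_set I) {s \<in> I. x s \<in> U} \<longleftrightarrow>
      (\<forall>s\<in>I. x s \<in> U \<longrightarrow> (\<exists>\<delta>>0. \<forall>s'\<in>I. dist s' s < \<delta> \<longrightarrow> x s' \<in> U))" for U
    unfolding openin_euclidean_subtopology_iff by auto
  then show ?thesis unfolding continuous_map by auto
qed

section \<open>Solutions in charts, uniqueness and regularity\<close>

context smooth_manifold
begin

text \<open>Weaker than \<open>integral_curve\<close>: any set of times, and a derivative in place
  of smoothness. Such curves are easily cut, glued and reparametrised; \<open>solves_smooth\<close>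
  recovers smoothness when the field is smooth.\<close>

definition solves :: "(real \<Rightarrow> 'a \<Rightarrow> ('a, 'b) tvec) \<Rightarrow> real set \<Rightarrow> (real \<Rightarrow> 'a) \<Rightarrow> bool" where
  "solves V I x \<longleftrightarrow> continuous_map (top_of_set I) M x \<and>
     (\<forall>s\<in>I. \<forall>c\<in>charts_at A (x s). ((snd c \<circ> x) has_vector_derivative V s (x s) c) (at s within I))"

lemma solves_continuous: "solves V I x \<Longrightarrow> continuous_map (top_of_set I) M x"
  by (simp add: solves_def)

lemma solves_derivative:
  "solves V I x \<Longrightarrow> s \<in> I \<Longrightarrow> c \<in> charts_at A (x s) \<Longrightarrow>
    ((snd c \<circ> x) has_vector_derivative V s (x s) c) (at s within I)"
  by (simp add: solves_def)

lemma solves_in: "solves V I x \<Longrightarrow> s \<in> I \<Longrightarrow> x s \<in> topspace M"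
  using continuous_map_image_subset_topspace[OF solves_continuous] by fastforce

lemma solves_near:
  assumes "solves V I x" "s \<in> I" "openin M U" "x s \<in> U"
  obtains \<delta> where "\<delta> > 0" "\<And>s'. s' \<in> I \<Longrightarrow> \<bar>s' - s\<bar> < \<delta> \<Longrightarrow> x s' \<in> U"
proof -
  from continuous_map_top_of_set_iff[THEN iffD1, OF solves_continuous[OF assms(1)],
      THEN conjunct2, rule_format, OF assms(2-4)]
  obtain \<delta> where "\<delta> > 0" "\<forall>s'\<in>I. dist s' s < \<delta> \<longrightarrow> x s' \<in> U" by blast
  then show ?thesis by (intro that[of \<delta>]) (auto simp: dist_real_def)
qed

lemma solves_subset: "solves V I x \<Longrightarrow> J \<subseteq> I \<Longrightarrow> solves V J x"
  unfolding solves_def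
  by (meson continuous_map_from_subtopology_mono has_vector_derivative_within_subset subsetD)

lemma solves_cong:
  assumes "solves V I x" "\<And>s. s \<in> I \<Longrightarrow> x s = y s" "\<And>s. s \<in> I \<Longrightarrow> V s (x s) = W s (x s)"
  shows "solves W I y"
  unfolding solves_def
proof (intro conjI ballI)
  show "continuous_map (top_of_set I) M y"
    by (rule continuous_map_eq[OF solves_continuous[OF assms(1)]]) (use assms in auto)
  fix s c assume s: "s \<in> I" and c: "c \<in> charts_at A (y s)"
  have "((snd c \<circ> x) has_vector_derivative W s (y s) c) (at s within I)"
    using solves_derivative[OF assms(1) s, of c] assms(2,3)[OF s] c by simp
  then show "((snd c \<circ> y) has_vector_derivative W s (y s) c) (at s within I)"
    by (rule has_vector_derivative_transform[rotated 2]) (use s assms(2) in auto)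
qed

text \<open>Transports an equation verified in one chart to all the charts over which
  \<open>solves\<close> quantifies. Tangency of \<open>v\<close> is what turns the chain rule for
  \<open>transition c d\<close> into the component \<open>v d\<close>.\<close>

lemma derivative_chart_change:
  assumes x: "continuous_map (top_of_set I) M x" and s: "s \<in> I"
    and c: "c \<in> charts_at A (x s)" and d: "d \<in> charts_at A (x s)" and v: "v \<in> tangent_space A (x s)"
    and D: "((snd c \<circ> x) has_vector_derivative v c) (at s within I)"
  shows "((snd d \<circ> x) has_vector_derivative v d) (at s within I)"
proof -
  have "(transition c d has_derivative Dtrans c d (x s)) (at ((snd c \<circ> x) s) within (snd c \<circ> x) ` I)"
    using transition_has_derivative[OF c d] by (simp add: has_derivative_at_withinI)
  from vector_derivative_diff_chain_within[OF D this]
  have "(transition c d \<circ> (snd c \<circ> x) has_vector_derivative v d) (at s within I)"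
    unfolding tangentD[OF v c d] by (simp add: comp_def)
  moreover obtain \<delta> where "\<delta> > 0" "\<And>s'. s' \<in> I \<Longrightarrow> dist s' s < \<delta> \<Longrightarrow> x s' \<in> fst c"
    using x s c chart_domain unfolding continuous_map_top_of_set_iff charts_at_iff by metis
  ultimately show ?thesis
    by (elim has_vector_derivative_transform_within) (use s c in \<open>auto simp: charts_at_iff transition_def\<close>)
qed

text \<open>Supplies a right-hand side that is smooth on an open set around
  \<open>(s0, snd c p)\<close>, even if \<open>s0\<close> is 0 or 1, so that the Euclidean theorems
  apply.\<close>

lemma smooth_vf_local:
  assumes V: "smooth_vf V" and s0: "s0 \<in> {0..1}" and c: "c \<in> charts_at A p"
  obtains r B F where "r > 0" "open B" "snd c p \<in> B" "B \<subseteq> snd c ` fst c"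
    "\<And>k. Ck_on k (ball s0 r \<times> B) F"
    "\<forall>s y. s \<in> ball s0 r \<longrightarrow> s \<in> {0..1} \<longrightarrow> y \<in> B \<longrightarrow> F (s, y) = V s (chart_inv c y) c"
proof -
  let ?I = "snd c ` fst c"
  have cA: "c \<in> A" and pc: "p \<in> fst c" using c by (auto simp: charts_at_iff)
  have sm: "smooth_on ({0..1} \<times> ?I) (\<lambda>(t, y). V t (chart_inv c y) c)"
    using V cA unfolding smooth_vf_def by blast
  have mem: "(s0, snd c p) \<in> {0..1} \<times> ?I" using s0 pc by auto
  obtain U F where U: "open U" "(s0, snd c p) \<in> U" "\<And>k. Ck_on k U F"
    "\<And>z. z \<in> {0..1} \<times> ?I \<Longrightarrow> z \<in> U \<Longrightarrow> F z = (case z of (t, y) \<Rightarrow> V t (chart_inv c y) c)"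
    using smooth_onE[OF sm mem] by metis
  obtain S B' where SO: "open S" "open B'" "s0 \<in> S" "snd c p \<in> B'" "S \<times> B' \<subseteq> U"
    using open_prod_elim[OF U(1,2)] by (metis mem_Sigma_iff)
  obtain r where r: "r > 0" "ball s0 r \<subseteq> S" using SO(1,3) open_contains_ball by metis
  show ?thesis
  proof (rule that[of r "B' \<inter> ?I" F])
    show "open (B' \<inter> ?I)" using SO(2) chart_image[OF cA] by blast
    have sub: "ball s0 r \<times> (B' \<inter> ?I) \<subseteq> U" using r(2) SO(5) by blast
    show "Ck_on k (ball s0 r \<times> (B' \<inter> ?I)) F" for k using Ck_on_subset[OF U(3) sub] .
    show "\<forall>s y. s \<in> ball s0 r \<longrightarrow> s \<in> {0..1} \<longrightarrow> y \<in> B' \<inter> ?I \<longrightarrow> F (s, y) = V s (chart_inv c y) c"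
    proof (intro allI impI)
      fix s y assume "s \<in> ball s0 r" "s \<in> {0..1}" "y \<in> B' \<inter> ?I"
      then show "F (s, y) = V s (chart_inv c y) c" using U(4)[of "(s, y)"] subsetD[OF sub, of "(s, y)"] by auto
    qed
  qed (use r SO pc in auto)
qed

lemma solves_in_chart:
  assumes x: "solves V I x" "I \<subseteq> {0..1}" "s0 \<in> I" and c: "c \<in> charts_at A (x s0)"
    and B: "r > 0" "open B" "snd c (x s0) \<in> B"
    and F: "\<forall>s y. s \<in> ball s0 r \<longrightarrow> s \<in> {0..1} \<longrightarrow> y \<in> B \<longrightarrow> F (s, y) = V s (chart_inv c y) c"
  obtains \<delta> where "\<delta> > 0" "\<delta> \<le> r" "\<And>s. s \<in> I \<Longrightarrow> \<bar>s - s0\<bar> < \<delta> \<Longrightarrow> x s \<in> fst c \<and> snd c (x s) \<in> B \<and>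
     ((snd c \<circ> x) has_vector_derivative F (s, (snd c \<circ> x) s)) (at s within I)"
proof -
  have cA: "c \<in> A" and pc: "x s0 \<in> fst c" using c by (auto simp: charts_at_iff)
  have "x s0 \<in> {p \<in> fst c. snd c p \<in> B}" using pc B by simp
  from solves_near[OF x(1,3) openin_chart_vimage[OF cA B(2)] this]
  obtain \<delta> where \<delta>: "\<delta> > 0" "\<And>s. s \<in> I \<Longrightarrow> \<bar>s - s0\<bar> < \<delta> \<Longrightarrow> x s \<in> fst c \<and> snd c (x s) \<in> B"
    by (metis (no_types, lifting) mem_Collect_eq)
  show ?thesis
  proof (rule that[of "min \<delta> r"])
    fix s assume s: "s \<in> I" "\<bar>s - s0\<bar> < min \<delta> r"
    then have xs: "x s \<in> fst c" "snd c (x s) \<in> B" using \<delta>(2) by auto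
    have "F (s, snd c (x s)) = V s (x s) c"
      using F[rule_format, of s "snd c (x s)"] s x(2) xs cA by (auto simp: dist_real_def)
    then show "x s \<in> fst c \<and> snd c (x s) \<in> B \<and>
      ((snd c \<circ> x) has_vector_derivative F (s, (snd c \<circ> x) s)) (at s within I)"
      using xs solves_derivative[OF x(1) s(1), of c] cA by (simp add: charts_at_iff)
  qed (use \<delta> B in auto)
qed

lemma solves_locally_unique:
  assumes V: "smooth_vf V" and x: "solves V {a..b} x" and y: "solves V {a..b} y"
    and ab: "{a..b} \<subseteq> {0..1}" and s0: "s0 \<in> {a..b}" "x s0 = y s0"
  obtains \<delta> where "\<delta> > 0" "\<And>s. s \<in> {a..b} \<Longrightarrow> \<bar>s - s0\<bar> < \<delta> \<Longrightarrow> x s = y s"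
proof -
  obtain c where c: "c \<in> charts_at A (x s0)" using charts_at_nonempty[OF solves_in[OF x s0(1)]] by blast
  have cy: "c \<in> charts_at A (y s0)" using c s0 by simp
  have s01: "s0 \<in> {0..1}" using s0 ab by blast
  obtain r B F where B: "r > 0" "open B" "snd c (x s0) \<in> B"
    and Ck: "\<And>k. Ck_on k (ball s0 r \<times> B) F"
    and F: "\<forall>s y. s \<in> ball s0 r \<longrightarrow> s \<in> {0..1} \<longrightarrow> y \<in> B \<longrightarrow> F (s, y) = V s (chart_inv c y) c"
    using smooth_vf_local[OF V s01 c] by metis
  have Oy: "snd c (y s0) \<in> B" using B s0 by simp
  obtain d1 where d1: "d1 > 0" "\<And>s. s \<in> {a..b} \<Longrightarrow> \<bar>s - s0\<bar> < d1 \<Longrightarrow> x s \<in> fst c \<and> snd c (x s) \<in> B \<and>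
     ((snd c \<circ> x) has_vector_derivative F (s, (snd c \<circ> x) s)) (at s within {a..b})"
    using solves_in_chart[OF x ab s0(1) c B F] by metis
  obtain d2 where d2: "d2 > 0" "\<And>s. s \<in> {a..b} \<Longrightarrow> \<bar>s - s0\<bar> < d2 \<Longrightarrow> y s \<in> fst c \<and> snd c (y s) \<in> B \<and>
     ((snd c \<circ> y) has_vector_derivative F (s, (snd c \<circ> y) s)) (at s within {a..b})"
    using solves_in_chart[OF y ab s0(1) cy B(1,2) Oy F] by metis
  define d where "d = min d1 d2 / 2"
  define a' b' where "a' = max a (s0 - d)" and "b' = min b (s0 + d)"
  have d: "d > 0" "d < d1" "d < d2" using d1 d2 by (auto simp: d_def)
  have sub: "{a'..b'} \<subseteq> {a..b}" by (auto simp: a'_def b'_def)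
  have near: "\<bar>s - s0\<bar> < d1" "\<bar>s - s0\<bar> < d2" "s \<in> {a..b}" if "s \<in> {a'..b'}" for s
    using that d sub by (auto simp: a'_def b'_def)
  obtain \<delta> where \<delta>: "\<delta> > 0" "\<And>s. s \<in> {a'..b'} \<Longrightarrow> \<bar>s - s0\<bar> < \<delta> \<Longrightarrow> (snd c \<circ> x) s = (snd c \<circ> y) s"
  proof (rule ode_locally_unique[of "ball s0 r \<times> B" F s0 a' b' "snd c \<circ> x" "snd c \<circ> y"])
    show "open (ball s0 r \<times> B)" using B by (intro open_Times) auto
    fix s assume s: "s \<in> {a'..b'}"
    show "((snd c \<circ> x) has_vector_derivative F (s, (snd c \<circ> x) s)) (at s within {a'..b'})"
      using d1(2)[OF near(3)[OF s] near(1)[OF s]] has_vector_derivative_within_subset[OF _ sub] by blast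
    show "((snd c \<circ> y) has_vector_derivative F (s, (snd c \<circ> y) s)) (at s within {a'..b'})"
      using d2(2)[OF near(3)[OF s] near(2)[OF s]] has_vector_derivative_within_subset[OF _ sub] by blast
  qed (use Ck B s0 d in \<open>auto simp: a'_def b'_def simp del: Ck_on.simps\<close>)
  show ?thesis
  proof (rule that[of "min \<delta> d"])
    fix s assume s: "s \<in> {a..b}" "\<bar>s - s0\<bar> < min \<delta> d"
    then have "s \<in> {a'..b'}" by (auto simp: a'_def b'_def)
    then have "snd c (x s) = snd c (y s)" "x s \<in> fst c" "y s \<in> fst c"
      using \<delta>(2)[of s] s d1(2) d2(2) near by auto
    then show "x s = y s" using inj_onD[OF chart_inj] c unfolding charts_at_iff by blast
  qed (use \<delta> d in auto)
qed

text \<open>The times of coincidence form an open set by local uniqueness, the remaining times by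
  the Hausdorff property, and the interval is connected. The common point may lie at any time, so
  uniqueness holds backward as well.\<close>

lemma solves_unique:
  assumes V: "smooth_vf V" and x: "solves V {a..b} x" and y: "solves V {a..b} y"
    and ab: "{a..b} \<subseteq> {0..1}" and s0: "s0 \<in> {a..b}" "x s0 = y s0" and s: "s \<in> {a..b}"
  shows "x s = y s"
proof -
  define E where "E = {s \<in> {a..b}. x s = y s}"
  have "openin (top_of_set {a..b}) E"
    unfolding openin_euclidean_subtopology_iff
  proof (intro conjI ballI)
    fix s assume "s \<in> E"
    then have "s \<in> {a..b}" "x s = y s" by (auto simp: E_def)
    from solves_locally_unique[OF V x y ab this] obtain \<delta> where
      "\<delta> > 0" "\<And>s'. s' \<in> {a..b} \<Longrightarrow> \<bar>s' - s\<bar> < \<delta> \<Longrightarrow> x s' = y s'" by metis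
    then show "\<exists>e>0. \<forall>x'\<in>{a..b}. dist x' s < e \<longrightarrow> x' \<in> E"
      by (auto simp: E_def dist_real_def)
  qed (auto simp: E_def)
  moreover have "openin (top_of_set {a..b}) ({a..b} - E)"
    unfolding openin_euclidean_subtopology_iff
  proof (intro conjI ballI)
    fix s assume "s \<in> {a..b} - E"
    then have s: "s \<in> {a..b}" "x s \<noteq> y s" by (auto simp: E_def)
    then obtain U1 U2 where U: "openin M U1" "openin M U2" "x s \<in> U1" "y s \<in> U2" "disjnt U1 U2"
      using Hausdorff solves_in[OF x s(1)] solves_in[OF y s(1)] unfolding Hausdorff_space_def by metis
    obtain d1 where d1: "d1 > 0" "\<And>s'. s' \<in> {a..b} \<Longrightarrow> \<bar>s' - s\<bar> < d1 \<Longrightarrow> x s' \<in> U1"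
      using solves_near[OF x s(1) U(1,3)] by metis
    obtain d2 where d2: "d2 > 0" "\<And>s'. s' \<in> {a..b} \<Longrightarrow> \<bar>s' - s\<bar> < d2 \<Longrightarrow> y s' \<in> U2"
      using solves_near[OF y s(1) U(2,4)] by metis
    have "x s' \<noteq> y s'" if "s' \<in> {a..b}" "\<bar>s' - s\<bar> < min d1 d2" for s'
      using d1(2)[of s'] d2(2)[of s'] that U(5) by (auto simp: disjnt_iff)
    then show "\<exists>e>0. \<forall>x'\<in>{a..b}. dist x' s < e \<longrightarrow> x' \<in> {a..b} - E"
      using d1(1) d2(1) by (intro exI[of _ "min d1 d2"]) (auto simp: E_def dist_real_def)
  qed (auto simp: E_def)
  ultimately have "E = {} \<or> E = {a..b}"
    using connected_clopen[of "{a..b}"] by (auto simp: closedin_def E_def)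
  moreover have "s0 \<in> E" using s0 by (simp add: E_def)
  ultimately have "s \<in> E" using s by blast
  then show ?thesis by (simp add: E_def)
qed

text \<open>At an end point of the interval, the extension demanded by \<^const>\<open>smooth_on\<close> is the local solution
  of the extended equation; it agrees with \<open>x\<close> by uniqueness.\<close>

lemma solves_smooth:
  assumes V: "smooth_vf V" and x: "solves V {0..t} x" and t: "t \<le> 1"
  shows "smooth_curve M A t x"
  unfolding smooth_curve_def
proof (intro conjI ballI)
  show "continuous_map (top_of_set {0..t}) M x" using solves_continuous[OF x] .
  fix c assume cA: "c \<in> A"
  show "smooth_on {s \<in> {0..t}. x s \<in> fst c} (snd c \<circ> x)"
  proof (rule smooth_onI)
    fix s0 assume "s0 \<in> {s \<in> {0..t}. x s \<in> fst c}"
    then have s0: "s0 \<in> {0..t}" "s0 \<in> {0..1}" and c: "c \<in> charts_at A (x s0)"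
      using t cA by (auto simp: charts_at_iff)
    have t01: "{0..t} \<subseteq> {0..1}" using t by auto
    obtain r B F where B: "r > 0" "open B" "snd c (x s0) \<in> B"
      and Ck: "\<And>k. Ck_on k (ball s0 r \<times> B) F"
      and F: "\<forall>s y. s \<in> ball s0 r \<longrightarrow> s \<in> {0..1} \<longrightarrow> y \<in> B \<longrightarrow> F (s, y) = V s (chart_inv c y) c"
      using smooth_vf_local[OF V s0(2) c] by metis
    have W: "open (ball s0 r \<times> B)" "(s0, snd c (x s0)) \<in> ball s0 r \<times> B" using B by (auto intro: open_Times)
    obtain d1 where d1: "d1 > 0" "\<And>s. s \<in> {0..t} \<Longrightarrow> \<bar>s - s0\<bar> < d1 \<Longrightarrow> x s \<in> fst c \<and> snd c (x s) \<in> B \<and>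
       ((snd c \<circ> x) has_vector_derivative F (s, (snd c \<circ> x) s)) (at s within {0..t})"
      using solves_in_chart[OF x t01 s0(1) c B F] by metis
    obtain d2 \<rho> where d2: "d2 > 0" "\<rho> > 0"
      "\<And>s1 y1. \<bar>s1 - s0\<bar> < d2 \<Longrightarrow> norm (y1 - snd c (x s0)) < \<rho> \<Longrightarrow>
       \<exists>y. y s1 = y1 \<and> (\<forall>s. \<bar>s - s1\<bar> < d2 \<longrightarrow> (s, y s) \<in> ball s0 r \<times> B \<and>
         (y has_vector_derivative F (s, y s)) (at s))"
      using picard_lindelof[OF W(1) Ck W(2)] by metis
    have "\<bar>s0 - s0\<bar> < d2" "norm (snd c (x s0) - snd c (x s0)) < \<rho>" using d2 by auto
    from d2(3)[OF this] obtain y where y: "y s0 = snd c (x s0)"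
      "\<And>s. \<bar>s - s0\<bar> < d2 \<Longrightarrow> (s, y s) \<in> ball s0 r \<times> B \<and> (y has_vector_derivative F (s, y s)) (at s)"
      by blast
    have yC: "Ck_on k (ball s0 d2) y" for k
      by (rule ode_solution_regular[OF W(1) Ck open_ball]) (use y(2) in \<open>auto simp: dist_real_def\<close>)
    define d where "d = min d1 d2 / 2"
    define a' b' where "a' = max 0 (s0 - d)" and "b' = min t (s0 + d)"
    have d: "d > 0" "d < d1" "d < d2" using d1 d2 by (auto simp: d_def)
    have sub: "{a'..b'} \<subseteq> {0..t}" by (auto simp: a'_def b'_def)
    have near: "\<bar>s - s0\<bar> < d1" "\<bar>s - s0\<bar> < d2" "s \<in> {0..t}" if "s \<in> {a'..b'}" for s
      using that d sub by (auto simp: a'_def b'_def)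
    obtain \<delta> where \<delta>: "\<delta> > 0" "\<And>s. s \<in> {a'..b'} \<Longrightarrow> \<bar>s - s0\<bar> < \<delta> \<Longrightarrow> (snd c \<circ> x) s = y s"
    proof (rule ode_locally_unique[of "ball s0 r \<times> B" F s0 a' b' "snd c \<circ> x" y])
      fix s assume s: "s \<in> {a'..b'}"
      show "((snd c \<circ> x) has_vector_derivative F (s, (snd c \<circ> x) s)) (at s within {a'..b'})"
        using d1(2)[OF near(3)[OF s] near(1)[OF s]] has_vector_derivative_within_subset[OF _ sub] by blast
      show "(y has_vector_derivative F (s, y s)) (at s within {a'..b'})"
        using y(2)[OF near(2)[OF s]] has_vector_derivative_at_within by blast
    qed (use Ck W s0 d y in \<open>auto simp: a'_def b'_def simp del: Ck_on.simps\<close>)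
    define e where "e = min \<delta> d"
    have "y s = (snd c \<circ> x) s" if "s \<in> {0..t}" "s \<in> ball s0 e" for s
    proof -
      have "s \<in> {a'..b'}" "\<bar>s - s0\<bar> < \<delta>"
        using that by (auto simp: e_def a'_def b'_def dist_real_def)
      from \<delta>(2)[OF this] show ?thesis ..
    qed
    moreover have "Ck_on k (ball s0 e) y" for k
      by (rule Ck_on_subset[OF yC]) (use d in \<open>auto simp: e_def\<close>)
    ultimately show "\<exists>U g. open U \<and> s0 \<in> U \<and> (\<forall>k. Ck_on k U g) \<and>
        (\<forall>y\<in>{s \<in> {0..t}. x s \<in> fst c} \<inter> U. g y = (snd c \<circ> x) y)"
      using \<delta> d by (intro exI[of _ "ball s0 e"] exI[of _ y]) (auto simp: e_def)
  qed
qed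

text \<open>Regularity of solutions closes the gap between the two notions, so flows can be studied
  through \<open>solves\<close>.\<close>

lemma integral_curve_iff_solves:
  assumes "smooth_vf V" "t \<le> 1"
  shows "integral_curve M A V t x \<longleftrightarrow> solves V {0..t} x"
  using solves_smooth[OF assms(1) _ assms(2)]
  by (auto simp: integral_curve_def solves_def smooth_curve_def)

section \<open>Existence, gluing and completeness\<close>

lemma solves_chart_invI:
  assumes V: "smooth_vf V" and I: "I \<subseteq> {0..1}" and c: "c \<in> A"
    and y: "\<And>s. s \<in> I \<Longrightarrow> y s \<in> snd c ` fst c"
      "\<And>s. s \<in> I \<Longrightarrow> (y has_vector_derivative V s (chart_inv c (y s)) c) (at s within I)"
  shows "solves V I (\<lambda>s. chart_inv c (y s))"
proof -
  have "continuous_on I y" using continuous_on_vector_derivative[OF y(2)] .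
  then have "continuous_map (top_of_set I) (top_of_set (snd c ` fst c)) y"
    using y(1) by (auto simp: continuous_map_in_subtopology)
  from continuous_map_compose[OF this continuous_map_chart_inv[OF c]]
  have cont: "continuous_map (top_of_set I) M (\<lambda>s. chart_inv c (y s))" by (simp add: o_def)
  show ?thesis
    unfolding solves_def
  proof (intro conjI ballI cont)
    fix s d assume s: "s \<in> I" and d: "d \<in> charts_at A (chart_inv c (y s))"
    have cc: "c \<in> charts_at A (chart_inv c (y s))" using y(1)[OF s] c by (simp add: charts_at_iff)
    have "V s (chart_inv c (y s)) \<in> tangent_space A (chart_inv c (y s))"
      using V s I charts_at_topspace[OF cc] unfolding smooth_vf_def by blast
    moreover have "((snd c \<circ> (\<lambda>s. chart_inv c (y s))) has_vector_derivative V s (chart_inv c (y s)) c) (at s within I)"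
      by (rule has_vector_derivative_transform[OF s _ y(2)[OF s]]) (use y(1) in auto)
    ultimately show "((snd d \<circ> (\<lambda>s. chart_inv c (y s))) has_vector_derivative V s (chart_inv c (y s)) d) (at s within I)"
      using derivative_chart_change[OF cont s cc d] by blast
  qed
qed

lemma solves_local_existence:
  assumes V: "smooth_vf V" and s0: "s0 \<in> {0..1}" and p: "p \<in> topspace M"
  obtains \<delta> N where "\<delta> > 0" "openin M N" "p \<in> N"
    "\<And>s1 q. \<bar>s1 - s0\<bar> < \<delta> \<Longrightarrow> q \<in> N \<Longrightarrow> \<exists>x. x s1 = q \<and> solves V {max 0 (s1 - \<delta>)..min 1 (s1 + \<delta>)} x"
proof -
  obtain c where c: "c \<in> charts_at A p" using charts_at_nonempty[OF p] by blast
  then have cA: "c \<in> A" and pc: "p \<in> fst c" by (auto simp: charts_at_iff)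
  obtain r B F where B: "r > 0" "open B" "snd c p \<in> B" "B \<subseteq> snd c ` fst c"
    and Ck: "\<And>k. Ck_on k (ball s0 r \<times> B) F"
    and F: "\<forall>s y. s \<in> ball s0 r \<longrightarrow> s \<in> {0..1} \<longrightarrow> y \<in> B \<longrightarrow> F (s, y) = V s (chart_inv c y) c"
    using smooth_vf_local[OF V s0 c] by metis
  have W: "open (ball s0 r \<times> B)" "(s0, snd c p) \<in> ball s0 r \<times> B" using B by (auto intro: open_Times)
  obtain d \<rho> where d: "d > 0" "\<rho> > 0"
    "\<And>s1 y1. \<bar>s1 - s0\<bar> < d \<Longrightarrow> norm (y1 - snd c p) < \<rho> \<Longrightarrow>
     \<exists>y. y s1 = y1 \<and> (\<forall>s. \<bar>s - s1\<bar> < d \<longrightarrow> (s, y s) \<in> ball s0 r \<times> B \<and>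
       (y has_vector_derivative F (s, y s)) (at s))"
    using picard_lindelof[OF W(1) Ck W(2)] by metis
  show ?thesis
  \<comment> \<open>\<open>picard_lindelof\<close> covers an open range of times, while the solution
    is wanted on a closed interval; half of \<open>d\<close> fits inside.\<close>
  proof (rule that[of "d / 2" "{q \<in> fst c. snd c q \<in> ball (snd c p) \<rho>}"])
    show "openin M {q \<in> fst c. snd c q \<in> ball (snd c p) \<rho>}" by (rule openin_chart_vimage[OF cA open_ball])
    fix s1 q assume s1: "\<bar>s1 - s0\<bar> < d / 2" and q: "q \<in> {q \<in> fst c. snd c q \<in> ball (snd c p) \<rho>}"
    then have "\<bar>s1 - s0\<bar> < d" "norm (snd c q - snd c p) < \<rho>"
      using d by (auto simp: dist_norm norm_minus_commute)
    from d(3)[OF this] obtain y where y: "y s1 = snd c q"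
      "\<And>s. \<bar>s - s1\<bar> < d \<Longrightarrow> (s, y s) \<in> ball s0 r \<times> B \<and> (y has_vector_derivative F (s, y s)) (at s)"
      by blast
    let ?I = "{max 0 (s1 - d / 2)..min 1 (s1 + d / 2)}"
    have "solves V ?I (\<lambda>s. chart_inv c (y s))"
    proof (rule solves_chart_invI[OF V _ cA])
      fix s assume s: "s \<in> ?I"
      then have near: "\<bar>s - s1\<bar> < d" and s01: "s \<in> {0..1}" using d by auto
      show "y s \<in> snd c ` fst c" using y(2)[OF near] B(4) by auto
      have "F (s, y s) = V s (chart_inv c (y s)) c" using F[rule_format, of s "y s"] y(2)[OF near] s01 by auto
      then show "(y has_vector_derivative V s (chart_inv c (y s)) c) (at s within ?I)"
        using y(2)[OF near] has_vector_derivative_at_within by metis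
    qed auto
    moreover have "chart_inv c (y s1) = q" using y(1) q cA by simp
    ultimately show "\<exists>x. x s1 = q \<and> solves V ?I x" by (intro exI[of _ "\<lambda>s. chart_inv c (y s)"]) auto
  qed (use d pc in auto)
qed

text \<open>At the seam both one-sided derivatives are given by \<open>V b (x b)\<close>, because
  the field depends on time and position only. So plain concatenation is again a solution.\<close>

lemma solves_glue:
  assumes x: "solves V {a..b} x" and y: "solves V {b..c} y" and abc: "a \<le> b" "b \<le> c" and xy: "x b = y b"
  shows "solves V {a..c} (\<lambda>s. if s \<le> b then x s else y s)" (is "solves V _ ?z")
  unfolding solves_def
proof (intro conjI ballI)
  have zx: "?z s = x s" if "s \<in> {a..b}" for s using that by auto
  have zy: "?z s = y s" if "s \<in> {b..c}" for s using that xy by (cases "s = b") auto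
  show "continuous_map (top_of_set {a..c}) M ?z"
    unfolding continuous_map_top_of_set_iff
  proof (intro conjI ballI allI impI)
    show "?z ` {a..c} \<subseteq> topspace M" using solves_in[OF x] solves_in[OF y] by auto
    fix s U assume s: "s \<in> {a..c}" and U: "openin M U" "?z s \<in> U"
    have 1: "\<exists>d>0. \<forall>s'\<in>{a..b}. \<bar>s' - s\<bar> < d \<longrightarrow> ?z s' \<in> U"
    proof (cases "s \<in> {a..b}")
      case True
      with zx U(2) have "x s \<in> U" by simp
      from solves_near[OF x True U(1) this] zx show ?thesis by metis
    next
      case False
      then show ?thesis using s by (intro exI[of _ "s - b"]) auto
    qed
    have 2: "\<exists>d>0. \<forall>s'\<in>{b..c}. \<bar>s' - s\<bar> < d \<longrightarrow> ?z s' \<in> U"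
    proof (cases "s \<in> {b..c}")
      case True
      with zy U(2) have "y s \<in> U" by simp
      from solves_near[OF y True U(1) this] zy show ?thesis by metis
    next
      case False
      then show ?thesis using s by (intro exI[of _ "b - s"]) auto
    qed
    from 1 2 obtain d1 d2 where d: "d1 > 0" "\<And>s'. s' \<in> {a..b} \<Longrightarrow> \<bar>s' - s\<bar> < d1 \<Longrightarrow> ?z s' \<in> U"
      "d2 > 0" "\<And>s'. s' \<in> {b..c} \<Longrightarrow> \<bar>s' - s\<bar> < d2 \<Longrightarrow> ?z s' \<in> U" by metis
    have "?z s' \<in> U" if "s' \<in> {a..c}" "dist s' s < min d1 d2" for s'
      using d(2)[of s'] d(4)[of s'] that by (cases "s' \<le> b") (auto simp: dist_real_def)
    with d show "\<exists>\<delta>>0. \<forall>s'\<in>{a..c}. dist s' s < \<delta> \<longrightarrow> ?z s' \<in> U" by (intro exI[of _ "min d1 d2"]) auto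
  qed
  fix s e assume s: "s \<in> {a..c}" and e: "e \<in> charts_at A (?z s)"
  have cl: "closure {a..b} \<inter> closure {b..c} = {b}" using abc by auto
  have un: "{a..c} = {a..b} \<union> {b..c}" using abc by auto
  have ab: "{a..b} \<union> {b} = {a..b}" "{b..c} \<union> {b} = {b..c}" using abc by auto
  have "((\<lambda>s. if s \<in> {a..b} then (snd e \<circ> x) s else (snd e \<circ> y) s) has_vector_derivative
     (if s \<in> {a..b} then V s (x s) e else V s (y s) e)) (at s within {a..c})"
  proof (rule has_vector_derivative_If_within_closures[OF _ un], unfold cl ab)
    show "((snd e \<circ> x) has_vector_derivative V s (x s) e) (at s within {a..b})" if "s \<in> {a..b}"
      using solves_derivative[OF x that, of e] e zx[OF that] by simp
    show "((snd e \<circ> y) has_vector_derivative V s (y s) e) (at s within {b..c})" if "s \<in> {b..c}"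
      using solves_derivative[OF y that, of e] e zy[OF that] by simp
    have eqb: "s = b" if "s \<in> closure {a..b}" "s \<in> closure {b..c}" using that cl by blast
    show "(snd e \<circ> x) s = (snd e \<circ> y) s" if "s \<in> closure {a..b}" "s \<in> closure {b..c}"
      using eqb[OF that] xy by simp
    show "V s (x s) e = V s (y s) e" if "s \<in> closure {a..b}" "s \<in> closure {b..c}"
      using eqb[OF that] xy by simp
  qed (use s un in auto)
  then have "((\<lambda>s. if s \<in> {a..b} then (snd e \<circ> x) s else (snd e \<circ> y) s) has_vector_derivative
     V s (?z s) e) (at s within {a..c})" using s by (auto split: if_splits)
  then show "((snd e \<circ> ?z) has_vector_derivative V s (?z s) e) (at s within {a..c})"
    by (rule has_vector_derivative_transform[OF s, rotated]) (auto simp: o_def)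
qed

lemma solves_const:
  assumes "p \<in> topspace M" "\<And>s. s \<in> I \<Longrightarrow> V s p = (\<lambda>c. 0)"
  shows "solves V I (\<lambda>_. p)"
  using assms by (auto simp: solves_def o_def)

text \<open>The time \<open>\<epsilon>\<close> is the same for all starting points, so the curve can
  be restarted at both of its ends; every step gains \<open>\<epsilon>\<close> on either side, up to
  truncation at 0 and 1.\<close>

lemma solves_step_extension:
  assumes loc: "\<And>s1 q. s1 \<in> {0..1} \<Longrightarrow> q \<in> topspace M \<Longrightarrow>
      \<exists>x. x s1 = q \<and> solves V {max 0 (s1 - \<epsilon>)..min 1 (s1 + \<epsilon>)} x" and \<epsilon>: "\<epsilon> > 0"
    and s1: "s1 \<in> {0..1}" "q \<in> topspace M"
  shows "\<exists>x. x s1 = q \<and> solves V {max 0 (s1 - real n * \<epsilon>)..min 1 (s1 + real n * \<epsilon>)} x"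
proof (induction n)
  case 0
  obtain x where "x s1 = q" "solves V {max 0 (s1 - \<epsilon>)..min 1 (s1 + \<epsilon>)} x" using loc[OF s1] by blast
  moreover have "{max 0 (s1 - real 0 * \<epsilon>)..min 1 (s1 + real 0 * \<epsilon>)} \<subseteq> {max 0 (s1 - \<epsilon>)..min 1 (s1 + \<epsilon>)}"
    using \<epsilon> s1 by auto
  ultimately show ?case using solves_subset by blast
next
  case (Suc n)
  define a b where "a = max 0 (s1 - real n * \<epsilon>)" and "b = min 1 (s1 + real n * \<epsilon>)"
  define a' b' where "a' = max 0 (a - \<epsilon>)" and "b' = min 1 (b + \<epsilon>)"
  have n0: "real n * \<epsilon> \<ge> 0" using \<epsilon> by simp
  have ab: "a \<in> {0..1}" "b \<in> {0..1}" "a \<le> s1" "s1 \<le> b" "a' \<le> a" "b \<le> b'" "a \<le> b"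
    using n0 s1 \<epsilon> unfolding a_def b_def a'_def b'_def atLeastAtMost_iff by linarith+
  from Suc.IH obtain x where x: "x s1 = q" "solves V {a..b} x" by (auto simp: a_def b_def)
  have "x a \<in> topspace M" "x b \<in> topspace M" using solves_in[OF x(2)] ab by auto
  then obtain y z where y: "y b = x b" "solves V {max 0 (b - \<epsilon>)..min 1 (b + \<epsilon>)} y"
    and z: "z a = x a" "solves V {max 0 (a - \<epsilon>)..min 1 (a + \<epsilon>)} z" using loc ab by meson
  have y': "solves V {b..b'} y" by (rule solves_subset[OF y(2)]) (use ab \<epsilon> in \<open>auto simp: b'_def\<close>)
  have z': "solves V {a'..a} z" by (rule solves_subset[OF z(2)]) (use ab \<epsilon> in \<open>auto simp: a'_def\<close>)
  let ?w = "\<lambda>s. if s \<le> b then x s else y s"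
  have w: "solves V {a..b'} ?w" by (rule solves_glue[OF x(2) y']) (use ab y in auto)
  have "solves V {a'..b'} (\<lambda>s. if s \<le> a then z s else ?w s)"
    by (rule solves_glue[OF z' w]) (use ab z in auto)
  moreover have "a' = max 0 (s1 - real (Suc n) * \<epsilon>)" "b' = min 1 (s1 + real (Suc n) * \<epsilon>)"
    using \<epsilon> by (auto simp: a'_def b'_def a_def b_def algebra_simps)
  moreover have "(if s1 \<le> a then z s1 else ?w s1) = q" using x(1) z(1) ab by auto
  ultimately show ?case by (intro exI[of _ "\<lambda>s. if s \<le> a then z s else ?w s"]) auto
qed

text \<open>A uniform existence time on a compact set containing the support, together with constant
  curves elsewhere, makes the flow complete.\<close>

lemma solves_global_existence:
  assumes V: "smooth_vf V" and K: "compactin M K"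
    and V0: "\<And>s p. s \<in> {0..1} \<Longrightarrow> p \<in> topspace M \<Longrightarrow> p \<notin> K \<Longrightarrow> V s p = (\<lambda>c. 0)"
    and t: "t \<in> {0..1}" and q: "q \<in> topspace M"
  obtains x where "solves V {0..1} x" "x t = q"
proof -
  let ?P = "prod_topology euclideanreal M"
  define Q where "Q u \<delta> \<longleftrightarrow> \<delta> > 0 \<and> (\<forall>s1 q. (s1, q) \<in> u \<longrightarrow>
      (\<exists>x. x s1 = q \<and> solves V {max 0 (s1 - \<delta>)..min 1 (s1 + \<delta>)} x))" for u :: "(real \<times> 'a) set" and \<delta>
  define \<U> where "\<U> = {u. openin ?P u \<and> (\<exists>\<delta>. Q u \<delta>)}"
  have KM: "K \<subseteq> topspace M" using compactin_subset_topspace[OF K] .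
  have cover: "{0..1} \<times> K \<subseteq> \<Union>\<U>"
  proof
    fix z assume "z \<in> {0..1::real} \<times> K"
    then obtain s0 p where z: "z = (s0, p)" "s0 \<in> {0..1}" "p \<in> topspace M" "p \<in> K" using KM by auto
    obtain \<delta> N where N: "\<delta> > 0" "openin M N" "p \<in> N"
      "\<And>s1 q. \<bar>s1 - s0\<bar> < \<delta> \<Longrightarrow> q \<in> N \<Longrightarrow> \<exists>x. x s1 = q \<and> solves V {max 0 (s1 - \<delta>)..min 1 (s1 + \<delta>)} x"
      using solves_local_existence[OF V z(2,3)] by metis
    have "openin ?P (ball s0 \<delta> \<times> N)" using N by (simp add: openin_prod_Times_iff)
    moreover have "Q (ball s0 \<delta> \<times> N) \<delta>" using N by (auto simp: Q_def dist_real_def abs_minus_commute)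
    ultimately have "ball s0 \<delta> \<times> N \<in> \<U>" by (auto simp: \<U>_def)
    moreover have "z \<in> ball s0 \<delta> \<times> N" using z N by simp
    ultimately show "z \<in> \<Union>\<U>" by (rule UnionI)
  qed
  have "compactin ?P ({0..1} \<times> K)" using K by (simp add: compactin_Times)
  then obtain \<F> where \<F>: "finite \<F>" "\<F> \<subseteq> \<U>" "{0..1} \<times> K \<subseteq> \<Union>\<F>"
    using cover unfolding compactin_def by (metis (no_types, lifting) \<U>_def mem_Collect_eq)
  then have "\<forall>u\<in>\<F>. \<exists>\<delta>. Q u \<delta>" by (auto simp: \<U>_def)
  from bchoice[OF this] obtain \<delta> where "\<forall>u\<in>\<F>. Q u (\<delta> u)" ..
  then have \<delta>: "Q u (\<delta> u)" if "u \<in> \<F>" for u using that by blast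
  \<comment> \<open>The element 1 keeps the minimum defined when the subcover is empty, which can
    happen for \<open>K = {}\<close>.\<close>
  define \<epsilon> where "\<epsilon> = Min (insert 1 (\<delta> ` \<F>))"
  have \<epsilon>: "\<epsilon> > 0" using \<F>(1) \<delta> by (auto simp: \<epsilon>_def Q_def)
  have loc: "\<exists>x. x s1 = q \<and> solves V {max 0 (s1 - \<epsilon>)..min 1 (s1 + \<epsilon>)} x"
    if s1: "s1 \<in> {0..1}" and q: "q \<in> topspace M" for s1 q
  proof (cases "q \<in> K")
    case True
    then obtain u where u: "u \<in> \<F>" "(s1, q) \<in> u" using \<F>(3) s1 by blast
    then obtain x where x: "x s1 = q" "solves V {max 0 (s1 - \<delta> u)..min 1 (s1 + \<delta> u)} x"
      using \<delta>[OF u(1)] unfolding Q_def by blast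
    have "\<epsilon> \<le> \<delta> u" using \<F>(1) u by (auto simp: \<epsilon>_def)
    then have "solves V {max 0 (s1 - \<epsilon>)..min 1 (s1 + \<epsilon>)} x"
      by (intro solves_subset[OF x(2)]) auto
    with x(1) show ?thesis by blast
  next
    case False
    have "solves V {max 0 (s1 - \<epsilon>)..min 1 (s1 + \<epsilon>)} (\<lambda>_. q)"
      by (rule solves_const[OF q]) (use V0[OF _ q False] in auto)
    then show ?thesis by (intro exI[of _ "\<lambda>_. q"]) auto
  qed
  obtain n :: nat where n: "1 < real n * \<epsilon>" using reals_Archimedean3[OF \<epsilon>] by blast
  obtain x where x: "x t = q" "solves V {max 0 (t - real n * \<epsilon>)..min 1 (t + real n * \<epsilon>)} x"
    using solves_step_extension[OF loc \<epsilon> t q, of n] by metis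
  have "max 0 (t - real n * \<epsilon>) = 0" "min 1 (t + real n * \<epsilon>) = 1" using n t by auto
  with x show ?thesis by (intro that[of x]) auto
qed

text \<open>The constant curve through \<open>x t\<close> is a solution too, and uniqueness applies
  in both time directions.\<close>

lemma solves_const_outside:
  assumes V: "smooth_vf V" and V0: "\<And>s. s \<in> {0..1} \<Longrightarrow> V s (x t) = (\<lambda>c. 0)"
    and x: "solves V {0..1} x" and t: "t \<in> {0..1}" and s: "s \<in> {0..1}"
  shows "x s = x t"
  using solves_unique[OF V x solves_const[where V=V, OF solves_in[OF x t] V0] order_refl t _ s] by simp

end

section \<open>Flows preserving a closed subset\<close>

context smooth_manifold
begin

lemma flow_eq:
  assumes V: "smooth_vf V" and x: "solves V {0..1} x" and t: "t \<in> {0..1}"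
  shows "flow M A V t (x 0) = x t"
proof -
  have t1: "t \<le> 1" and sub: "{0..t} \<subseteq> {0..1}" using t by auto
  note iff = integral_curve_iff_solves[OF V t1]
  show ?thesis
    unfolding flow_def
  proof (rule the_equality)
    show "\<exists>y. integral_curve M A V t y \<and> y 0 = x 0 \<and> y t = x t"
      using solves_subset[OF x sub] iff by blast
    fix y assume "\<exists>z. integral_curve M A V t z \<and> z 0 = x 0 \<and> z t = y"
    then obtain z where z: "solves V {0..t} z" "z 0 = x 0" "z t = y" using iff by blast
    have "z t = x t"
      by (rule solves_unique[OF V z(1) solves_subset[OF x sub] sub _ z(2)]) (use t in auto)
    then show "y = x t" using z by simp
  qed
qed

text \<open>Flows are traded for families \<open>\<gamma>\<close> of curves indexed by the initial
  point. Together with \<open>compatibleE\<close> this keeps the \<open>THE\<close> in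
  \<open>flow\<close> out of most later arguments.\<close>

lemma compatibleI:
  assumes V: "smooth_vf V" and \<gamma>: "\<And>x. x \<in> X \<Longrightarrow> solves V {0..1} (\<gamma> x)" "\<And>x. x \<in> X \<Longrightarrow> \<gamma> x 0 = x"
    and im: "\<And>t. t \<in> {0..1} \<Longrightarrow> (\<lambda>x. \<gamma> x t) ` X = X"
  shows "compatible M A V X" "\<And>x t. x \<in> X \<Longrightarrow> t \<in> {0..1} \<Longrightarrow> flow M A V t x = \<gamma> x t"
proof -
  show fl: "flow M A V t x = \<gamma> x t" if "x \<in> X" "t \<in> {0..1}" for x t
    using flow_eq[OF V \<gamma>(1)[OF that(1)] that(2)] \<gamma>(2)[OF that(1)] by simp
  have "X \<subseteq> flow_domain M A V 1"
    using \<gamma> integral_curve_iff_solves[OF V order_refl] unfolding flow_domain_def by blast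
  moreover have "flow M A V t ` X = X" if "t \<in> {0..1}" for t
    using im[OF that] fl[OF _ that] by (metis (no_types, lifting) image_cong)
  ultimately show "compatible M A V X" by (simp add: compatible_def)
qed

lemma compatibleE:
  assumes V: "smooth_vf V" and X: "compatible M A V X"
  obtains \<gamma> where "\<And>x. x \<in> X \<Longrightarrow> solves V {0..1} (\<gamma> x)" "\<And>x. x \<in> X \<Longrightarrow> \<gamma> x 0 = x"
    "\<And>t. t \<in> {0..1} \<Longrightarrow> (\<lambda>x. \<gamma> x t) ` X = X"
    "\<And>x t. x \<in> X \<Longrightarrow> t \<in> {0..1} \<Longrightarrow> flow M A V t x = \<gamma> x t"
proof -
  have "\<forall>x\<in>X. \<exists>y. solves V {0..1} y \<and> y 0 = x"
    using X integral_curve_iff_solves[OF V order_refl] unfolding compatible_def flow_domain_def by blast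
  from bchoice[OF this] obtain \<gamma> where "\<forall>x\<in>X. solves V {0..1} (\<gamma> x) \<and> \<gamma> x 0 = x" ..
  then have \<gamma>: "solves V {0..1} (\<gamma> x)" "\<gamma> x 0 = x" if "x \<in> X" for x using that by blast+
  have fl: "flow M A V t x = \<gamma> x t" if "x \<in> X" "t \<in> {0..1}" for x t
    using flow_eq[OF V \<gamma>(1)[OF that(1)] that(2)] \<gamma>(2)[OF that(1)] by simp
  have "(\<lambda>x. \<gamma> x t) ` X = X" if "t \<in> {0..1}" for t
  proof -
    have "flow M A V t ` X = X" using X that by (simp add: compatible_def)
    moreover have "flow M A V t ` X = (\<lambda>x. \<gamma> x t) ` X" using fl[OF _ that] by (intro image_cong) auto
    ultimately show ?thesis by simp
  qed
  with \<gamma> fl show ?thesis by (intro that[of \<gamma>])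
qed

text \<open>The chain rule in each chart. The sign of \<open>\<rho>'\<close> is free, so reversed
  time and pauses are both covered.\<close>

lemma solves_reparam:
  assumes x: "solves V {0..1} x"
    and \<rho>: "\<And>s. s \<in> I \<Longrightarrow> (\<rho> has_real_derivative \<rho>' s) (at s)" "\<And>s. s \<in> I \<Longrightarrow> \<rho> s \<in> {0..1}"
    and W: "\<And>s p. s \<in> I \<Longrightarrow> p \<in> topspace M \<Longrightarrow> W s p = (\<lambda>c. \<rho>' s *\<^sub>R V (\<rho> s) p c)"
  shows "solves W I (\<lambda>s. x (\<rho> s))"
  unfolding solves_def
proof (intro conjI ballI)
  have sub: "\<rho> ` I \<subseteq> {0..1}" using \<rho>(2) by blast
  have "continuous_on I \<rho>"
    using \<rho>(1) DERIV_isCont continuous_at_imp_continuous_on by blast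
  then have "continuous_map (top_of_set I) (top_of_set {0..1}) \<rho>"
    using sub by (auto simp: continuous_map_in_subtopology)
  from continuous_map_compose[OF this solves_continuous[OF x]]
  show "continuous_map (top_of_set I) M (\<lambda>s. x (\<rho> s))" by (simp add: o_def)
  fix s c assume s: "s \<in> I" and c: "c \<in> charts_at A (x (\<rho> s))"
  have 1: "(\<rho> has_vector_derivative \<rho>' s) (at s within I)"
    using \<rho>(1)[OF s] by (simp add: has_real_derivative_iff_has_vector_derivative has_vector_derivative_at_within)
  have 2: "((snd c \<circ> x) has_vector_derivative V (\<rho> s) (x (\<rho> s)) c) (at (\<rho> s) within \<rho> ` I)"
    using has_vector_derivative_within_subset[OF solves_derivative[OF x \<rho>(2)[OF s] c] sub] .
  from vector_diff_chain_within[OF 1 2]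
  have "((snd c \<circ> x) \<circ> \<rho> has_vector_derivative \<rho>' s *\<^sub>R V (\<rho> s) (x (\<rho> s)) c) (at s within I)" .
  then show "((snd c \<circ> (\<lambda>s. x (\<rho> s))) has_vector_derivative W s (x (\<rho> s)) c) (at s within I)"
    using W[OF s solves_in[OF x \<rho>(2)[OF s]]] by (simp add: o_def)
qed

section \<open>Reparametrised Hamiltonians\<close>

lemma smooth_time_fun_reparam:
  assumes "smooth_time_fun A H" "\<And>k. Ck_on k UNIV \<rho>" "\<And>k. Ck_on k UNIV \<rho>'" "\<rho> ` {0..1} \<subseteq> {0..1}"
  shows "smooth_time_fun A (\<lambda>t p. \<rho>' t * H (\<rho> t) p)"
  unfolding smooth_time_fun_def
proof
  fix c assume c: "c \<in> A"
  let ?S = "{0..1} \<times> snd c ` fst c"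
  have fst: "smooth_on ?S fst" and snd: "smooth_on ?S snd"
    by (intro smooth_on_bounded_linear bounded_linear_fst bounded_linear_snd)+
  have "smooth_on ?S (\<lambda>z. (\<rho> (fst z), snd z))"
    using smooth_on_compose[OF Ck_on_UNIV_imp_smooth_on[of \<rho>, OF assms(2), of UNIV] fst] snd
    by (intro smooth_on_Pair) auto
  moreover have "(\<lambda>z. (\<rho> (fst z), snd z)) ` ?S \<subseteq> ?S" using assms(4) by auto
  ultimately have "smooth_on ?S (\<lambda>z. (\<lambda>(t, y). H t (chart_inv c y)) (\<rho> (fst z), snd z))"
    using assms(1) c smooth_on_compose unfolding smooth_time_fun_def by blast
  then have "smooth_on ?S (\<lambda>z. \<rho>' (fst z) * H (\<rho> (fst z)) (chart_inv c (snd z)))"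
    using smooth_on_compose[OF Ck_on_UNIV_imp_smooth_on[of \<rho>', OF assms(3), of UNIV] fst]
    by (intro smooth_on_mult) auto
  then show "smooth_on ?S (\<lambda>(t, y). \<rho>' t * H (\<rho> t) (chart_inv c y))" by (simp add: case_prod_unfold)
qed

lemma smooth_time_fun_add:
  assumes "smooth_time_fun A H" "smooth_time_fun A K"
  shows "smooth_time_fun A (\<lambda>t p. H t p + K t p)"
  using assms smooth_on_add unfolding smooth_time_fun_def case_prod_unfold by blast

lemma smooth_time_fun_const: "smooth_time_fun A (\<lambda>t p. a)"
  unfolding smooth_time_fun_def case_prod_unfold by (simp add: smooth_on_const)

lemma smooth_time_fun_continuous:
  assumes "smooth_time_fun A H" "p \<in> topspace M"
  shows "continuous_on {0..1} (\<lambda>t. H t p)"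
proof -
  obtain c where c: "c \<in> A" "p \<in> fst c" using charts_at_nonempty[OF assms(2)] unfolding charts_at_iff by blast
  have "continuous_on ({0..1} \<times> snd c ` fst c) (\<lambda>(t, y). H t (chart_inv c y))"
    by (rule smooth_on_imp_continuous_on[OF assms(1)[unfolded smooth_time_fun_def, rule_format, OF c(1)]])
  moreover have "continuous_on {0..1} (\<lambda>t::real. (t, snd c p))" by (intro continuous_intros)
  moreover have "(\<lambda>t. (t, snd c p)) ` {0..1} \<subseteq> {0..1} \<times> snd c ` fst c" using c(2) by blast
  ultimately have "continuous_on {0..1} (\<lambda>t. (\<lambda>(t, y). H t (chart_inv c y)) (t, snd c p))"
    by (rule continuous_on_compose2)
  then show ?thesis using c by simp
qed

lemma mdiff_const: "mdiff (\<lambda>_. a) p"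
  by (simp add: mdiff_def o_def)

end

section \<open>Hamiltonian fields under rescaling, reversal and concatenation\<close>

context symplectic_manifold
begin

text \<open>The field at \<open>p\<close> sees only the differential there, hence only the germ of
  the Hamiltonian up to constants. The cases in use are \<open>k = 0\<close> for reparametrisation,
  \<open>a = 0\<close> for locally constant Hamiltonians, and \<open>a = 1\<close> for the
  normalised Hamiltonian where the cutoff is 1.\<close>

lemma ham_vf_affine:
  assumes U: "openin M U" "p \<in> U" and H: "mdiff (H s) p" and K: "\<And>q. q \<in> U \<Longrightarrow> K t q = a * H s q + k"
  shows "ham_vf A \<omega> K t p = (\<lambda>c. a *\<^sub>R ham_vf A \<omega> H s p c)"
proof -
  have pM: "p \<in> topspace M" using U openin_subset by blast
  have D: "((K t \<circ> chart_inv c) has_derivative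
      (\<lambda>w. a * frechet_derivative (H s \<circ> chart_inv c) (at (snd c p)) w)) (at (snd c p))"
    if c: "c \<in> charts_at A p" for c
  proof -
    have cA: "c \<in> A" "p \<in> fst c" using c by (auto simp: charts_at_iff)
    have "(H s \<circ> chart_inv c has_derivative frechet_derivative (H s \<circ> chart_inv c) (at (snd c p))) (at (snd c p))"
      using H c by (intro has_derivative_frechet) (auto simp: mdiff_def)
    then have "((\<lambda>y. a * (H s \<circ> chart_inv c) y + k) has_derivative
      (\<lambda>w. a * frechet_derivative (H s \<circ> chart_inv c) (at (snd c p)) w)) (at (snd c p))"
      by (rule has_derivative_eq_rhs[OF has_derivative_add[OF has_derivative_mult_right has_derivative_const]]) simp
    then show ?thesis
    proof (rule has_derivative_transform_within_open)
      show "open (snd c ` (U \<inter> fst c))"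
        using U(1) chart_domain[OF cA(1)] by (intro open_chart_image[OF cA(1)]) auto
      show "snd c p \<in> snd c ` (U \<inter> fst c)" using U(2) cA by blast
      show "a * (H s \<circ> chart_inv c) y + k = (K t \<circ> chart_inv c) y" if "y \<in> snd c ` (U \<inter> fst c)" for y
        using that K cA by auto
    qed
  qed
  have mK: "mdiff (K t) p" using D by (auto simp: mdiff_def differentiable_def)
  obtain c where c: "c \<in> charts_at A p" using charts_at_nonempty[OF pM] by blast
  let ?v = "ham_vf A \<omega> H s p"
  have v: "?v \<in> tangent_space A p" using ham_vf_props(1)[where H=H and t=s, OF pM H] .
  show ?thesis
  proof (rule ham_vf_unique[where H=K and t=t, OF pM mK tangent_scale[OF v]])
    fix w assume w: "w \<in> tangent_space A p"
    have "\<omega> p (\<lambda>c. a *\<^sub>R ?v c) w = a * \<omega> p ?v w"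
      using form_linear[OF pM v v w, of a 0] by simp
    also have "\<dots> = a * differential A (H s) p w" using ham_vf_props(2)[where H=H and t=s, OF pM H w] by simp
    also have "\<dots> = differential A (K t) p w"
      unfolding differential_eq[OF c H w] differential_eq[OF c mK w]
      using frechet_derivative_at[OF D[OF c]] by metis
    finally show "\<omega> p (\<lambda>c. a *\<^sub>R ?v c) w = differential A (K t) p w" .
  qed
qed

lemma ham_vf_zero:
  assumes "openin M U" "p \<in> U" "\<And>q. q \<in> U \<Longrightarrow> K t q = k"
  shows "ham_vf A \<omega> K t p = (\<lambda>c. 0)"
  using ham_vf_affine[OF assms(1,2), of "\<lambda>_ _. 0" t K t 0 k] mdiff_const assms(3) by simp

lemma Ham_funI:
  assumes "smooth_time_fun A H" "\<And>x. x \<in> X \<Longrightarrow> solves (ham_vf A \<omega> H) {0..1} (\<gamma> x)"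
    "\<And>x. x \<in> X \<Longrightarrow> \<gamma> x 0 = x" "\<And>t. t \<in> {0..1} \<Longrightarrow> (\<lambda>x. \<gamma> x t) ` X = X"
  shows "H \<in> Ham_fun M A \<omega> X" "\<And>x t. x \<in> X \<Longrightarrow> t \<in> {0..1} \<Longrightarrow> ham_flow M A \<omega> H t x = \<gamma> x t"
  using compatibleI[OF ham_vf_smooth[OF assms(1)] assms(2-4)] assms(1)
  by (auto simp: Ham_fun_def ham_flow_def)

lemma Ham_funE:
  assumes "H \<in> Ham_fun M A \<omega> X"
  obtains \<gamma> where "\<And>x. x \<in> X \<Longrightarrow> solves (ham_vf A \<omega> H) {0..1} (\<gamma> x)" "\<And>x. x \<in> X \<Longrightarrow> \<gamma> x 0 = x"
    "\<And>t. t \<in> {0..1} \<Longrightarrow> (\<lambda>x. \<gamma> x t) ` X = X"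
    "\<And>x t. x \<in> X \<Longrightarrow> t \<in> {0..1} \<Longrightarrow> ham_flow M A \<omega> H t x = \<gamma> x t"
proof -
  have "smooth_vf (ham_vf A \<omega> H)" "compatible M A (ham_vf A \<omega> H) X"
    using assms ham_vf_smooth by (auto simp: Ham_fun_def)
  then show ?thesis
  proof (rule compatibleE)
    fix \<gamma> assume "\<And>x. x \<in> X \<Longrightarrow> solves (ham_vf A \<omega> H) {0..1} (\<gamma> x)" "\<And>x. x \<in> X \<Longrightarrow> \<gamma> x 0 = x"
      "\<And>t. t \<in> {0..1} \<Longrightarrow> (\<lambda>x. \<gamma> x t) ` X = X"
      "\<And>x t. x \<in> X \<Longrightarrow> t \<in> {0..1} \<Longrightarrow> flow M A (ham_vf A \<omega> H) t x = \<gamma> x t"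
    then show thesis by (intro that[of \<gamma>]) (simp_all add: ham_flow_def)
  qed
qed

lemma Ham_fun_smooth: "H \<in> Ham_fun M A \<omega> X \<Longrightarrow> smooth_time_fun A H"
  by (simp add: Ham_fun_def)

lemma Ham_flow_image: "H \<in> Ham_fun M A \<omega> X \<Longrightarrow> ham_flow M A \<omega> H 1 ` X = X"
  by (simp add: Ham_fun_def compatible_def ham_flow_def)

lemma ham_vf_reparam:
  assumes H: "smooth_time_fun A H" and r: "r \<in> {0..1}" and p: "p \<in> topspace M" and K: "K s = (\<lambda>q. a * H r q)"
  shows "ham_vf A \<omega> K s p = (\<lambda>c. a *\<^sub>R ham_vf A \<omega> H r p c)"
  by (rule ham_vf_affine[where k=0 and U="topspace M" and H=H and s=r, OF _ p smooth_time_fun_mdiff[where H=H and t=r, OF H r]])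
     (auto simp: K)

text \<open>The reversed curve from \<open>y\<close> runs back along the curve that ends at
  \<open>y\<close>. Such a curve exists because the time-one map is onto \<open>X\<close>, and its
  starting point \<open>bk y\<close> is unique because solutions that meet at time 1
  coincide.\<close>

lemma Ham_fun_reverse:
  assumes H: "H \<in> Ham_fun M A \<omega> X"
  shows "(\<lambda>t p. - H (1 - t) p) \<in> Ham_fun M A \<omega> X" (is "?K \<in> _")
    and "\<And>x. x \<in> X \<Longrightarrow> ham_flow M A \<omega> (\<lambda>t p. - H (1 - t) p) 1 (ham_flow M A \<omega> H 1 x) = x"
proof -
  note sH = Ham_fun_smooth[OF H]
  obtain \<gamma> where \<gamma>: "\<And>x. x \<in> X \<Longrightarrow> solves (ham_vf A \<omega> H) {0..1} (\<gamma> x)" "\<And>x. x \<in> X \<Longrightarrow> \<gamma> x 0 = x"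
    "\<And>t. t \<in> {0..1} \<Longrightarrow> (\<lambda>x. \<gamma> x t) ` X = X"
    "\<And>x t. x \<in> X \<Longrightarrow> t \<in> {0..1} \<Longrightarrow> ham_flow M A \<omega> H t x = \<gamma> x t"
    using Ham_funE[OF H] by metis
  have inj: "inj_on (\<lambda>x. \<gamma> x 1) X"
  proof (rule inj_onI)
    fix x y assume xy: "x \<in> X" "y \<in> X" "\<gamma> x 1 = \<gamma> y 1"
    have "\<gamma> x 0 = \<gamma> y 0"
      by (rule solves_unique[OF ham_vf_smooth[OF sH] \<gamma>(1)[OF xy(1)] \<gamma>(1)[OF xy(2)] order_refl _ xy(3)]) auto
    then show "x = y" using \<gamma>(2) xy by simp
  qed
  define bk where "bk = inv_into X (\<lambda>x. \<gamma> x 1)"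
  have im1: "(\<lambda>x. \<gamma> x 1) ` X = X" using \<gamma>(3)[of 1] by simp
  have bk: "bk y \<in> X" "\<gamma> (bk y) 1 = y" if "y \<in> X" for y
    using that im1 inv_into_into[of y "\<lambda>x. \<gamma> x 1" X] f_inv_into_f[of y "\<lambda>x. \<gamma> x 1" X]
    unfolding bk_def by auto
  have bk_eq: "bk (\<gamma> x 1) = x" if "x \<in> X" for x
    unfolding bk_def using inv_into_f_f[OF inj that] .
  have bk_image: "bk ` X = X" proof
    show "bk ` X \<subseteq> X" using bk by blast
    show "X \<subseteq> bk ` X"
    proof
      fix x assume x: "x \<in> X"
      then have "\<gamma> x 1 \<in> X" using im1 by blast
      then show "x \<in> bk ` X" using bk_eq[OF x] image_eqI[of x bk "\<gamma> x 1" X] by simp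
    qed
  qed
  have "smooth_time_fun A (\<lambda>t p. -1 * H (1 - t) p)"
    by (rule smooth_time_fun_reparam[OF sH])
      (auto intro!: Ck_on_diff Ck_on_const Ck_on_id)
  then have sK: "smooth_time_fun A ?K" by simp
  have sol: "solves (ham_vf A \<omega> ?K) {0..1} (\<lambda>t. \<gamma> (bk y) (1 - t))" if y: "y \<in> X" for y
  proof (rule solves_reparam[OF \<gamma>(1)[OF bk(1)[OF y]], where \<rho>="\<lambda>t. 1 - t" and \<rho>'="\<lambda>_. -1"])
    fix s p assume "s \<in> {0..1::real}" "p \<in> topspace M"
    then show "ham_vf A \<omega> ?K s p = (\<lambda>c. -1 *\<^sub>R ham_vf A \<omega> H (1 - s) p c)"
      by (intro ham_vf_reparam[OF sH]) auto
  qed (auto intro!: derivative_eq_intros)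
  have im: "(\<lambda>y. \<gamma> (bk y) (1 - t)) ` X = X" if "t \<in> {0..1}" for t
  proof -
    have "(\<lambda>y. \<gamma> (bk y) (1 - t)) ` X = (\<lambda>x. \<gamma> x (1 - t)) ` bk ` X" by (simp add: image_image)
    then show ?thesis using \<gamma>(3)[of "1 - t"] that bk_image by simp
  qed
  have at0: "\<gamma> (bk y) (1 - 0) = y" if "y \<in> X" for y using bk(2)[OF that] by simp
  show "?K \<in> Ham_fun M A \<omega> X" using Ham_funI(1)[OF sK sol at0 im] .
  show "ham_flow M A \<omega> ?K 1 (ham_flow M A \<omega> H 1 x) = x" if x: "x \<in> X" for x
  proof -
    have \<gamma>x: "\<gamma> x 1 \<in> X" using im1 x by blast
    have "ham_flow M A \<omega> ?K 1 (\<gamma> x 1) = \<gamma> (bk (\<gamma> x 1)) (1 - 1)"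
      using Ham_funI(2)[OF sK sol at0 im \<gamma>x, of 1] by simp
    then show ?thesis using \<gamma>(2,4)[OF x] bk_eq[OF x] by simp
  qed
qed

text \<open>The two Hamiltonians run one after the other, each slowed down to a stop at both ends, so that
  the concatenation is smooth in time.\<close>

lemma Ham_fun_concat:
  assumes H: "H \<in> Ham_fun M A \<omega> X" "H' \<in> Ham_fun M A \<omega> X"
    and \<rho>: "\<And>k. Ck_on k UNIV \<rho>" "\<And>k. Ck_on k UNIV \<rho>'"
      "\<And>x. (\<rho> has_real_derivative \<rho>' x) (at x)" "\<And>x. \<rho> x \<in> {0..1}"
      "\<And>x. x \<le> 0 \<Longrightarrow> \<rho> x = 0" "\<And>x. x \<ge> 1/3 \<Longrightarrow> \<rho> x = 1" "\<And>x. x \<ge> 1/3 \<Longrightarrow> \<rho>' x = 0"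
    and \<sigma>: "\<And>k. Ck_on k UNIV \<sigma>" "\<And>k. Ck_on k UNIV \<sigma>'"
      "\<And>x. (\<sigma> has_real_derivative \<sigma>' x) (at x)" "\<And>x. \<sigma> x \<in> {0..1}"
      "\<And>x. x \<le> 2/3 \<Longrightarrow> \<sigma> x = 0" "\<And>x. x \<ge> 1 \<Longrightarrow> \<sigma> x = 1" "\<And>x. x \<le> 2/3 \<Longrightarrow> \<sigma>' x = 0"
  defines "K \<equiv> (\<lambda>t p. \<rho>' t * H (\<rho> t) p + \<sigma>' t * H' (\<sigma> t) p)"
  shows "K \<in> Ham_fun M A \<omega> X"
    and "\<And>x. x \<in> X \<Longrightarrow> ham_flow M A \<omega> K 1 x = ham_flow M A \<omega> H' 1 (ham_flow M A \<omega> H 1 x)"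
proof -
  note sH = Ham_fun_smooth[OF H(1)] Ham_fun_smooth[OF H(2)]
  obtain \<gamma> where \<gamma>: "\<And>x. x \<in> X \<Longrightarrow> solves (ham_vf A \<omega> H) {0..1} (\<gamma> x)" "\<And>x. x \<in> X \<Longrightarrow> \<gamma> x 0 = x"
    "\<And>t. t \<in> {0..1} \<Longrightarrow> (\<lambda>x. \<gamma> x t) ` X = X"
    "\<And>x t. x \<in> X \<Longrightarrow> t \<in> {0..1} \<Longrightarrow> ham_flow M A \<omega> H t x = \<gamma> x t"
    using Ham_funE[OF H(1)] by metis
  obtain \<eta> where \<eta>: "\<And>x. x \<in> X \<Longrightarrow> solves (ham_vf A \<omega> H') {0..1} (\<eta> x)" "\<And>x. x \<in> X \<Longrightarrow> \<eta> x 0 = x"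
    "\<And>t. t \<in> {0..1} \<Longrightarrow> (\<lambda>x. \<eta> x t) ` X = X"
    "\<And>x t. x \<in> X \<Longrightarrow> t \<in> {0..1} \<Longrightarrow> ham_flow M A \<omega> H' t x = \<eta> x t"
    using Ham_funE[OF H(2)] by metis
  have im1: "(\<lambda>x. \<gamma> x 1) ` X = X" using \<gamma>(3)[of 1] by simp
  then have \<gamma>X: "\<gamma> x 1 \<in> X" if "x \<in> X" for x using that by blast
  have sK: "smooth_time_fun A K"
    unfolding K_def using \<rho>(4) \<sigma>(4)
    by (intro smooth_time_fun_add smooth_time_fun_reparam sH \<rho>(1,2) \<sigma>(1,2)) blast+
  \<comment> \<open>The time 1/2 lies in the pause between 1/3 and 2/3. On each half one of the two
    summands of \<open>K\<close> vanishes identically, so the field there is a reparametrised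
    one.\<close>
  define \<theta> where "\<theta> x t = (if t \<le> 1/2 then \<gamma> x (\<rho> t) else \<eta> (\<gamma> x 1) (\<sigma> t))" for x t
  have sol: "solves (ham_vf A \<omega> K) {0..1} (\<theta> x)" if x: "x \<in> X" for x
    unfolding \<theta>_def
  proof (rule solves_glue)
    show "solves (ham_vf A \<omega> K) {0..1/2} (\<lambda>t. \<gamma> x (\<rho> t))"
    proof (rule solves_reparam[OF \<gamma>(1)[OF x] \<rho>(3,4)])
      fix s p assume s: "s \<in> {0..1/2::real}" and p: "p \<in> topspace M"
      show "ham_vf A \<omega> K s p = (\<lambda>c. \<rho>' s *\<^sub>R ham_vf A \<omega> H (\<rho> s) p c)"
        by (rule ham_vf_reparam[OF sH(1) \<rho>(4) p]) (use s \<sigma>(7) in \<open>simp add: K_def\<close>)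
    qed
    show "solves (ham_vf A \<omega> K) {1/2..1} (\<lambda>t. \<eta> (\<gamma> x 1) (\<sigma> t))"
    proof (rule solves_reparam[OF \<eta>(1)[OF \<gamma>X[OF x]] \<sigma>(3,4)])
      fix s p assume s: "s \<in> {1/2::real..1}" and p: "p \<in> topspace M"
      show "ham_vf A \<omega> K s p = (\<lambda>c. \<sigma>' s *\<^sub>R ham_vf A \<omega> H' (\<sigma> s) p c)"
        by (rule ham_vf_reparam[OF sH(2) \<sigma>(4) p]) (use s \<rho>(7) in \<open>simp add: K_def\<close>)
    qed
    show "\<gamma> x (\<rho> (1/2)) = \<eta> (\<gamma> x 1) (\<sigma> (1/2))"
      using \<rho>(6) \<sigma>(5) \<eta>(2)[OF \<gamma>X[OF x]] by simp
  qed auto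
  have \<theta>0: "\<theta> x 0 = x" if "x \<in> X" for x using \<gamma>(2)[OF that] \<rho>(5) by (simp add: \<theta>_def)
  have im: "(\<lambda>x. \<theta> x t) ` X = X" for t
  proof (cases "t \<le> 1/2")
    case True
    then show ?thesis using \<gamma>(3)[OF \<rho>(4)] by (simp add: \<theta>_def)
  next
    case False
    have "(\<lambda>x. \<eta> (\<gamma> x 1) (\<sigma> t)) ` X = (\<lambda>y. \<eta> y (\<sigma> t)) ` (\<lambda>x. \<gamma> x 1) ` X" by (simp add: image_image)
    then show ?thesis using False \<eta>(3)[OF \<sigma>(4)] im1 by (simp add: \<theta>_def)
  qed
  show "K \<in> Ham_fun M A \<omega> X" using Ham_funI(1)[OF sK sol \<theta>0 im] .
  show "ham_flow M A \<omega> K 1 x = ham_flow M A \<omega> H' 1 (ham_flow M A \<omega> H 1 x)" if x: "x \<in> X" for x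
  proof -
    have "ham_flow M A \<omega> K 1 x = \<theta> x 1" using Ham_funI(2)[OF sK sol \<theta>0 im x] by simp
    also have "\<dots> = \<eta> (\<gamma> x 1) 1" using \<sigma>(6) by (simp add: \<theta>_def)
    finally show ?thesis using \<gamma>(4)[OF x] \<eta>(4)[OF \<gamma>X[OF x]] by simp
  qed
qed

lemma Ham_fun_zero:
  assumes "X \<subseteq> topspace M"
  shows "(\<lambda>t p. 0) \<in> Ham_fun M A \<omega> X" "\<And>x. x \<in> X \<Longrightarrow> ham_flow M A \<omega> (\<lambda>t p. 0) 1 x = x"
proof -
  have "solves (ham_vf A \<omega> (\<lambda>t p. 0)) {0..1} (\<lambda>_. x)" if "x \<in> X" for x
    using assms that by (intro solves_const ham_vf_zero[OF openin_topspace]) auto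
  note * = Ham_funI[where \<gamma>="\<lambda>x _. x", OF smooth_time_fun_const[of 0] this]
  show "(\<lambda>t p. 0) \<in> Ham_fun M A \<omega> X" by (rule *(1)) auto
  show "ham_flow M A \<omega> (\<lambda>t p. 0) 1 x = x" if "x \<in> X" for x
    by (rule *(2)[where t=1]) (use that in auto)
qed

end

section \<open>Oscillation\<close>

text \<open>A supremum of differences avoids subtracting infinite extrema. \<open>ennreal\<close>
  sends negative differences to 0, which is harmless as the swapped pair also occurs; for empty
  \<open>X\<close> the value is 0.\<close>

definition osc :: "'a set \<Rightarrow> ('a \<Rightarrow> real) \<Rightarrow> ennreal" where
  "osc X f = (SUP x\<in>X. SUP y\<in>X. ennreal (f x - f y))"

lemma osc_upper: "x \<in> X \<Longrightarrow> y \<in> X \<Longrightarrow> ennreal (f x - f y) \<le> osc X f"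
  unfolding osc_def by (meson SUP_upper2 order_refl)

lemma osc_least: "(\<And>x y. x \<in> X \<Longrightarrow> y \<in> X \<Longrightarrow> ennreal (f x - f y) \<le> r) \<Longrightarrow> osc X f \<le> r"
  unfolding osc_def by (meson SUP_least)

text \<open>If \<open>osc X f\<close> is a real \<open>r\<close>, all values lie within
  \<open>r\<close> of a single one, so both extrema are finite and can be subtracted as real
  numbers. If it is infinite, it is trivially an upper bound.\<close>

lemma osc_eq: "e2ennreal ((SUP x\<in>X. ereal (f x)) - (INF x\<in>X. ereal (f x))) = osc X f"
proof (cases "X = {}")
  case True
  then show ?thesis by (simp add: osc_def bot_ereal_def top_ereal_def e2ennreal_neg bot_ennreal)
next
  case False
  let ?S = "SUP x\<in>X. ereal (f x)" and ?I = "INF x\<in>X. ereal (f x)"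
  show ?thesis
  proof (rule antisym)
    show "osc X f \<le> e2ennreal (?S - ?I)"
    proof (rule osc_least)
      fix x y assume xy: "x \<in> X" "y \<in> X"
      have "ereal (f x) - ereal (f y) \<le> ?S - ?I"
        using xy by (intro ereal_minus_mono SUP_upper INF_lower)
      then have "e2ennreal (ereal (f x - f y)) \<le> e2ennreal (?S - ?I)" by (intro e2ennreal_mono) simp
      then show "ennreal (f x - f y) \<le> e2ennreal (?S - ?I)" by simp
    qed
    show "e2ennreal (?S - ?I) \<le> osc X f"
    proof (cases "osc X f")
      case (real r)
      have le: "f x - f y \<le> r" if "x \<in> X" "y \<in> X" for x y
        using osc_upper[OF that, of f] real by (simp add: ennreal_le_iff)
      have "?S - ereal r \<le> ?I"
      proof (rule INF_greatest)
        fix y assume y: "y \<in> X"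
        have "?S \<le> ereal (f y + r)" using le[OF _ y] by (intro SUP_least) (simp add: algebra_simps)
        then show "?S - ereal r \<le> ereal (f y)" by (simp add: ereal_minus_le)
      qed
      obtain x where x: "x \<in> X" using False by blast
      have S: "ereal (f x) \<le> ?S" "?S \<le> ereal (f x + r)" and I: "?I \<le> ereal (f x)" "ereal (f x - r) \<le> ?I"
        using le x by (auto intro!: SUP_upper SUP_least INF_lower INF_greatest simp: algebra_simps)
      then obtain s i where si: "?S = ereal s" "?I = ereal i"
        by (cases ?S; cases ?I) auto
      have "?S - ?I \<le> ereal r" using \<open>?S - ereal r \<le> ?I\<close> si by simp
      then have "e2ennreal (?S - ?I) \<le> e2ennreal (ereal r)" by (rule e2ennreal_mono)
      then show ?thesis using real by simp
    qed simp
  qed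
qed

lemma osc_norm_eq: "osc_norm X H = (\<integral>\<^sup>+t\<in>{0..1}. osc X (H t) \<partial>lborel)"
  unfolding osc_norm_def osc_eq ..

lemma osc_const: "osc X (\<lambda>_. k) = 0"
  unfolding osc_def by (simp add: SUP_constant bot_ennreal)

lemma osc_scale:
  assumes "a \<ge> 0"
  shows "osc X (\<lambda>p. a * f p) = osc X f * ennreal a"
proof -
  have "ennreal (a * f x - a * f y) = ennreal a * ennreal (f x - f y)" for x y
    using assms by (simp add: ennreal_mult'[symmetric] algebra_simps)
  then show ?thesis unfolding osc_def by (simp add: SUP_mult_left_ennreal mult.commute)
qed

lemma osc_add: "osc X (\<lambda>p. f p + g p) \<le> osc X f + osc X g"
proof (rule osc_least)
  fix x y assume xy: "x \<in> X" "y \<in> X"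
  have "ennreal (f x + g x - (f y + g y)) \<le> ennreal (f x - f y) + ennreal (g x - g y)"
    by (cases "f x - f y \<ge> 0"; cases "g x - g y \<ge> 0")
       (auto simp: ennreal_plus[symmetric] ennreal_neg simp del: ennreal_plus intro!: ennreal_leI)
  also have "\<dots> \<le> osc X f + osc X g" using xy by (intro add_mono osc_upper)
  finally show "ennreal (f x + g x - (f y + g y)) \<le> osc X f + osc X g" .
qed

lemma osc_uminus: "osc X (\<lambda>p. - f p) = osc X f"
proof -
  have "osc X (\<lambda>p. - f p) = (SUP x\<in>X. SUP y\<in>X. ennreal (f y - f x))"
    by (simp add: osc_def)
  also have "\<dots> = osc X f" unfolding osc_def by (rule SUP_commute)
  finally show ?thesis .
qed

text \<open>The supremum may be over an uncountable set: measurability comes from lower semicontinuity.\<close>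

lemma osc_measurable:
  assumes "\<And>x. x \<in> X \<Longrightarrow> continuous_on {0..1} (\<lambda>t. H t x)"
  shows "(\<lambda>t. osc X (H t) * indicator {0..1::real} t) \<in> borel_measurable borel"
proof (rule borel_measurableI_greater)
  fix y :: ennreal
  \<comment> \<open>Each superlevel set is the trace on \<open>{0..1}\<close> of an open subset of
    the line. Choosing these open sets keeps the arbitrary union open before it is intersected with
    the interval.\<close>
  have "\<forall>z\<in>X \<times> X. \<exists>T. open T \<and> T \<inter> {0..1} = {t \<in> {0..1}. y < ennreal (H t (fst z) - H t (snd z))}"
  proof
    fix z assume z: "z \<in> X \<times> X"
    have "continuous_on {0..1} (\<lambda>t. ennreal (H t (fst z) - H t (snd z)))"
      using assms z by (intro continuous_on_ennreal continuous_intros) (auto simp: mem_Times_iff)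
    from continuous_on_open_invariant[THEN iffD1, OF this, rule_format, OF open_greaterThan[of y]]
    have "\<exists>T. open T \<and> T \<inter> {0..1} = (\<lambda>t. ennreal (H t (fst z) - H t (snd z))) -` {y<..} \<inter> {0..1}" .
    moreover have "(\<lambda>t. ennreal (H t (fst z) - H t (snd z))) -` {y<..} \<inter> {0..1} =
      {t \<in> {0..1}. y < ennreal (H t (fst z) - H t (snd z))}" by auto
    ultimately show "\<exists>T. open T \<and> T \<inter> {0..1} = {t \<in> {0..1}. y < ennreal (H t (fst z) - H t (snd z))}"
      by (simp only:)
  qed
  from bchoice[OF this] obtain T' where
    T': "\<forall>z\<in>X \<times> X. open (T' z) \<and> T' z \<inter> {0..1} = {t \<in> {0..1}. y < ennreal (H t (fst z) - H t (snd z))}" ..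
  define T where "T x x' = T' (x, x')" for x x'
  have T: "open (T x x') \<and> T x x' \<inter> {0..1} = {t \<in> {0..1}. y < ennreal (H t x - H t x')}"
    if "x \<in> X" "x' \<in> X" for x x'
    using bspec[OF T', of "(x, x')"] that by (simp add: T_def)
  have "{t \<in> space borel. y < osc X (H t) * indicator {0..1} t} = (\<Union>x\<in>X. \<Union>x'\<in>X. T x x') \<inter> {0..1}"
  proof (intro equalityI subsetI)
    fix t assume "t \<in> {t \<in> space borel. y < osc X (H t) * indicator {0..1} t}"
    then have t: "t \<in> {0..1}" "y < osc X (H t)" by (cases "t \<in> {0..1}"; simp)+
    then obtain x x' where "x \<in> X" "x' \<in> X" "y < ennreal (H t x - H t x')"
      by (auto simp: osc_def less_SUP_iff)
    then show "t \<in> (\<Union>x\<in>X. \<Union>x'\<in>X. T x x') \<inter> {0..1}" using t T by blast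
  next
    fix t assume "t \<in> (\<Union>x\<in>X. \<Union>x'\<in>X. T x x') \<inter> {0..1}"
    then obtain x x' where x: "x \<in> X" "x' \<in> X" "t \<in> T x x' \<inter> {0..1}" by blast
    then have "t \<in> {0..1}" "y < ennreal (H t x - H t x')" using T[OF x(1,2)] by blast+
    then show "t \<in> {t \<in> space borel. y < osc X (H t) * indicator {0..1} t}"
      using osc_upper[OF x(1,2), of "H t"] by (auto simp: indicator_def)
  qed
  also have "\<dots> \<in> sets borel"
  proof -
    have "open (\<Union>x\<in>X. \<Union>x'\<in>X. T x x')" using T by blast
    then show ?thesis by (intro sets.Int borel_open borel_closed) auto
  qed
  finally show "{t \<in> space borel. y < osc X (H t) * indicator {0..1} t} \<in> sets borel" .
qed

lemma osc_norm_reverse: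
  assumes "\<And>x. x \<in> X \<Longrightarrow> continuous_on {0..1} (\<lambda>t. H t x)"
  shows "osc_norm X (\<lambda>t p. - H (1 - t) p) = osc_norm X H"
proof -
  let ?f = "\<lambda>t. osc X (H t) * indicator {0..1::real} t"
  have "?f (1 + -1 * t) = osc X (\<lambda>p. - H (1 - t) p) * indicator {0..1} t" for t
    by (auto simp: osc_uminus indicator_def)
  then show ?thesis
    using nn_integral_real_affine[OF osc_measurable[of X H, OF assms], where t=1 and c="-1"]
    by (simp add: osc_norm_eq)
qed

text \<open>Substitution along a nondecreasing \<open>\<rho>\<close>; during its pauses the weight
  \<open>\<rho>'\<close> is 0. Measurability is included because the integral of a sum will have to
  be split.\<close>

lemma osc_norm_reparam:
  assumes H: "\<And>x. x \<in> X \<Longrightarrow> continuous_on {0..1} (\<lambda>t. H t x)"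
    and \<rho>: "\<And>x. (\<rho> has_real_derivative \<rho>' x) (at x)" "continuous_on UNIV \<rho>'" "\<And>x. \<rho>' x \<ge> 0"
      "\<rho> 0 = 0" "\<rho> 1 = 1" "\<And>x. \<rho> x \<in> {0..1}"
  shows "(\<integral>\<^sup>+t. osc X (H (\<rho> t)) * ennreal (\<rho>' t) * indicator {0..1} t \<partial>lborel) = osc_norm X H"
    and "(\<lambda>t. osc X (H (\<rho> t)) * ennreal (\<rho>' t) * indicator {0..1} t) \<in> borel_measurable borel"
proof -
  let ?f = "\<lambda>t. osc X (H t) * indicator {0..1::real} t"
  have m: "?f \<in> borel_measurable borel" by (rule osc_measurable[OF H])
  have f\<rho>: "?f (\<rho> t) = osc X (H (\<rho> t))" for t using \<rho>(6)[of t] by simp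
  have "(\<integral>\<^sup>+t. ?f t * indicator {\<rho> 0..\<rho> 1} t \<partial>lborel) =
      (\<integral>\<^sup>+t. ?f (\<rho> t) * ennreal (\<rho>' t) * indicator {0..1} t \<partial>lborel)"
    by (rule nn_integral_substitution_aux[OF m _ \<rho>(1) continuous_on_subset[OF \<rho>(2)] \<rho>(3)]) auto
  moreover have "?f t * indicator {\<rho> 0..\<rho> 1} t = ?f t" for t using \<rho>(4,5) by (simp add: indicator_def)
  ultimately show "(\<integral>\<^sup>+t. osc X (H (\<rho> t)) * ennreal (\<rho>' t) * indicator {0..1} t \<partial>lborel) = osc_norm X H"
    unfolding f\<rho> osc_norm_eq by simp
  have "continuous_on UNIV \<rho>" using \<rho>(1) by (auto intro!: continuous_at_imp_continuous_on DERIV_isCont)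
  then have "\<rho> \<in> borel_measurable borel" by (rule borel_measurable_continuous_onI)
  from measurable_compose[OF this m] have "(\<lambda>t. osc X (H (\<rho> t))) \<in> borel_measurable borel" unfolding f\<rho> .
  moreover have "\<rho>' \<in> borel_measurable borel" using \<rho>(2) by (rule borel_measurable_continuous_onI)
  ultimately show "(\<lambda>t. osc X (H (\<rho> t)) * ennreal (\<rho>' t) * indicator {0..1} t) \<in> borel_measurable borel"
    by measurable
qed

section \<open>Cutoff functions\<close>

context smooth_manifold
begin

definition smooth_fun :: "('a \<Rightarrow> real) \<Rightarrow> bool" where
  "smooth_fun f \<longleftrightarrow> (\<forall>c\<in>A. smooth_on (snd c ` fst c) (\<lambda>y. f (chart_inv c y)))"

text \<open>A radial step in one chart, extended by 0. It stays smooth in every other chart because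
  the compact set \<open>K\<close>, off which it vanishes, is closed in the Hausdorff space
  \<open>M\<close>.\<close>

lemma bump_function:
  assumes U: "openin M U" "p \<in> U"
  obtains \<beta> N K where "openin M N" "p \<in> N" "compactin M K" "K \<subseteq> U" "smooth_fun \<beta>"
    "\<And>q. \<beta> q \<in> {0..1}" "\<And>q. q \<in> N \<Longrightarrow> \<beta> q = 1" "\<And>q. q \<notin> K \<Longrightarrow> \<beta> q = 0"
proof -
  have "p \<in> topspace M" using U openin_subset by blast
  then obtain c where c: "c \<in> A" "p \<in> fst c" using charts_at_nonempty unfolding charts_at_iff by blast
  let ?p = "snd c p"
  have op: "open (snd c ` (U \<inter> fst c))"
    using U(1) chart_domain[OF c(1)] by (intro open_chart_image[OF c(1)]) auto
  obtain r where r: "r > 0" "cball ?p r \<subseteq> snd c ` (U \<inter> fst c)"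
    using op open_contains_cball U(2) c(2) by (metis IntI imageI)
  then have rI: "cball ?p r \<subseteq> snd c ` fst c" by blast
  define K where "K = chart_inv c ` cball ?p r"
  have K: "compactin M K"
    unfolding K_def
  proof (rule image_compactin[OF _ continuous_map_chart_inv[OF c(1)]])
    show "compactin (top_of_set (snd c ` fst c)) (cball ?p r)"
      using rI by (simp add: compactin_subtopology)
  qed
  have Kiff: "q \<in> K \<longleftrightarrow> q \<in> fst c \<and> snd c q \<in> cball ?p r" for q
  proof
    assume "q \<in> K"
    then obtain y where y: "y \<in> cball ?p r" "q = chart_inv c y" unfolding K_def by blast
    then show "q \<in> fst c \<and> snd c q \<in> cball ?p r" using subsetD[OF rI y(1)] by simp
  next
    assume "q \<in> fst c \<and> snd c q \<in> cball ?p r"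
    then show "q \<in> K" unfolding K_def using c(1) by (intro image_eqI[of q "chart_inv c" "snd c q"]) auto
  qed
  have KU: "K \<subseteq> U" using r(2) c(1) unfolding K_def by force
  have "(r / 2)\<^sup>2 < r\<^sup>2" using r(1) by (simp add: power2_eq_square)
  then obtain \<sigma> \<sigma>' :: "real \<Rightarrow> real" where \<sigma>: "\<And>k. Ck_on k UNIV \<sigma>" "\<And>x. \<sigma> x \<in> {0..1}"
    "\<And>x. x \<le> (r / 2)\<^sup>2 \<Longrightarrow> \<sigma> x = 0" "\<And>x. x \<ge> r\<^sup>2 \<Longrightarrow> \<sigma> x = 1"
    by (rule smooth_step) blast
  \<comment> \<open>The squared distance is smooth at the centre too, which is why the thresholds
    for \<open>\<sigma>\<close> are squares.\<close>
  define g where "g y = 1 - \<sigma> ((y - ?p) \<bullet> (y - ?p))" for y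
  have gC: "Ck_on k UNIV g" for k
  proof -
    have "Ck_on k UNIV (\<lambda>y. (y - ?p) \<bullet> (y - ?p))"
      by (intro Ck_on_inner Ck_on_diff Ck_on_id Ck_on_const open_UNIV)
    from Ck_on_compose[OF open_UNIV open_UNIV \<sigma>(1) this subset_UNIV]
    show ?thesis unfolding g_def by (intro Ck_on_diff Ck_on_const open_UNIV)
  qed
  have g0: "g y = 0" if "y \<notin> cball ?p r" for y
  proof -
    have "r \<le> norm (y - ?p)" using that by (simp add: dist_norm norm_minus_commute)
    then have "r\<^sup>2 \<le> (y - ?p) \<bullet> (y - ?p)" using r(1) by (simp add: power2_norm_eq_inner[symmetric] power_mono)
    then show ?thesis using \<sigma>(4) by (simp add: g_def)
  qed
  have g1: "g y = 1" if "y \<in> ball ?p (r / 2)" for y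
  proof -
    have "norm (y - ?p) \<le> r / 2" using that by (simp add: dist_norm norm_minus_commute)
    then have "(y - ?p) \<bullet> (y - ?p) \<le> (r / 2)\<^sup>2" using power_mono[of "norm (y - ?p)" "r / 2" 2]
      by (simp add: power2_norm_eq_inner[symmetric])
    then show ?thesis using \<sigma>(3) by (simp add: g_def)
  qed
  define \<beta> where "\<beta> q = (if q \<in> fst c then g (snd c q) else 0)" for q
  have \<beta>0: "\<beta> q = 0" if "q \<notin> K" for q using that g0 by (auto simp: \<beta>_def Kiff)
  have "smooth_fun \<beta>"
    unfolding smooth_fun_def
  proof
    fix d assume d: "d \<in> A"
    have "Ck_on k (snd d ` fst d) (\<lambda>y. \<beta> (chart_inv d y))" for k
    proof (rule Ck_on_local)
      fix y assume y: "y \<in> snd d ` fst d"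
      show "\<exists>W. open W \<and> y \<in> W \<and> Ck_on k W (\<lambda>y. \<beta> (chart_inv d y))"
      proof (cases "chart_inv d y \<in> fst c")
        case True
        let ?W = "snd d ` (fst d \<inter> fst c)"
        have W: "open ?W" by (rule open_overlap[OF d c(1)])
        have "y \<in> ?W" using y True d by (intro image_eqI[of y "snd d" "chart_inv d y"]) auto
        moreover have "Ck_on k ?W (\<lambda>y. g (transition d c y))"
          by (rule Ck_on_compose[OF W open_UNIV gC Ck_on_transition[OF d c(1)] subset_UNIV])
        then have "Ck_on k ?W (\<lambda>y. \<beta> (chart_inv d y))"
          by (rule Ck_on_cong[OF W, THEN iffD1, rotated]) (use d in \<open>auto simp: \<beta>_def transition_def\<close>)
        ultimately show ?thesis using W by blast
      next
        case False
        let ?W = "snd d ` (fst d - K)"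
        have "closedin M K" using compactin_imp_closedin[OF Hausdorff K] .
        then have "openin M (fst d - K)" using chart_domain[OF d] by (simp add: openin_diff)
        then have W: "open ?W" by (rule open_chart_image[OF d]) auto
        have "y \<in> ?W" using y False d by (intro image_eqI[of y "snd d" "chart_inv d y"]) (auto simp: Kiff)
        moreover have "Ck_on k ?W (\<lambda>y. \<beta> (chart_inv d y))"
          by (rule Ck_on_cong[OF W, THEN iffD1, OF _ Ck_on_const[of _ _ 0]]) (use d \<beta>0 in auto)
        ultimately show ?thesis using W by blast
      qed
    qed
    then show "smooth_on (snd d ` fst d) (\<lambda>y. \<beta> (chart_inv d y))"
      using smooth_on_open[OF chart_image[OF d]] by blast
  qed
  show ?thesis
  proof (rule that[OF _ _ K KU \<open>smooth_fun \<beta>\<close> _ _ \<beta>0])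
    show "openin M {q \<in> fst c. snd c q \<in> ball ?p (r / 2)}" by (rule openin_chart_vimage[OF c(1) open_ball])
    show "p \<in> {q \<in> fst c. snd c q \<in> ball ?p (r / 2)}" using c(2) r(1) by simp
    show "\<beta> q \<in> {0..1}" for q using \<sigma>(2)[of "(snd c q - ?p) \<bullet> (snd c q - ?p)"] by (auto simp: \<beta>_def g_def)
    show "\<beta> q = 1" if "q \<in> {q \<in> fst c. snd c q \<in> ball ?p (r / 2)}" for q
      using that g1 by (auto simp: \<beta>_def)
  qed
qed

lemma cutoff_function:
  assumes U: "openin M U" and Y: "compactin M Y" "Y \<subseteq> U"
  obtains \<kappa> N K where "openin M N" "Y \<subseteq> N" "compactin M K" "K \<subseteq> U" "smooth_fun \<kappa>"
    "\<And>q. \<kappa> q \<in> {0..1}" "\<And>q. q \<in> N \<Longrightarrow> \<kappa> q = 1" "\<And>q. q \<notin> K \<Longrightarrow> \<kappa> q = 0"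
proof -
  define G where "G N \<beta> K \<longleftrightarrow> compactin M K \<and> K \<subseteq> U \<and> smooth_fun \<beta> \<and> (\<forall>q. \<beta> q \<in> {0..1}) \<and>
     (\<forall>q\<in>N. \<beta> q = 1) \<and> (\<forall>q. q \<notin> K \<longrightarrow> \<beta> q = 0)" for N \<beta> K
  define \<U> where "\<U> = {N. openin M N \<and> (\<exists>z. G N (fst z) (snd z))}"
  have "Y \<subseteq> \<Union>\<U>"
  proof
    fix p assume "p \<in> Y"
    then have "p \<in> U" using Y by blast
    from bump_function[OF U this] obtain \<beta> N K where "openin M N" "p \<in> N" "G N \<beta> K"
      unfolding G_def by metis
    then have "N \<in> \<U>" unfolding \<U>_def by auto
    with \<open>p \<in> N\<close> show "p \<in> \<Union>\<U>" by blast
  qed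
  then obtain \<F> where \<F>: "finite \<F>" "\<F> \<subseteq> \<U>" "Y \<subseteq> \<Union>\<F>"
    using Y(1) unfolding compactin_def by (metis (no_types, lifting) \<U>_def mem_Collect_eq)
  then have "\<forall>N\<in>\<F>. \<exists>z. G N (fst z) (snd z)" by (auto simp: \<U>_def)
  from bchoice[OF this] obtain z where z: "\<forall>N\<in>\<F>. G N (fst (z N)) (snd (z N))" ..
  define \<beta> where "\<beta> N = fst (z N)" for N
  define K where "K N = snd (z N)" for N
  have G: "compactin M (K N)" "K N \<subseteq> U" "smooth_fun (\<beta> N)" "\<beta> N q \<in> {0..1}" "q \<in> N \<Longrightarrow> \<beta> N q = 1"
    "q \<notin> K N \<Longrightarrow> \<beta> N q = 0" if "N \<in> \<F>" for N q
    using bspec[OF z that] unfolding G_def \<beta>_def K_def by blast+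
  \<comment> \<open>This is 1 as soon as one bump is 1 and 0 where all of them vanish; unlike a sum
    it stays in \<open>{0..1}\<close>.\<close>
  define \<kappa> where "\<kappa> q = 1 - (\<Prod>N\<in>\<F>. 1 - \<beta> N q)" for q
  show ?thesis
  proof (rule that[of "\<Union>\<F>" "\<Union>(K ` \<F>)" \<kappa>])
    show "openin M (\<Union>\<F>)" using \<F>(2) by (auto simp: \<U>_def)
    show "Y \<subseteq> \<Union>\<F>" by fact
    show "compactin M (\<Union>(K ` \<F>))" using G(1) \<F>(1) by (intro compactin_Union) auto
    show "\<Union>(K ` \<F>) \<subseteq> U" using G(2) by blast
    show "smooth_fun \<kappa>"
      using G(3) unfolding \<kappa>_def smooth_fun_def
      by (intro ballI smooth_on_diff smooth_on_const smooth_on_prod) blast+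
    show "\<kappa> q \<in> {0..1}" for q
    proof -
      have "0 \<le> (\<Prod>N\<in>\<F>. 1 - \<beta> N q)" using G(4) by (intro prod_nonneg) auto
      moreover have "(\<Prod>N\<in>\<F>. 1 - \<beta> N q) \<le> 1" using G(4) by (intro prod_le_1) auto
      ultimately show ?thesis by (simp add: \<kappa>_def)
    qed
    show "\<kappa> q = 1" if "q \<in> \<Union>\<F>" for q
    proof -
      obtain N where "N \<in> \<F>" "q \<in> N" using \<open>q \<in> \<Union>\<F>\<close> by blast
      then have "1 - \<beta> N q = 0" using G(5) by simp
      then have "(\<Prod>N\<in>\<F>. 1 - \<beta> N q) = 0" using \<F>(1) \<open>N \<in> \<F>\<close> by (intro prod_zero) auto
      then show ?thesis by (simp add: \<kappa>_def)
    qed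
    show "\<kappa> q = 0" if "q \<notin> \<Union>(K ` \<F>)" for q
      using G(6) that by (simp add: \<kappa>_def)
  qed
qed

text \<open>Uniform continuity on \<open>{0..1}\<close> times a closed coordinate ball gives, around
  each point of \<open>Y\<close>, a neighbourhood that serves all times at once.\<close>

lemma smooth_time_fun_neighbourhood:
  assumes H: "smooth_time_fun A H" and Y: "Y \<subseteq> topspace M" and \<epsilon>: "\<epsilon> > 0"
  obtains U where "openin M U" "Y \<subseteq> U"
    "\<And>t q. t \<in> {0..1} \<Longrightarrow> q \<in> U \<Longrightarrow> \<exists>y\<in>Y. \<bar>H t q - H t y\<bar> \<le> \<epsilon>"
proof -
  define \<U> where "\<U> = {N. openin M N \<and> (\<exists>y\<in>Y. \<forall>t\<in>{0..1}. \<forall>q\<in>N. \<bar>H t q - H t y\<bar> \<le> \<epsilon>)}"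
  have "Y \<subseteq> \<Union>\<U>"
  proof
    fix y assume y: "y \<in> Y"
    then have "y \<in> topspace M" using Y by blast
    then obtain c where c: "c \<in> A" "y \<in> fst c" using charts_at_nonempty unfolding charts_at_iff by blast
    let ?y = "snd c y" and ?g = "\<lambda>(t, z). H t (chart_inv c z)"
    obtain r where r: "r > 0" "cball ?y r \<subseteq> snd c ` fst c"
      using chart_image[OF c(1)] open_contains_cball c(2) by (metis imageI)
    have "continuous_on ({0..1} \<times> snd c ` fst c) ?g"
      by (rule smooth_on_imp_continuous_on[OF H[unfolded smooth_time_fun_def, rule_format, OF c(1)]])
    then have "continuous_on ({0..1} \<times> cball ?y r) ?g"
      using r(2) by (elim continuous_on_subset) auto
    then have "uniformly_continuous_on ({0..1} \<times> cball ?y r) ?g"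
      by (rule compact_uniformly_continuous) (intro compact_Times compact_Icc compact_cball)
    then obtain d where d: "d > 0" "\<And>z z'. z \<in> {0..1} \<times> cball ?y r \<Longrightarrow> z' \<in> {0..1} \<times> cball ?y r \<Longrightarrow>
        dist z' z < d \<Longrightarrow> dist (?g z') (?g z) < \<epsilon>"
      unfolding uniformly_continuous_on_def using \<epsilon> by metis
    define N where "N = {q \<in> fst c. snd c q \<in> ball ?y (min r d)}"
    have "\<bar>H t q - H t y\<bar> \<le> \<epsilon>" if t: "t \<in> {0..1}" and q: "q \<in> N" for t q
    proof -
      have "dist (?g (t, snd c q)) (?g (t, ?y)) < \<epsilon>"
        using q t r(1) by (intro d(2)) (auto simp: N_def dist_Pair_Pair dist_commute)
      then show ?thesis using q c by (simp add: N_def dist_real_def)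
    qed
    moreover have "openin M N" unfolding N_def by (rule openin_chart_vimage[OF c(1) open_ball])
    ultimately have "N \<in> \<U>" using y unfolding \<U>_def by blast
    moreover have "y \<in> N" using c r d by (simp add: N_def)
    ultimately show "y \<in> \<Union>\<U>" by blast
  qed
  moreover have "openin M (\<Union>\<U>)" by (auto simp: \<U>_def)
  moreover have "\<exists>y\<in>Y. \<bar>H t q - H t y\<bar> \<le> \<epsilon>" if "t \<in> {0..1}" "q \<in> \<Union>\<U>" for t q
    using that unfolding \<U>_def by blast
  ultimately show ?thesis by (intro that[of "\<Union>\<U>"])
qed

lemma smooth_time_fun_cutoff:
  assumes H: "smooth_time_fun A H" and \<kappa>: "smooth_fun \<kappa>" and y0: "y0 \<in> topspace M"
  shows "smooth_time_fun A (\<lambda>t p. \<kappa> p * (H t p - H t y0))"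
  unfolding smooth_time_fun_def
proof
  fix c assume c: "c \<in> A"
  let ?S = "{0..1} \<times> snd c ` fst c"
  have fst: "smooth_on ?S fst" and snd: "smooth_on ?S snd"
    by (intro smooth_on_bounded_linear bounded_linear_fst bounded_linear_snd)+
  have 1: "smooth_on ?S (\<lambda>z. \<kappa> (chart_inv c (snd z)))"
    by (rule smooth_on_compose[OF \<kappa>[unfolded smooth_fun_def, rule_format, OF c] snd]) auto
  have 2: "smooth_on ?S (\<lambda>z. H (fst z) (chart_inv c (snd z)))"
    using H c unfolding smooth_time_fun_def case_prod_unfold by blast
  \<comment> \<open>\<open>y0\<close> may lie outside the chart \<open>c\<close>, so the function
    \<open>H t y0\<close> of time is read in a chart around \<open>y0\<close>.\<close>
  obtain d where d: "d \<in> A" "y0 \<in> fst d" using charts_at_nonempty[OF y0] unfolding charts_at_iff by blast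
  have "smooth_on ?S (\<lambda>z. (fst z, snd d y0))" by (intro smooth_on_Pair fst smooth_on_const)
  moreover have "(\<lambda>z. (fst z, snd d y0)) ` ?S \<subseteq> {0..1} \<times> snd d ` fst d" using d by auto
  ultimately have "smooth_on ?S (\<lambda>z. (\<lambda>(t, y). H t (chart_inv d y)) (fst z, snd d y0))"
    using H d(1) smooth_on_compose unfolding smooth_time_fun_def by blast
  then have 3: "smooth_on ?S (\<lambda>z. H (fst z) y0)" using d by simp
  show "smooth_on ?S (\<lambda>(t, y). \<kappa> (chart_inv c y) * (H t (chart_inv c y) - H t y0))"
    unfolding case_prod_unfold by (intro smooth_on_mult smooth_on_diff 1 2 3)
qed

end

text \<open>The function \<open>f - f y0\<close> takes the value 0 on \<open>Y\<close>, so
  multiplying by \<open>\<kappa>\<close> pulls values towards a value already attained. Where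
  \<open>\<kappa>\<close> is nonzero, \<open>f\<close> is \<open>\<epsilon>\<close>-close to a value
  on \<open>Y\<close>; each end of the range thus costs one \<open>\<epsilon>\<close>.\<close>

lemma osc_cutoff:
  assumes \<kappa>: "\<And>q. \<kappa> q \<in> {0..1::real}" and y0: "y0 \<in> Y" and \<epsilon>: "\<epsilon> \<ge> 0"
    and near: "\<And>q. \<kappa> q \<noteq> 0 \<Longrightarrow> \<exists>y\<in>Y. \<bar>f q - f y\<bar> \<le> \<epsilon>"
  shows "osc Y' (\<lambda>q. \<kappa> q * (f q - f y0)) \<le> osc Y f + ennreal (2 * \<epsilon>)"
proof (rule osc_least)
  fix p q
  have up: "\<exists>y\<in>Y. \<kappa> q * (f q - f y0) \<le> f y - f y0 + \<epsilon>" for q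
  proof (cases "\<kappa> q \<noteq> 0 \<and> f q - f y0 \<ge> 0")
    case True
    then obtain y where y: "y \<in> Y" "\<bar>f q - f y\<bar> \<le> \<epsilon>" using near by blast
    have "\<kappa> q * (f q - f y0) \<le> 1 * (f q - f y0)" using True \<kappa>[of q] by (intro mult_right_mono) auto
    then show ?thesis using y by (intro bexI[of _ y]) auto
  next
    case False
    then have "\<kappa> q * (f q - f y0) \<le> 0" using \<kappa>[of q] by (auto simp: mult_nonneg_nonpos)
    then show ?thesis using y0 \<epsilon> by (intro bexI[of _ y0]) auto
  qed
  have low: "\<exists>y\<in>Y. f y - f y0 - \<epsilon> \<le> \<kappa> q * (f q - f y0)" for q
  proof (cases "\<kappa> q \<noteq> 0 \<and> f q - f y0 \<le> 0")
    case True
    then obtain y where y: "y \<in> Y" "\<bar>f q - f y\<bar> \<le> \<epsilon>" using near by blast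
    have "1 * (f q - f y0) \<le> \<kappa> q * (f q - f y0)" using True \<kappa>[of q] by (intro mult_right_mono_neg) auto
    then show ?thesis using y by (intro bexI[of _ y]) auto
  next
    case False
    then have "\<kappa> q * (f q - f y0) \<ge> 0" using \<kappa>[of q] by auto
    then show ?thesis using y0 \<epsilon> by (intro bexI[of _ y0]) auto
  qed
  obtain y y' where y: "y \<in> Y" "y' \<in> Y"
    "\<kappa> p * (f p - f y0) - \<kappa> q * (f q - f y0) \<le> f y - f y' + 2 * \<epsilon>"
    using up[of p] low[of q] by force
  have "ennreal (\<kappa> p * (f p - f y0) - \<kappa> q * (f q - f y0)) \<le> ennreal (f y - f y' + 2 * \<epsilon>)"
    using y(3) by (rule ennreal_leI)
  also have "\<dots> \<le> ennreal (f y - f y') + ennreal (2 * \<epsilon>)"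
    using \<epsilon> by (cases "f y - f y' \<ge> 0")
      (auto simp: ennreal_plus[symmetric] ennreal_neg simp del: ennreal_plus intro!: ennreal_leI)
  also have "\<dots> \<le> osc Y f + ennreal (2 * \<epsilon>)" by (intro add_right_mono osc_upper y)
  finally show "ennreal (\<kappa> p * (f p - f y0) - \<kappa> q * (f q - f y0)) \<le> osc Y f + ennreal (2 * \<epsilon>)" .
qed

section \<open>Extending a Hamiltonian from \<open>Y\<close> to \<open>Y'\<close>\<close>

context symplectic_manifold
begin

text \<open>A curve that is outside \<open>K\<close> at some time is constant, so a curve that meets
  \<open>Y\<close> cannot leave it. Completeness provides a curve through every point of
  \<open>Y\<close> at every time, which makes the flow map \<open>Y\<close> onto itself.\<close>

lemma Ham_fun_compact_support:
  assumes H: "smooth_time_fun A H" and K: "compactin M K" "K \<subseteq> Y"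
    and H0: "\<And>t q. q \<in> topspace M \<Longrightarrow> q \<notin> K \<Longrightarrow> H t q = 0" and Y: "Y \<subseteq> topspace M"
  shows "H \<in> Ham_fun M A \<omega> Y"
proof -
  let ?V = "ham_vf A \<omega> H"
  have V: "smooth_vf ?V" by (rule ham_vf_smooth[OF H])
  have "openin M (topspace M - K)" using compactin_imp_closedin[OF Hausdorff K(1)] by blast
  then have V0: "?V s p = (\<lambda>c. 0)" if "p \<in> topspace M" "p \<notin> K" for s p
    by (rule ham_vf_zero[where k=0]) (use H0 that in auto)
  have stay: "x s \<in> Y" if x: "solves ?V {0..1} x" and t: "t \<in> {0..1}" "x t \<in> Y" and s: "s \<in> {0..1}" for x t s
  proof (rule ccontr)
    assume "x s \<notin> Y"
    then have "x s \<notin> K" using K by blast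
    then have "x t = x s"
      using solves_const_outside[where V="?V" and t=s, OF V V0[OF solves_in[OF x s]] x s t(1)] by simp
    with t \<open>x s \<notin> Y\<close> show False by simp
  qed
  have ex: "\<exists>x. solves ?V {0..1} x \<and> x t = q" if "t \<in> {0..1}" "q \<in> topspace M" for t q
    using solves_global_existence[OF V K(1) V0 that] by metis
  have "\<forall>q\<in>Y. \<exists>x. solves ?V {0..1} x \<and> x 0 = q" using ex[of 0] Y by auto
  from bchoice[OF this] obtain \<gamma> where \<gamma>: "\<forall>q\<in>Y. solves ?V {0..1} (\<gamma> q) \<and> \<gamma> q 0 = q" ..
  have "(\<lambda>q. \<gamma> q t) ` Y = Y" if t: "t \<in> {0..1}" for t
  proof
    show "(\<lambda>q. \<gamma> q t) ` Y \<subseteq> Y"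
    proof (rule image_subsetI)
      fix q assume "q \<in> Y"
      then have "solves ?V {0..1} (\<gamma> q)" "\<gamma> q 0 \<in> Y" using \<gamma> by auto
      then show "\<gamma> q t \<in> Y" using stay[of "\<gamma> q" 0 t] t by simp
    qed
    show "Y \<subseteq> (\<lambda>q. \<gamma> q t) ` Y"
    proof
      fix q assume q: "q \<in> Y"
      then obtain x where x: "solves ?V {0..1} x" "x t = q" using ex[OF t] Y by blast
      have x0: "x 0 \<in> Y" by (rule stay[OF x(1) t]) (use x q in auto)
      have "\<gamma> (x 0) t = x t"
        by (rule solves_unique[OF V _ x(1) order_refl, where ?s0.0=0]) (use \<gamma> x0 t in auto)
      with x x0 show "q \<in> (\<lambda>q. \<gamma> q t) ` Y" by (intro image_eqI[of _ _ "x 0"]) auto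
    qed
  qed
  then show ?thesis by (intro Ham_funI(1)[OF H, where \<gamma>=\<gamma>]) (use \<gamma> in auto)
qed

lemma Ham_fun_cutoff:
  assumes H: "H \<in> Ham_fun M A \<omega> Y" and Y: "compactin M Y" "y0 \<in> Y"
    and Y': "closedin M Y'" "Y \<subseteq> M interior_of Y'" and \<epsilon>: "\<epsilon> > 0"
  obtains H' where "H' \<in> Ham_fun M A \<omega> Y'" "\<And>x. x \<in> Y \<Longrightarrow> ham_flow M A \<omega> H' 1 x = ham_flow M A \<omega> H 1 x"
    "osc_norm Y' H' \<le> osc_norm Y H + ennreal (2 * \<epsilon>)"
proof -
  note sH = Ham_fun_smooth[OF H]
  have YM: "Y \<subseteq> topspace M" and Y'M: "Y' \<subseteq> topspace M"
    using Y(1) Y'(1) compactin_subset_topspace closedin_subset by blast+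
  obtain U where U: "openin M U" "Y \<subseteq> U"
    "\<And>t q. t \<in> {0..1} \<Longrightarrow> q \<in> U \<Longrightarrow> \<exists>y\<in>Y. \<bar>H t q - H t y\<bar> \<le> \<epsilon>"
    using smooth_time_fun_neighbourhood[OF sH YM \<epsilon>] by metis
  \<comment> \<open>\<open>U\<close> controls the oscillation on the support of the cutoff; the
    interior keeps this support inside \<open>Y'\<close>.\<close>
  have "openin M (U \<inter> M interior_of Y')" "Y \<subseteq> U \<inter> M interior_of Y'" using U Y' by auto
  from cutoff_function[OF this(1) Y(1) this(2)] obtain \<kappa> N K where
    N: "openin M N" "Y \<subseteq> N" and K: "compactin M K" "K \<subseteq> U \<inter> M interior_of Y'" and \<kappa>: "smooth_fun \<kappa>"
    "\<And>q. \<kappa> q \<in> {0..1}" "\<And>q. q \<in> N \<Longrightarrow> \<kappa> q = 1" "\<And>q. q \<notin> K \<Longrightarrow> \<kappa> q = 0" by metis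
  have KY': "K \<subseteq> Y'" using K(2) interior_of_subset by fastforce
  define H' where "H' = (\<lambda>t p. \<kappa> p * (H t p - H t y0))"
  have sH': "smooth_time_fun A H'"
    unfolding H'_def using smooth_time_fun_cutoff[OF sH \<kappa>(1)] Y(2) YM by blast
  have H'Ham: "H' \<in> Ham_fun M A \<omega> Y'"
    by (rule Ham_fun_compact_support[OF sH' K(1) KY' _ Y'M]) (simp add: H'_def \<kappa>(4))
  have eqN: "ham_vf A \<omega> H t p = ham_vf A \<omega> H' t p" if "p \<in> N" "t \<in> {0..1}" for t p
  proof -
    have "ham_vf A \<omega> H' t p = (\<lambda>c. 1 *\<^sub>R ham_vf A \<omega> H t p c)"
      by (rule ham_vf_affine[where H=H and s=t and k="- H t y0", OF N(1) that(1) smooth_time_fun_mdiff[OF sH that(2)]])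
         (simp add: H'_def \<kappa>(3))
    then show ?thesis by simp
  qed
  obtain \<gamma> where \<gamma>: "\<And>x. x \<in> Y \<Longrightarrow> solves (ham_vf A \<omega> H) {0..1} (\<gamma> x)" "\<And>x. x \<in> Y \<Longrightarrow> \<gamma> x 0 = x"
    "\<And>t. t \<in> {0..1} \<Longrightarrow> (\<lambda>x. \<gamma> x t) ` Y = Y"
    "\<And>x t. x \<in> Y \<Longrightarrow> t \<in> {0..1} \<Longrightarrow> ham_flow M A \<omega> H t x = \<gamma> x t"
    using Ham_funE[OF H] by metis
  have fl: "ham_flow M A \<omega> H' 1 x = ham_flow M A \<omega> H 1 x" if x: "x \<in> Y" for x
  proof -
    \<comment> \<open>Compatibility keeps the old curve in \<open>Y\<close>, hence in the
      neighbourhood \<open>N\<close> where both fields agree; so it also solves the new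
      equation.\<close>
    have "\<gamma> x s \<in> N" if "s \<in> {0..1}" for s using \<gamma>(3)[OF that] x N(2) by blast
    then have "solves (ham_vf A \<omega> H') {0..1} (\<gamma> x)"
      by (intro solves_cong[OF \<gamma>(1)[OF x] refl] eqN)
    from flow_eq[OF ham_vf_smooth[OF sH'] this, of 1] show ?thesis
      using \<gamma>(2,4)[OF x] by (simp add: ham_flow_def)
  qed
  have osc_le: "osc Y' (H' t) \<le> osc Y (H t) + ennreal (2 * \<epsilon>)" if t: "t \<in> {0..1}" for t
    unfolding H'_def
  proof (rule osc_cutoff[OF \<kappa>(2) Y(2)])
    fix q assume "\<kappa> q \<noteq> 0"
    then have "q \<in> U" using \<kappa>(4) K(2) by blast
    then show "\<exists>y\<in>Y. \<bar>H t q - H t y\<bar> \<le> \<epsilon>" by (rule U(3)[OF t])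
  qed (use \<epsilon> in simp)
  have "osc_norm Y' H' \<le> (\<integral>\<^sup>+t. osc Y (H t) * indicator {0..1} t + ennreal (2 * \<epsilon>) * indicator {0..1} t \<partial>lborel)"
    unfolding osc_norm_eq using osc_le by (intro nn_integral_mono) (auto simp: indicator_def)
  also have "\<dots> = osc_norm Y H + ennreal (2 * \<epsilon>)"
    using osc_measurable[of Y H] smooth_time_fun_continuous[OF sH] YM
    by (subst nn_integral_add) (auto simp: osc_norm_eq nn_integral_cmult_indicator)
  finally show ?thesis using H'Ham fl by (intro that[of H'])
qed

section \<open>The group and its semi-norm\<close>

lemma HamE:
  assumes "\<phi> \<in> Ham M A \<omega> X"
  obtains H where "H \<in> Ham_fun M A \<omega> X" "\<phi> = restrict (ham_flow M A \<omega> H 1) X"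
  using assms unfolding Ham_def by blast

lemma HamI: "H \<in> Ham_fun M A \<omega> X \<Longrightarrow> restrict (ham_flow M A \<omega> H 1) X \<in> Ham M A \<omega> X"
  unfolding Ham_def by blast

lemma Ham_maps: "\<phi> \<in> Ham M A \<omega> X \<Longrightarrow> x \<in> X \<Longrightarrow> \<phi> x \<in> X"
  using Ham_flow_image by (metis HamE imageI restrict_apply')

lemma Ham_extensional: "\<phi> \<in> Ham M A \<omega> X \<Longrightarrow> \<phi> \<in> extensional X"
  by (auto elim: HamE)

lemma Ham_fun_product:
  assumes H: "H \<in> Ham_fun M A \<omega> X" "H' \<in> Ham_fun M A \<omega> X" and X: "X \<subseteq> topspace M"
  obtains K where "K \<in> Ham_fun M A \<omega> X"
    "\<And>x. x \<in> X \<Longrightarrow> ham_flow M A \<omega> K 1 x = ham_flow M A \<omega> H' 1 (ham_flow M A \<omega> H 1 x)"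
    "osc_norm X K \<le> osc_norm X H' + osc_norm X H"
proof -
  obtain \<rho> \<rho>' :: "real \<Rightarrow> real" where \<rho>: "\<And>k. Ck_on k UNIV \<rho>" "\<And>k. Ck_on k UNIV \<rho>'"
    "\<And>x. (\<rho> has_real_derivative \<rho>' x) (at x)" "\<And>x. \<rho>' x \<ge> 0" "\<And>x. \<rho> x \<in> {0..1}"
    "\<And>x. x \<le> 0 \<Longrightarrow> \<rho> x = 0" "\<And>x. x \<ge> 1/3 \<Longrightarrow> \<rho> x = 1" "\<And>x. x \<ge> 1/3 \<Longrightarrow> \<rho>' x = 0"
    by (rule smooth_step[of 0 "1/3"]) (simp, blast)
  obtain \<sigma> \<sigma>' :: "real \<Rightarrow> real" where \<sigma>: "\<And>k. Ck_on k UNIV \<sigma>" "\<And>k. Ck_on k UNIV \<sigma>'"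
    "\<And>x. (\<sigma> has_real_derivative \<sigma>' x) (at x)" "\<And>x. \<sigma>' x \<ge> 0" "\<And>x. \<sigma> x \<in> {0..1}"
    "\<And>x. x \<le> 2/3 \<Longrightarrow> \<sigma> x = 0" "\<And>x. x \<ge> 1 \<Longrightarrow> \<sigma> x = 1" "\<And>x. x \<le> 2/3 \<Longrightarrow> \<sigma>' x = 0"
    by (rule smooth_step[of "2/3" 1]) (simp, blast)
  define K where "K = (\<lambda>t p. \<rho>' t * H (\<rho> t) p + \<sigma>' t * H' (\<sigma> t) p)"
  note K = Ham_fun_concat[OF H \<rho>(1-3,5-8) \<sigma>(1-3,5-8), folded K_def]
  have c: "continuous_on {0..1} (\<lambda>t. H t x)" "continuous_on {0..1} (\<lambda>t. H' t x)" if "x \<in> X" for x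
    using smooth_time_fun_continuous[OF Ham_fun_smooth] H X that by blast+
  have c\<rho>: "continuous_on UNIV \<rho>'" and c\<sigma>: "continuous_on UNIV \<sigma>'"
    using \<rho>(2)[of 0] \<sigma>(2)[of 0] by auto
  have v: "\<rho> 0 = 0" "\<rho> 1 = 1" "\<sigma> 0 = 0" "\<sigma> 1 = 1" using \<rho>(6,7) \<sigma>(6,7) by auto
  let ?a = "\<lambda>t. osc X (H (\<rho> t)) * ennreal (\<rho>' t) * indicator {0..1} t"
  let ?b = "\<lambda>t. osc X (H' (\<sigma> t)) * ennreal (\<sigma>' t) * indicator {0..1} t"
  note a = osc_norm_reparam[where X=X and H=H, OF c(1) \<rho>(3) c\<rho> \<rho>(4) v(1,2) \<rho>(5)]
  note b = osc_norm_reparam[where X=X and H=H', OF c(2) \<sigma>(3) c\<sigma> \<sigma>(4) v(3,4) \<sigma>(5)]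
  \<comment> \<open>Monotonicity of the steps enters here: a factor can be pulled out of
    \<open>osc\<close> by \<open>osc_scale\<close> because it is nonnegative.\<close>
  have "osc X (K t) \<le> osc X (H (\<rho> t)) * ennreal (\<rho>' t) + osc X (H' (\<sigma> t)) * ennreal (\<sigma>' t)" for t
    unfolding K_def osc_scale[OF \<rho>(4), symmetric] osc_scale[OF \<sigma>(4), symmetric] by (rule osc_add)
  then have "osc_norm X K \<le> (\<integral>\<^sup>+t. ?a t + ?b t \<partial>lborel)"
    unfolding osc_norm_eq by (intro nn_integral_mono) (simp add: indicator_def)
  also have "\<dots> = osc_norm X H + osc_norm X H'"
    using a b by (subst nn_integral_add) auto
  finally show ?thesis using K by (intro that[of K]) (auto simp: add.commute)
qed

lemma Ham_compose:
  assumes X: "X \<subseteq> topspace M" and "\<phi> \<in> Ham M A \<omega> X" "\<psi> \<in> Ham M A \<omega> X"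
  shows "compose X \<phi> \<psi> \<in> Ham M A \<omega> X"
proof -
  obtain H H' where H: "H \<in> Ham_fun M A \<omega> X" "\<psi> = restrict (ham_flow M A \<omega> H 1) X"
    "H' \<in> Ham_fun M A \<omega> X" "\<phi> = restrict (ham_flow M A \<omega> H' 1) X" using assms by (metis HamE)
  obtain K where K: "K \<in> Ham_fun M A \<omega> X"
    "\<And>x. x \<in> X \<Longrightarrow> ham_flow M A \<omega> K 1 x = ham_flow M A \<omega> H' 1 (ham_flow M A \<omega> H 1 x)"
    using Ham_fun_product[OF H(1,3) X] by metis
  have "compose X \<phi> \<psi> = restrict (ham_flow M A \<omega> K 1) X"
    using Ham_maps[OF assms(3)] K(2) by (auto simp: compose_def fun_eq_iff restrict_def H(2,4))
  then show ?thesis using HamI[OF K(1)] by simp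
qed

lemma Ham_left_inverse:
  assumes "H \<in> Ham_fun M A \<omega> X"
  shows "compose X (restrict (ham_flow M A \<omega> (\<lambda>t p. - H (1 - t) p) 1) X) (restrict (ham_flow M A \<omega> H 1) X)
    = restrict id X"
  using Ham_fun_reverse(2)[OF assms] Ham_flow_image[OF assms]
  by (auto simp: compose_def fun_eq_iff restrict_def)

lemma group_Ham:
  assumes X: "X \<subseteq> topspace M"
  shows "group (Ham_group M A \<omega> X)"
proof (rule groupI)
  let ?G = "Ham_group M A \<omega> X"
  have one: "restrict id X = restrict (ham_flow M A \<omega> (\<lambda>t p. 0) 1) X"
    using Ham_fun_zero(2)[OF X] by (auto simp: fun_eq_iff restrict_def)
  show "\<one>\<^bsub>?G\<^esub> \<in> carrier ?G"
    using HamI[OF Ham_fun_zero(1)[OF X]] by (simp add: Ham_group_def one)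
  show "\<phi> \<otimes>\<^bsub>?G\<^esub> \<psi> \<in> carrier ?G" if "\<phi> \<in> carrier ?G" "\<psi> \<in> carrier ?G" for \<phi> \<psi>
    using Ham_compose[OF X] that by (simp add: Ham_group_def)
  show "\<phi> \<otimes>\<^bsub>?G\<^esub> \<psi> \<otimes>\<^bsub>?G\<^esub> \<theta> = \<phi> \<otimes>\<^bsub>?G\<^esub> (\<psi> \<otimes>\<^bsub>?G\<^esub> \<theta>)"
    if "\<phi> \<in> carrier ?G" "\<psi> \<in> carrier ?G" "\<theta> \<in> carrier ?G" for \<phi> \<psi> \<theta>
    using that Ham_maps[of \<theta> X] by (auto simp: Ham_group_def compose_def fun_eq_iff restrict_def)
  show "\<one>\<^bsub>?G\<^esub> \<otimes>\<^bsub>?G\<^esub> \<phi> = \<phi>" if "\<phi> \<in> carrier ?G" for \<phi>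
    using that Ham_maps[of \<phi> X] Ham_extensional[of \<phi> X]
    by (auto simp: Ham_group_def compose_def fun_eq_iff restrict_def extensional_def)
  show "\<exists>\<psi>\<in>carrier ?G. \<psi> \<otimes>\<^bsub>?G\<^esub> \<phi> = \<one>\<^bsub>?G\<^esub>" if "\<phi> \<in> carrier ?G" for \<phi>
  proof -
    have "\<phi> \<in> Ham M A \<omega> X" using that by (simp add: Ham_group_def)
    then obtain H where H: "H \<in> Ham_fun M A \<omega> X" "\<phi> = restrict (ham_flow M A \<omega> H 1) X"
      by (rule HamE)
    then show ?thesis
      using Ham_left_inverse[OF H(1)] HamI[OF Ham_fun_reverse(1)[OF H(1)]] unfolding Ham_group_def by auto
  qed
qed

text \<open>With \<open>rel_hofer_norm_ge\<close> this merges the two nested infima into one, over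
  the Hamiltonians for \<open>Y\<close> whose time-one map restricts to \<open>\<phi>\<close> on
  \<open>X\<close>. The intermediate map on \<open>Y\<close> disappears from the later
  estimates.\<close>

lemma rel_hofer_norm_le:
  assumes "X \<subseteq> Y" "H \<in> Ham_fun M A \<omega> Y" "restrict (ham_flow M A \<omega> H 1) X = \<phi>"
  shows "rel_hofer_norm M A \<omega> X Y \<phi> \<le> osc_norm Y H"
proof -
  let ?\<psi> = "restrict (ham_flow M A \<omega> H 1) Y"
  have "restrict ?\<psi> X = \<phi>" using assms(1,3) by (simp add: Int_absorb1)
  then have "rel_hofer_norm M A \<omega> X Y \<phi> \<le> hofer_norm M A \<omega> Y ?\<psi>"
    unfolding rel_hofer_norm_def using HamI[OF assms(2)] by (intro Inf_lower) blast
  also have "\<dots> \<le> osc_norm Y H"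
    unfolding hofer_norm_def using assms(2) by (intro Inf_lower) blast
  finally show ?thesis .
qed

lemma rel_hofer_norm_ge:
  assumes "X \<subseteq> Y" "\<And>H. H \<in> Ham_fun M A \<omega> Y \<Longrightarrow> restrict (ham_flow M A \<omega> H 1) X = \<phi> \<Longrightarrow> r \<le> osc_norm Y H"
  shows "r \<le> rel_hofer_norm M A \<omega> X Y \<phi>"
  unfolding rel_hofer_norm_def hofer_norm_def
proof (intro Inf_greatest, clarify)
  fix \<psi> assume \<psi>: "\<psi> \<in> Ham M A \<omega> Y" "\<phi> = restrict \<psi> X"
  show "r \<le> Inf {osc_norm Y H |H. H \<in> Ham_fun M A \<omega> Y \<and> restrict (ham_flow M A \<omega> H 1) Y = \<psi>}"
  proof (intro Inf_greatest, clarify)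
    fix H assume H: "H \<in> Ham_fun M A \<omega> Y" "\<psi> = restrict (ham_flow M A \<omega> H 1) Y"
    then have "restrict (ham_flow M A \<omega> H 1) X = \<phi>" using assms(1) \<psi>(2) by (simp add: Int_absorb1)
    with H(1) show "r \<le> osc_norm Y H" by (rule assms(2))
  qed
qed

lemma rel_hofer_norm_one:
  assumes "Y \<subseteq> topspace M" "X \<subseteq> Y"
  shows "rel_hofer_norm M A \<omega> X Y (restrict id X) = 0"
proof -
  have "restrict (ham_flow M A \<omega> (\<lambda>t p. 0) 1) X = restrict id X"
    using Ham_fun_zero(2)[OF assms(1)] assms(2) by (auto simp: fun_eq_iff restrict_def)
  from rel_hofer_norm_le[OF assms(2) Ham_fun_zero(1)[OF assms(1)] this]
  show ?thesis by (simp add: osc_norm_eq osc_const)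
qed

text \<open>Reversing a Hamiltonian that induces \<open>g\<close> leads from
  \<open>x = g (h x)\<close> back to \<open>h x\<close>, at the same cost. Applied to an element and
  to its inverse, this gives the equality of their norms.\<close>

lemma rel_hofer_norm_inverse:
  assumes Y: "Y \<subseteq> topspace M" "X \<subseteq> Y" and h: "\<And>x. x \<in> X \<Longrightarrow> h x \<in> X" "h \<in> extensional X" "\<And>x. x \<in> X \<Longrightarrow> g (h x) = x"
  shows "rel_hofer_norm M A \<omega> X Y h \<le> rel_hofer_norm M A \<omega> X Y g"
proof (rule rel_hofer_norm_ge[OF Y(2)])
  fix H assume H: "H \<in> Ham_fun M A \<omega> Y" "restrict (ham_flow M A \<omega> H 1) X = g"
  let ?K = "\<lambda>t p. - H (1 - t) p"
  have "ham_flow M A \<omega> ?K 1 x = h x" if x: "x \<in> X" for x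
  proof -
    have "ham_flow M A \<omega> H 1 (h x) = x" using h(1,3)[OF x] H(2) by (metis restrict_apply')
    then show ?thesis using Ham_fun_reverse(2)[OF H(1), of "h x"] h(1)[OF x] Y(2) by auto
  qed
  then have "restrict (ham_flow M A \<omega> ?K 1) X = h"
    using h(2) by (auto simp: fun_eq_iff restrict_def extensional_def)
  from rel_hofer_norm_le[OF Y(2) Ham_fun_reverse(1)[OF H(1)] this]
  have "rel_hofer_norm M A \<omega> X Y h \<le> osc_norm Y ?K" .
  also have "\<dots> = osc_norm Y H"
    by (rule osc_norm_reverse) (use smooth_time_fun_continuous[OF Ham_fun_smooth[OF H(1)]] Y(1) in blast)
  finally show "rel_hofer_norm M A \<omega> X Y h \<le> osc_norm Y H" .
qed

lemma rel_hofer_norm_compose: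
  assumes Y: "Y \<subseteq> topspace M" "X \<subseteq> Y" and h: "\<And>x. x \<in> X \<Longrightarrow> h x \<in> X"
  shows "rel_hofer_norm M A \<omega> X Y (compose X g h) \<le> rel_hofer_norm M A \<omega> X Y g + rel_hofer_norm M A \<omega> X Y h"
    (is "?c \<le> ?g + ?h")
proof -
  have le: "?c \<le> osc_norm Y H' + osc_norm Y H"
    if H: "H \<in> Ham_fun M A \<omega> Y" "restrict (ham_flow M A \<omega> H 1) X = h"
      and H': "H' \<in> Ham_fun M A \<omega> Y" "restrict (ham_flow M A \<omega> H' 1) X = g" for H H'
  proof -
    obtain K where K: "K \<in> Ham_fun M A \<omega> Y"
      "\<And>x. x \<in> Y \<Longrightarrow> ham_flow M A \<omega> K 1 x = ham_flow M A \<omega> H' 1 (ham_flow M A \<omega> H 1 x)"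
      "osc_norm Y K \<le> osc_norm Y H' + osc_norm Y H"
      using Ham_fun_product[OF H(1) H'(1) Y(1)] by metis
    have "ham_flow M A \<omega> K 1 x = g (h x)" if x: "x \<in> X" for x
    proof -
      have "ham_flow M A \<omega> H 1 x = h x" "ham_flow M A \<omega> H' 1 (h x) = g (h x)"
        using H(2) H'(2) x h[OF x] by (metis restrict_apply')+
      then show ?thesis using K(2)[of x] x Y(2) by auto
    qed
    then have "restrict (ham_flow M A \<omega> K 1) X = compose X g h"
      by (auto simp: fun_eq_iff restrict_def compose_def)
    from rel_hofer_norm_le[OF Y(2) K(1) this] K(3) show ?thesis by (rule order_trans)
  qed
  \<comment> \<open>Moving one summand to the other side allows the infimum to be taken over one
    Hamiltonian at a time. Subtraction in \<open>ennreal\<close> is delicate only for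
    \<open>a = \<infinity>\<close>, where the claim is trivial.\<close>
  have add_bound: "c \<le> a + b" if "a \<noteq> \<infinity> \<Longrightarrow> c - a \<le> b" for a b c :: ennreal
    using that by (cases "a = \<infinity>") (auto simp: ennreal_minus_le_iff)
  show ?thesis
  proof (subst add.commute, rule add_bound)
    assume h_fin: "?h \<noteq> \<infinity>"
    show "?c - ?h \<le> ?g"
    proof (rule rel_hofer_norm_ge[OF Y(2)])
      fix H' assume H': "H' \<in> Ham_fun M A \<omega> Y" "restrict (ham_flow M A \<omega> H' 1) X = g"
      have "?c \<le> osc_norm Y H' + ?h"
      proof (rule add_bound)
        assume fin: "osc_norm Y H' \<noteq> \<infinity>"
        show "?c - osc_norm Y H' \<le> ?h"
          by (rule rel_hofer_norm_ge[OF Y(2)]) (use le[OF _ _ H'] fin in \<open>simp add: ennreal_minus_le_iff\<close>)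
      qed
      then show "?c - ?h \<le> osc_norm Y H'" using h_fin by (simp add: ennreal_minus_le_iff add.commute)
    qed
  qed
qed

lemma group_seminorm_rel_hofer_norm:
  assumes Y: "Y \<subseteq> topspace M" "X \<subseteq> Y"
  shows "group_seminorm (Ham_group M A \<omega> X) (rel_hofer_norm M A \<omega> X Y)"
proof -
  let ?G = "Ham_group M A \<omega> X" and ?N = "rel_hofer_norm M A \<omega> X Y"
  have X: "X \<subseteq> topspace M" using Y by blast
  interpret group ?G by (rule group_Ham[OF X])
  have carrier: "carrier ?G = Ham M A \<omega> X" and mult: "g \<otimes>\<^bsub>?G\<^esub> h = compose X g h"
    and one: "\<one>\<^bsub>?G\<^esub> = restrict id X" for g h
    by (simp_all add: Ham_group_def)
  have inv_le: "?N (inv\<^bsub>?G\<^esub> g) \<le> ?N g" if g: "g \<in> carrier ?G" for g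
  proof (rule rel_hofer_norm_inverse[OF Y])
    have i: "inv\<^bsub>?G\<^esub> g \<in> Ham M A \<omega> X" using inv_closed[OF g] carrier by simp
    show "(inv\<^bsub>?G\<^esub> g) x \<in> X" if "x \<in> X" for x using Ham_maps[OF i that] .
    show "inv\<^bsub>?G\<^esub> g \<in> extensional X" by (rule Ham_extensional[OF i])
    show "g ((inv\<^bsub>?G\<^esub> g) x) = x" if "x \<in> X" for x
      using fun_cong[OF r_inv[OF g], of x] that by (simp add: mult one compose_eq)
  qed
  show ?thesis
  proof
    show "?N \<one>\<^bsub>?G\<^esub> = 0" unfolding one by (rule rel_hofer_norm_one[OF Y])
    show "?N (inv\<^bsub>?G\<^esub> g) = ?N g" if g: "g \<in> carrier ?G" for g
      using inv_le[OF g] inv_le[OF inv_closed[OF g]] inv_inv[OF g] by simp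
    show "?N (g \<otimes>\<^bsub>?G\<^esub> h) \<le> ?N g + ?N h" if "g \<in> carrier ?G" "h \<in> carrier ?G" for g h
      unfolding mult using that(2) carrier Ham_maps by (intro rel_hofer_norm_compose[OF Y]) auto
  qed
qed

lemma rel_hofer_norm_antimono:
  assumes "X \<subseteq> Y" "closedin M Y'" "Y \<subseteq> M interior_of Y'" "compactin M Y" "Y \<noteq> {}"
  shows "rel_hofer_norm M A \<omega> X Y' \<phi> \<le> rel_hofer_norm M A \<omega> X Y \<phi>"
proof (rule rel_hofer_norm_ge[OF assms(1)])
  fix H assume H: "H \<in> Ham_fun M A \<omega> Y" "restrict (ham_flow M A \<omega> H 1) X = \<phi>"
  obtain y0 where y0: "y0 \<in> Y" using assms(5) by blast
  have XY': "X \<subseteq> Y'" using assms(1,3) interior_of_subset[of M Y'] by blast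
  show "rel_hofer_norm M A \<omega> X Y' \<phi> \<le> osc_norm Y H"
  proof (rule ennreal_le_epsilon)
    fix e :: real assume "e > 0"
    \<comment> \<open>The cutoff with parameter \<open>\<epsilon>\<close> costs
      \<open>2 * \<epsilon>\<close>, so half of \<open>e\<close> is spent.\<close>
    then have "e / 2 > 0" by simp
    from Ham_fun_cutoff[OF H(1) assms(4) y0 assms(2,3) this]
    obtain H' where H': "H' \<in> Ham_fun M A \<omega> Y'" "\<And>x. x \<in> Y \<Longrightarrow> ham_flow M A \<omega> H' 1 x = ham_flow M A \<omega> H 1 x"
      "osc_norm Y' H' \<le> osc_norm Y H + ennreal (2 * (e / 2))" by metis
    have "restrict (ham_flow M A \<omega> H' 1) X = \<phi>"
      unfolding H(2)[symmetric] by (rule restrict_ext) (use H'(2) assms(1) in blast)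
    from rel_hofer_norm_le[OF XY' H'(1) this] H'(3)
    show "rel_hofer_norm M A \<omega> X Y' \<phi> \<le> osc_norm Y H + ennreal e" by simp
  qed
qed

end

theorem proposition4:
  fixes M :: "'a topology"
    and A :: "('a, 'b::{real_inner, heine_borel}) chart set"
    and \<omega> :: "'a \<Rightarrow> ('a, 'b) tvec \<Rightarrow> ('a, 'b) tvec \<Rightarrow> real"
    and X Y :: "'a set"
  assumes "symplectic_manifold M A \<omega>"
    and "closedin M X" and "closedin M Y" and "X \<subseteq> Y"
  shows "group_seminorm (Ham_group M A \<omega> X) (rel_hofer_norm M A \<omega> X Y) \<and>
    (\<forall>Y'. closedin M Y' \<longrightarrow> Y \<subseteq> M interior_of Y' \<longrightarrow> compactin M Y \<longrightarrow> Y \<noteq> {} \<longrightarrow>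
       (\<forall>\<phi>\<in>Ham M A \<omega> X. rel_hofer_norm M A \<omega> X Y \<phi> \<ge> rel_hofer_norm M A \<omega> X Y' \<phi>))"
proof -
  interpret symplectic_manifold M A \<omega> by fact
  show ?thesis
    using group_seminorm_rel_hofer_norm[OF closedin_subset[OF assms(3)] assms(4)]
      rel_hofer_norm_antimono[OF assms(4)] by blast
qed

end
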